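(* Consider $N\ge 2$ reservoirs coupled to a finite-dimensional system by a finite-rank coupling $V$, with one-particle space $\mathcal{H}=\mathcal{H}_{\mathcal{S}}\oplus\bigoplus_{j=1}^N\mathcal{H}_j$, decoupled Hamiltonian $H_0$ and coupled Hamiltonian $H=H_0+V$, satisfying all the assumptions listed in the context; no time reversal symmetry is assumed. Let $\beta_j>0$ and $\mu_j\in\mathbb{R}$ be the inverse temperature and chemical potential of reservoir $j$, let $T(E)=(T_{jk}(E))_{j,k=1}^N$ be the transition matrix at energy $E\in\sigma_0$, let $\Phi_k$ and $\mathcal{I}_k$ be the steady energy and particle currents out of reservoir $k$, and let $$\sigma=-\sum_{k=1}^{N}\beta_{k}\big(\Phi_{k}-\mu_{k}\mathcal{I}_{k}\big)$$ be the entropy production. Suppose that for some $j_0,k_0\in\{1,\dots,N\}$ the scattering is nontrivial in the channel $(j_0,k_0)$, i.e. $T_{j_0k_0}(E)\neq0$ for all $E$ in a subset of $\sigma_0$ of positive Lebesgue measure, and that $(\beta_{j_0},\mu_{j_0})\neq(\beta_{k_0},\mu_{k_0})$. Then $$\sigma>0 .$$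
   Context: Inner products are linear in the second argument; $|a\rangle\langle b|$ denotes the operator $u\mapsto \langle b,u\rangle a$. **Decoupled system.** $\mathcal{H}=\mathcal{H}_{\mathcal{S}}\oplus\bigoplus_{j=1}^N\mathcal{H}_j$ is an orthogonal sum of Hilbert spaces with $\dim\mathcal{H}_{\mathcal{S}}=M<\infty$. $H_{\mathcal{S}}$ and $H_j$ are self-adjoint on $\mathcal{H}_{\mathcal{S}}$ and $\mathcal{H}_j$, and $H_0=H_{\mathcal{S}}+\sum_{j=1}^N H_j$ (direct sum). $\Pi_j$ is the orthogonal projection of $\mathcal{H}$ onto $\mathcal{H}_j$, and $\Pi_0=\sum_{j=1}^N\Pi_j$. Each $H_j$ has simple (multiplicity one) purely absolutely continuous spectrum, the same set $\sigma_0\subset[0,\infty)$ for all $j$. Its spectral representation is given by generalized eigenfunctions $\psi^0_{j,E}\in\mathcal{K}_j^*$, $E\in\sigma_0$, where $\mathcal{K}_j\subset\mathcal{H}_j\subset\mathcal{K}_j^*$ is a Gelfand triple, with $H_j\psi^0_{j,E}=E\psi^0_{j,E}$. That is, $u\mapsto u(E)=\langle\psi^0_{j,E},u\rangle$ (generalized Fourier transform) extends to a unitary map $\mathcal{H}_j\to L^2(\sigma_0,dE)$ turning $H_j$ into multiplication by $E$. **Coupling.** $V$ is self-adjoint of finite rank. Its diagonal blocks in the decomposition $\mathcal{H}_{\mathcal{S}}\oplus\bigoplus_j\mathcal{H}_j$ vanish. Its off-diagonal blocks are $V_{\mathcal{S}j}:\mathcal{H}_j\to\mathcal{H}_{\mathcal{S}}$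 and, for $j<k$, $V_{jk}:\mathcal{H}_k\to\mathcal{H}_j$ (direct contacts between reservoirs), together with their adjoints. Each $V_{\mathcal{S}j}$ is a finite sum $\sum_l v_{jl}|s_{jl}\rangle\langle f_{jl}|$ and each $V_{jk}$ a finite sum of the form $\sum_l v_l|g_{l}\rangle\langle g'_{l}|$, with positive coefficients and with orthonormal systems $\{s_{jl}\}_l\subset\mathcal{H}_{\mathcal{S}}$, $\{f_{jl}\}_l\subset\mathcal{H}_j$, $\{g_l\}_l\subset\mathcal{H}_j$, $\{g'_l\}_l\subset\mathcal{H}_k$ (the coefficients and the systems $g,g'$ depending on the pair $(j,k)$). The vectors in the reservoir spaces appearing here are called the coupling vectors. **Scattering theory.** The Møller operators $\Omega_\pm=\operatorname{s-lim}_{t\to\mp\infty}e^{itH}e^{-itH_0}\Pi_0$, $H=H_0+V$, exist and are unitary from $\Pi_0\mathcal{H}$ onto the absolutely continuous subspace of $H$. The scattering operator is $S=\Omega_-^*\Omega_+$ on $\Pi_0\mathcal{H}$, and $T$ is defined by $S=1-2\pi i\,T$. Since $S$ and $T$ commute with $H_0$, in the representation $\Pi_0\mathcal{H}\cong L^2(\sigma_0,dE;\mathbb{C}^N)$ they act as multiplication by $N\times N$ matrices $S(E)$ (unitary) and $T(E)=(T_{jk}(E))$. **Standing technical assumptions.** The coupling vectors are such that their generalized Fourier transforms are smooth in $E$, and such that, for all $E\in\sigma_0$ outside a discrete exceptional set, $\Omega_\pm$ have bounded extensions to the orthogonal sum of the $\mathcal{K}_j^*$, $\psi^\pm_{j,E}=\Omega_\pm\psi^0_{j,E}$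 are generalized eigenfunctions of $H$ ($H\psi^\pm_{j,E}=E\psi^\pm_{j,E}$) giving spectral representations of the absolutely continuous part of $H$, they satisfy the Lippmann–Schwinger equation $\psi^\pm_{j,E}=\psi^0_{j,E}-(H_0-E\mp i0)^{-1}V\psi^\pm_{j,E}$, and $T_{jk}(E)=\langle\psi^0_{j,E},V\psi^+_{k,E}\rangle$. They are also such that the commutators $[V,\Pi_kH_0\Pi_k]$ are finite-rank operators (e.g. the coupling vectors in $\mathcal{H}_k$ lie in the domain of $H_k$). **Initial state and currents.** $f^{FD}_{\beta,\mu}(x)=(1+e^{\beta(x-\mu)})^{-1}$ is the Fermi–Dirac function and $\Pi_0F_0\Pi_0=\sum_{j=1}^N f^{FD}_{\beta_j,\mu_j}(H_j)$ is the initial one-particle density operator of the reservoirs. The steady particle and energy currents out of reservoir $k$ are $$\mathcal{I}_k=-i\,\mathrm{Tr}_{\mathcal{H}}\big(\Omega_{+}\Pi_{0}F_{0}\Pi_{0}\Omega_{+}^{*}[V,\Pi_{k}]\big),\qquad \Phi_k=-i\,\mathrm{Tr}_{\mathcal{H}}\big(\Omega_{+}\Pi_{0}F_{0}\Pi_{0}\Omega_{+}^{*}[V,\Pi_{k}H_0\Pi_k]\big).$$ *)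

theory Defs
  imports "HOL-Probability.Characteristic_Functions"
begin

section \<open>Complex Hilbert spaces\<close>

text \<open>Inner products are linear in the second argument. Positive definiteness is contained in
  \<open>cinner_self\<close>.\<close>

class chilbert_space = banach +
  fixes scaleC :: "complex \<Rightarrow> 'a \<Rightarrow> 'a"  (infixr "*\<^sub>C" 75)
    and cinner :: "'a \<Rightarrow> 'a \<Rightarrow> complex"
  assumes scaleC_add_right: "a *\<^sub>C (x + y) = a *\<^sub>C x + a *\<^sub>C y"
    and scaleC_add_left: "(a + b) *\<^sub>C x = a *\<^sub>C x + b *\<^sub>C x"
    and scaleC_scaleC: "a *\<^sub>C b *\<^sub>C x = (a * b) *\<^sub>C x"
    and scaleC_of_real: "complex_of_real r *\<^sub>C x = r *\<^sub>R x"
    and cinner_add_right: "cinner x (y + z) = cinner x y + cinner x z"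
    and cinner_scaleC_right: "cinner x (a *\<^sub>C y) = a * cinner x y"
    and cinner_commute: "cinner y x = cnj (cinner x y)"
    and cinner_self: "cinner x x = complex_of_real ((norm x)\<^sup>2)"

global_interpretation complex_vector: vector_space "scaleC :: complex \<Rightarrow> 'a \<Rightarrow> 'a::chilbert_space"
  defines csubspace = complex_vector.subspace
    and cspan = complex_vector.span
proof
  show "1 *\<^sub>C x = x" for x :: 'a
    using scaleC_of_real[of 1 x] by simp
qed (simp_all add: scaleC_add_right scaleC_add_left scaleC_scaleC)


section \<open>Bounded operators\<close>

definition bounded_clinear :: "('h::chilbert_space \<Rightarrow> 'h) \<Rightarrow> bool" where
  "bounded_clinear A \<longleftrightarrow> bounded_linear A \<and> (\<forall>c u. A (c *\<^sub>C u) = c *\<^sub>C A u)"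

definition finite_rank :: "('h::chilbert_space \<Rightarrow> 'h) \<Rightarrow> bool" where
  "finite_rank A \<longleftrightarrow> bounded_clinear A \<and> (\<exists>B. finite B \<and> range A \<subseteq> cspan B)"

definition cadjoint :: "('h::chilbert_space \<Rightarrow> 'h) \<Rightarrow> 'h \<Rightarrow> 'h" where
  "cadjoint A = (THE B. \<forall>u v. cinner (A u) v = cinner u (B v))"

definition orth_proj :: "'h::chilbert_space set \<Rightarrow> 'h \<Rightarrow> 'h" where
  "orth_proj K u = (THE v. v \<in> K \<and> (\<forall>w\<in>K. cinner w (u - v) = 0))"

definition orthonormal_family :: "nat \<Rightarrow> (nat \<Rightarrow> 'h::chilbert_space) \<Rightarrow> bool" where
  "orthonormal_family n e \<longleftrightarrow> (\<forall>l<n. \<forall>m<n. cinner (e l) (e m) = (if l = m then 1 else 0))"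

definition orthonormal_basis :: "'h::chilbert_space set \<Rightarrow> bool" where
  "orthonormal_basis B \<longleftrightarrow>
     (\<forall>e\<in>B. \<forall>e'\<in>B. cinner e e' = (if e = e' then 1 else 0)) \<and>
     (\<forall>u. (\<forall>e\<in>B. cinner e u = 0) \<longrightarrow> u = 0)"

text \<open>For trace class operators (below: finite-rank operators) the value does not depend on the
  orthonormal basis.\<close>

definition op_trace :: "('h::chilbert_space \<Rightarrow> 'h) \<Rightarrow> complex" where
  "op_trace A = (\<Sum>\<^sub>\<infinity>e\<in>(SOME B. orthonormal_basis B). cinner e (A e))"


section \<open>Unbounded operators\<close>

text \<open>An operator in a closed subspace \<open>K\<close> is given by its domain \<open>D\<close> and a total function
  \<open>A\<close> which is only relevant on \<open>D\<close>. The last clause of \<open>self_adjoint_on\<close> says that the graph of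
  the adjoint is the graph of \<open>A\<close>.\<close>

definition self_adjoint_on :: "'h::chilbert_space set \<Rightarrow> 'h set \<Rightarrow> ('h \<Rightarrow> 'h) \<Rightarrow> bool" where
  "self_adjoint_on K D A \<longleftrightarrow>
     csubspace D \<and> D \<subseteq> K \<and> K \<subseteq> closure D \<and> A ` D \<subseteq> K \<and>
     (\<forall>u\<in>D. \<forall>v\<in>D. A (u + v) = A u + A v) \<and> (\<forall>c. \<forall>u\<in>D. A (c *\<^sub>C u) = c *\<^sub>C A u) \<and>
     (\<forall>v\<in>K. \<forall>w\<in>K. (\<forall>u\<in>D. cinner v (A u) = cinner w u) \<longleftrightarrow> v \<in> D \<and> w = A v)"

definition op_spectrum :: "'h::chilbert_space set \<Rightarrow> 'h set \<Rightarrow> ('h \<Rightarrow> 'h) \<Rightarrow> complex set" where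
  "op_spectrum K D A =
     {z. \<not> (bij_betw (\<lambda>u. A u - z *\<^sub>C u) D K \<and>
            (\<exists>C. \<forall>u\<in>D. norm u \<le> C * norm (A u - z *\<^sub>C u)))}"

definition resolvent :: "'h::chilbert_space set \<Rightarrow> ('h \<Rightarrow> 'h) \<Rightarrow> complex \<Rightarrow> 'h \<Rightarrow> 'h" where
  "resolvent D A z v = (THE u. u \<in> D \<and> A u - z *\<^sub>C u = v)"

text \<open>\<open>U t\<close> is $e^{itA}$: by Stone's theorem a self-adjoint \<open>A\<close> with domain \<open>D\<close> determines
  exactly one such \<open>U\<close>, namely the strongly continuous unitary group with generator \<open>\<i>A\<close>.\<close>

definition unitary_group_of ::
    "'h::chilbert_space set \<Rightarrow> ('h \<Rightarrow> 'h) \<Rightarrow> (real \<Rightarrow> 'h \<Rightarrow> 'h) \<Rightarrow> bool" where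
  "unitary_group_of D A U \<longleftrightarrow>
     (\<forall>t. bounded_clinear (U t) \<and> (\<forall>u. norm (U t u) = norm u)) \<and>
     (\<forall>u. U 0 u = u) \<and> (\<forall>s t u. U (s + t) u = U s (U t u)) \<and>
     (\<forall>u. continuous_on UNIV (\<lambda>t. U t u)) \<and>
     (\<forall>u v. ((\<lambda>t. U t u) has_vector_derivative v) (at 0) \<longleftrightarrow> u \<in> D \<and> v = \<i> *\<^sub>C A u)"

text \<open>The absolutely continuous subspace of the generator of \<open>U\<close>. The measure \<open>\<mu>\<close> is the spectral
  measure of \<open>u\<close>, identified by its characteristic function $t \mapsto \langle u, e^{itA}u\rangle$.\<close>

definition ac_subspace :: "(real \<Rightarrow> 'h::chilbert_space \<Rightarrow> 'h) \<Rightarrow> 'h set" where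
  "ac_subspace U =
     {u. \<exists>\<mu>. finite_measure \<mu> \<and> sets \<mu> = sets borel \<and> absolutely_continuous lborel \<mu> \<and>
             (\<forall>t. cinner u (U t u) = char \<mu> t)}"

text \<open>The commutator $[A,B]$ of symmetric operators, as the bounded operator representing the form
  $\langle u,[A,B]v\rangle=\langle Au,Bv\rangle-\langle Bu,Av\rangle$ on a dense common domain \<open>D\<close>.\<close>

definition is_commutator ::
    "'h::chilbert_space set \<Rightarrow> ('h \<Rightarrow> 'h) \<Rightarrow> ('h \<Rightarrow> 'h) \<Rightarrow> ('h \<Rightarrow> 'h) \<Rightarrow> bool" where
  "is_commutator D A B C \<longleftrightarrow>
     bounded_clinear C \<and>
     (\<forall>u\<in>D. \<forall>v\<in>D. cinner u (C v) = cinner (A u) (B v) - cinner (B u) (A v))"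

definition commutator ::
    "'h::chilbert_space set \<Rightarrow> ('h \<Rightarrow> 'h) \<Rightarrow> ('h \<Rightarrow> 'h) \<Rightarrow> 'h \<Rightarrow> 'h" where
  "commutator D A B = (THE C. is_commutator D A B C)"


section \<open>Spectral representations\<close>

definition square_int_on :: "real set \<Rightarrow> (real \<Rightarrow> complex) \<Rightarrow> bool" where
  "square_int_on W g \<longleftrightarrow>
     g \<in> borel_measurable (lebesgue_on W) \<and> integrable (lebesgue_on W) (\<lambda>E. (cmod (g E))\<^sup>2)"

text \<open>\<open>G\<close> represents a unitary map from \<open>K\<close> onto $L^2(W,dE;\mathbb{C}^J)$; \<open>G j u\<close> is a
  representative of the \<open>j\<close>-th component of the image of \<open>u\<close>.\<close>

definition L2_unitary ::
    "'h::chilbert_space set \<Rightarrow> nat set \<Rightarrow> real set \<Rightarrow> (nat \<Rightarrow> 'h \<Rightarrow> real \<Rightarrow> complex) \<Rightarrow> bool" where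
  "L2_unitary K J W G \<longleftrightarrow>
     (\<forall>j\<in>J. \<forall>u\<in>K. square_int_on W (G j u)) \<and>
     (\<forall>j\<in>J. \<forall>u\<in>K. \<forall>v\<in>K. AE E in lebesgue_on W. G j (u + v) E = G j u E + G j v E) \<and>
     (\<forall>j\<in>J. \<forall>c. \<forall>u\<in>K. AE E in lebesgue_on W. G j (c *\<^sub>C u) E = c * G j u E) \<and>
     (\<forall>u\<in>K. (norm u)\<^sup>2 = (\<Sum>j\<in>J. \<integral>E. (cmod (G j u E))\<^sup>2 \<partial>lebesgue_on W)) \<and>
     (\<forall>g. (\<forall>j\<in>J. square_int_on W (g j)) \<longrightarrow>
        (\<exists>u\<in>K. \<forall>j\<in>J. AE E in lebesgue_on W. G j u E = g j E))"

text \<open>\<open>G\<close> turns the part of \<open>A\<close> (with domain \<open>D\<close>) in \<open>K\<close> into multiplication by \<open>E\<close> on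
  $L^2(W,dE;\mathbb{C}^J)$. For a singleton \<open>J\<close> this says that \<open>A\<close> has simple, purely absolutely
  continuous spectrum.\<close>

definition spectral_rep ::
    "'h::chilbert_space set \<Rightarrow> 'h set \<Rightarrow> ('h \<Rightarrow> 'h) \<Rightarrow> nat set \<Rightarrow> real set \<Rightarrow>
     (nat \<Rightarrow> 'h \<Rightarrow> real \<Rightarrow> complex) \<Rightarrow> bool" where
  "spectral_rep K D A J W G \<longleftrightarrow>
     L2_unitary K J W G \<and>
     D \<inter> K = {u\<in>K. \<forall>j\<in>J. square_int_on W (\<lambda>E. complex_of_real E * G j u E)} \<and>
     (\<forall>u\<in>D \<inter> K. A u \<in> K \<and>
        (\<forall>j\<in>J. AE E in lebesgue_on W. G j (A u) E = complex_of_real E * G j u E))"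

text \<open>\<open>h(A)\<close> for an operator \<open>A\<close> in \<open>K\<close> which \<open>F\<close> turns into multiplication by \<open>E\<close>.\<close>

definition spectral_fun ::
    "'h::chilbert_space set \<Rightarrow> real set \<Rightarrow> ('h \<Rightarrow> real \<Rightarrow> complex) \<Rightarrow> (real \<Rightarrow> real) \<Rightarrow> 'h \<Rightarrow> 'h" where
  "spectral_fun K W F h u =
     (THE v. v \<in> K \<and> (AE E in lebesgue_on W. F v E = complex_of_real (h E) * F u E))"

definition smooth_fun_on :: "real set \<Rightarrow> (real \<Rightarrow> complex) \<Rightarrow> bool" where
  "smooth_fun_on S f \<longleftrightarrow>
     (\<exists>d. d 0 = f \<and> (\<forall>n::nat. \<forall>x\<in>S. (d n has_vector_derivative d (Suc n) x) (at x)))"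


section \<open>Gelfand triples\<close>

definition ip_norm :: "('h \<Rightarrow> 'h \<Rightarrow> complex) \<Rightarrow> 'h \<Rightarrow> real" where
  "ip_norm ip u = sqrt (Re (ip u u))"

text \<open>A Hilbert space \<open>K\<close> with inner product \<open>ip\<close>, densely and continuously embedded in the
  closed subspace \<open>H\<close>.\<close>

definition gelfand_triple ::
    "'h::chilbert_space set \<Rightarrow> 'h set \<Rightarrow> ('h \<Rightarrow> 'h \<Rightarrow> complex) \<Rightarrow> bool" where
  "gelfand_triple H K ip \<longleftrightarrow>
     csubspace K \<and> K \<subseteq> H \<and> H \<subseteq> closure K \<and>
     (\<forall>u\<in>K. \<forall>v\<in>K. \<forall>w\<in>K. ip u (v + w) = ip u v + ip u w) \<and>
     (\<forall>c. \<forall>u\<in>K. \<forall>v\<in>K. ip u (c *\<^sub>C v) = c * ip u v) \<and>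
     (\<forall>u\<in>K. \<forall>v\<in>K. ip v u = cnj (ip u v)) \<and>
     (\<forall>u\<in>K. u \<noteq> 0 \<longrightarrow> 0 < Re (ip u u)) \<and>
     (\<forall>X. (\<forall>n::nat. X n \<in> K) \<and>
          (\<forall>e>0. \<exists>n0. \<forall>m\<ge>n0. \<forall>n\<ge>n0. ip_norm ip (X m - X n) < e) \<longrightarrow>
          (\<exists>u\<in>K. (\<lambda>n. ip_norm ip (X n - u)) \<longlonglongrightarrow> 0)) \<and>
     (\<exists>C. \<forall>u\<in>K. norm u \<le> C * ip_norm ip u)"

text \<open>An element $\psi$ of $K^*$ is represented by the functional $u\mapsto\langle\psi,u\rangle$,
  which is linear in \<open>u\<close>; a vector \<open>h\<close> of the Hilbert space is thus embedded as \<open>cinner h\<close>. Values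
  outside \<open>K\<close> are irrelevant.\<close>

definition dual_space ::
    "'h::chilbert_space set \<Rightarrow> ('h \<Rightarrow> 'h \<Rightarrow> complex) \<Rightarrow> ('h \<Rightarrow> complex) set" where
  "dual_space K ip =
     {\<phi>. (\<forall>u\<in>K. \<forall>v\<in>K. \<phi> (u + v) = \<phi> u + \<phi> v) \<and> (\<forall>c. \<forall>u\<in>K. \<phi> (c *\<^sub>C u) = c * \<phi> u) \<and>
         (\<exists>C. \<forall>u\<in>K. cmod (\<phi> u) \<le> C * ip_norm ip u)}"

text \<open>\<open>X\<close> is a bounded linear map from the dual of \<open>K0\<close> to the dual of \<open>K\<close> (norms from \<open>ip\<close>)
  extending the operator \<open>A\<close> defined on the subspace \<open>H0\<close>.\<close>

definition bounded_extension ::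
    "'h::chilbert_space set \<Rightarrow> 'h set \<Rightarrow> 'h set \<Rightarrow> ('h \<Rightarrow> 'h \<Rightarrow> complex) \<Rightarrow> ('h \<Rightarrow> 'h) \<Rightarrow>
     (('h \<Rightarrow> complex) \<Rightarrow> 'h \<Rightarrow> complex) \<Rightarrow> bool" where
  "bounded_extension H0 K0 K ip A X \<longleftrightarrow>
     (\<forall>\<phi>\<in>dual_space K0 ip. X \<phi> \<in> dual_space K ip) \<and>
     (\<forall>\<phi>\<in>dual_space K0 ip. \<forall>\<eta>\<in>dual_space K0 ip. \<forall>u\<in>K. X (\<lambda>w. \<phi> w + \<eta> w) u = X \<phi> u + X \<eta> u) \<and>
     (\<forall>c. \<forall>\<phi>\<in>dual_space K0 ip. \<forall>u\<in>K. X (\<lambda>w. c * \<phi> w) u = c * X \<phi> u) \<and>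
     (\<exists>C. \<forall>\<phi>\<in>dual_space K0 ip. \<forall>b\<ge>0. (\<forall>w\<in>K0. cmod (\<phi> w) \<le> b * ip_norm ip w) \<longrightarrow>
        (\<forall>u\<in>K. cmod (X \<phi> u) \<le> C * b * ip_norm ip u)) \<and>
     (\<forall>h\<in>H0. \<forall>u\<in>K. X (cinner h) u = cinner (A h) u)"

text \<open>$H\psi=E\psi$ in $K^*$, i.e. $\langle\psi,Hu\rangle=E\langle\psi,u\rangle$ whenever both sides
  make sense.\<close>

definition generalized_eigenfunction ::
    "'h::chilbert_space set \<Rightarrow> 'h set \<Rightarrow> ('h \<Rightarrow> 'h) \<Rightarrow> real \<Rightarrow> ('h \<Rightarrow> complex) \<Rightarrow> bool" where
  "generalized_eigenfunction K D A E \<phi> \<longleftrightarrow>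
     (\<forall>u\<in>K \<inter> D. A u \<in> K \<longrightarrow> \<phi> (A u) = complex_of_real E * \<phi> u)"


section \<open>Open quantum systems\<close>

datatype branch = Plus | Minus

text \<open>$\Omega_\pm$ is a limit for $t\to\mp\infty$.\<close>

fun branch_time :: "branch \<Rightarrow> real filter" where
  "branch_time Plus = at_bot"
| "branch_time Minus = at_top"

fun branch_sign :: "branch \<Rightarrow> real" where
  "branch_sign Plus = 1"
| "branch_sign Minus = -1"

text \<open>The one-particle space is the whole type \<open>'h\<close>; reservoirs are indexed by \<open>{1..nres}\<close>. The
  coupling between the system and reservoir \<open>j\<close> is
  $V_{\mathcal Sj}=\sum_{l<\mathit{sc\_num}\,j}\mathit{sc\_coeff}\,j\,l\,
    |\mathit{sc\_sys}\,j\,l\rangle\langle\mathit{sc\_res}\,j\,l|$,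
  the direct contact between reservoirs \<open>j < k\<close> is
  $V_{jk}=\sum_{l<\mathit{dc\_num}\,j\,k}\mathit{dc\_coeff}\,j\,k\,l\,
    |\mathit{dc\_left}\,j\,k\,l\rangle\langle\mathit{dc\_right}\,j\,k\,l|$.
  \<open>four j\<close> is the unitary extension of $u\mapsto\langle\psi^0_{j,E},u\rangle$; \<open>propag0\<close> and
  \<open>propag\<close> are $e^{itH_0}$ and $e^{itH}$.\<close>

record 'h open_system =
  nres :: nat
  sys :: "'h set"
  res :: "nat \<Rightarrow> 'h set"
  ham_sys :: "'h \<Rightarrow> 'h"
  dom_res :: "nat \<Rightarrow> 'h set"
  ham_res :: "nat \<Rightarrow> 'h \<Rightarrow> 'h"
  sigma0 :: "real set"
  nuc :: "nat \<Rightarrow> 'h set"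
  nuc_ip :: "nat \<Rightarrow> 'h \<Rightarrow> 'h \<Rightarrow> complex"
  psi0 :: "nat \<Rightarrow> real \<Rightarrow> 'h \<Rightarrow> complex"
  four :: "nat \<Rightarrow> 'h \<Rightarrow> real \<Rightarrow> complex"
  coupling :: "'h \<Rightarrow> 'h"
  sc_num :: "nat \<Rightarrow> nat"
  sc_coeff :: "nat \<Rightarrow> nat \<Rightarrow> real"
  sc_sys :: "nat \<Rightarrow> nat \<Rightarrow> 'h"
  sc_res :: "nat \<Rightarrow> nat \<Rightarrow> 'h"
  dc_num :: "nat \<Rightarrow> nat \<Rightarrow> nat"
  dc_coeff :: "nat \<Rightarrow> nat \<Rightarrow> nat \<Rightarrow> real"
  dc_left :: "nat \<Rightarrow> nat \<Rightarrow> nat \<Rightarrow> 'h"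
  dc_right :: "nat \<Rightarrow> nat \<Rightarrow> nat \<Rightarrow> 'h"
  propag0 :: "real \<Rightarrow> 'h \<Rightarrow> 'h"
  propag :: "real \<Rightarrow> 'h \<Rightarrow> 'h"
  moller :: "branch \<Rightarrow> 'h \<Rightarrow> 'h"
  psi :: "branch \<Rightarrow> nat \<Rightarrow> real \<Rightarrow> 'h \<Rightarrow> complex"
  Tmat :: "nat \<Rightarrow> nat \<Rightarrow> real \<Rightarrow> complex"
  exc :: "real set"

definition proj_sys :: "'h::chilbert_space open_system \<Rightarrow> 'h \<Rightarrow> 'h" where
  "proj_sys Q = orth_proj (sys Q)"

definition proj_res :: "'h::chilbert_space open_system \<Rightarrow> nat \<Rightarrow> 'h \<Rightarrow> 'h" where
  "proj_res Q j = orth_proj (res Q j)"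

definition proj0 :: "'h::chilbert_space open_system \<Rightarrow> 'h \<Rightarrow> 'h" where
  "proj0 Q u = (\<Sum>j=1..nres Q. proj_res Q j u)"

definition dom0 :: "'h::chilbert_space open_system \<Rightarrow> 'h set" where
  "dom0 Q = {u. \<forall>j\<in>{1..nres Q}. proj_res Q j u \<in> dom_res Q j}"

definition ham0 :: "'h::chilbert_space open_system \<Rightarrow> 'h \<Rightarrow> 'h" where
  "ham0 Q u = ham_sys Q (proj_sys Q u) + (\<Sum>j=1..nres Q. ham_res Q j (proj_res Q j u))"

definition ham :: "'h::chilbert_space open_system \<Rightarrow> 'h \<Rightarrow> 'h" where
  "ham Q u = ham0 Q u + coupling Q u"

text \<open>$\mathcal{H}_{\mathcal S}\oplus\bigoplus_j\mathcal{K}_j$, its subspace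
  $\bigoplus_j\mathcal{K}_j$, and the inner product of the orthogonal sum.\<close>

definition nuc_total :: "'h::chilbert_space open_system \<Rightarrow> 'h set" where
  "nuc_total Q = {u. \<forall>j\<in>{1..nres Q}. proj_res Q j u \<in> nuc Q j}"

definition nuc_reservoirs :: "'h::chilbert_space open_system \<Rightarrow> 'h set" where
  "nuc_reservoirs Q = {u \<in> nuc_total Q. proj_sys Q u = 0}"

definition nuc_total_ip :: "'h::chilbert_space open_system \<Rightarrow> 'h \<Rightarrow> 'h \<Rightarrow> complex" where
  "nuc_total_ip Q u v = cinner (proj_sys Q u) (proj_sys Q v) +
     (\<Sum>j=1..nres Q. nuc_ip Q j (proj_res Q j u) (proj_res Q j v))"

text \<open>The unperturbed eigenfunction as an element of $\bigoplus_j\mathcal{K}_j^*$.\<close>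

definition psi0_total :: "'h::chilbert_space open_system \<Rightarrow> nat \<Rightarrow> real \<Rightarrow> 'h \<Rightarrow> complex" where
  "psi0_total Q j E u = psi0 Q j E (proj_res Q j u)"

text \<open>$V\psi$ for \<open>\<psi>\<close> in the dual space, characterised by
  $\langle V\psi,u\rangle=\langle\psi,Vu\rangle$. It is a vector since \<open>V\<close> has finite rank.\<close>

definition coupling_dual :: "'h::chilbert_space open_system \<Rightarrow> ('h \<Rightarrow> complex) \<Rightarrow> 'h" where
  "coupling_dual Q \<phi> = (THE w. \<forall>u. cinner w u = \<phi> (coupling Q u))"

definition coupling_vectors :: "'h::chilbert_space open_system \<Rightarrow> nat \<Rightarrow> 'h set" where
  "coupling_vectors Q k =
     {sc_res Q k l | l. l < sc_num Q k} \<union>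
     {dc_left Q k m l | m l. k < m \<and> m \<le> nres Q \<and> l < dc_num Q k m} \<union>
     {dc_right Q j k l | j l. 1 \<le> j \<and> j < k \<and> l < dc_num Q j k}"

definition scattering_op :: "'h::chilbert_space open_system \<Rightarrow> 'h \<Rightarrow> 'h" where
  "scattering_op Q u = cadjoint (moller Q Minus) (moller Q Plus u)"

definition Smat :: "'h open_system \<Rightarrow> nat \<Rightarrow> nat \<Rightarrow> real \<Rightarrow> complex" where
  "Smat Q j k E = (if j = k then 1 else 0) - 2 * complex_of_real pi * \<i> * Tmat Q j k E"


locale decoupled_system =
  fixes Q :: "'h::chilbert_space open_system"
  assumes sys_finite_dim: "\<exists>B. finite B \<and> sys Q = cspan B"
    and res_subspace: "j \<in> {1..nres Q} \<Longrightarrow> csubspace (res Q j) \<and> closed (res Q j)"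
    and sys_orth_res: "j \<in> {1..nres Q} \<Longrightarrow> u \<in> sys Q \<Longrightarrow> v \<in> res Q j \<Longrightarrow> cinner u v = 0"
    and res_orth_res: "j \<in> {1..nres Q} \<Longrightarrow> k \<in> {1..nres Q} \<Longrightarrow> j \<noteq> k \<Longrightarrow>
        u \<in> res Q j \<Longrightarrow> v \<in> res Q k \<Longrightarrow> cinner u v = 0"
    and orth_sum: "\<exists>s\<in>sys Q. \<exists>r. (\<forall>j\<in>{1..nres Q}. r j \<in> res Q j) \<and> u = s + (\<Sum>j=1..nres Q. r j)"
    and ham_sys_sa: "self_adjoint_on (sys Q) (sys Q) (ham_sys Q)"
    and ham_res_sa: "j \<in> {1..nres Q} \<Longrightarrow> self_adjoint_on (res Q j) (dom_res Q j) (ham_res Q j)"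
    and sigma0: "sigma0 Q \<in> sets borel" "sigma0 Q \<subseteq> {0..}"
    and spectrum: "j \<in> {1..nres Q} \<Longrightarrow>
        op_spectrum (res Q j) (dom_res Q j) (ham_res Q j) = complex_of_real ` sigma0 Q"
    and gelfand: "j \<in> {1..nres Q} \<Longrightarrow> gelfand_triple (res Q j) (nuc Q j) (nuc_ip Q j)"
    and psi0_dual: "j \<in> {1..nres Q} \<Longrightarrow> E \<in> sigma0 Q \<Longrightarrow>
        psi0 Q j E \<in> dual_space (nuc Q j) (nuc_ip Q j)"
    and psi0_eigen: "j \<in> {1..nres Q} \<Longrightarrow> E \<in> sigma0 Q \<Longrightarrow>
        generalized_eigenfunction (nuc Q j) (dom_res Q j) (ham_res Q j) E (psi0 Q j E)"
    and four_psi0: "j \<in> {1..nres Q} \<Longrightarrow> u \<in> nuc Q j \<Longrightarrow>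
        AE E in lebesgue_on (sigma0 Q). four Q j u E = psi0 Q j E u"
    and four_spectral: "j \<in> {1..nres Q} \<Longrightarrow>
        spectral_rep (res Q j) (dom_res Q j) (ham_res Q j) {j} (sigma0 Q) (four Q)"

text \<open>The blocks below the diagonal are the adjoints of those above by symmetry of \<open>V\<close>.\<close>

locale coupled_system = decoupled_system +
  assumes coupling_symmetric: "cinner (coupling Q u) v = cinner u (coupling Q v)"
    and coupling_finite_rank: "finite_rank (coupling Q)"
    and sys_block_zero: "u \<in> sys Q \<Longrightarrow> proj_sys Q (coupling Q u) = 0"
    and res_block_zero: "j \<in> {1..nres Q} \<Longrightarrow> u \<in> res Q j \<Longrightarrow> proj_res Q j (coupling Q u) = 0"
    and sys_res_block: "j \<in> {1..nres Q} \<Longrightarrow> u \<in> res Q j \<Longrightarrow>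
        proj_sys Q (coupling Q u) =
          (\<Sum>l<sc_num Q j. (complex_of_real (sc_coeff Q j l) * cinner (sc_res Q j l) u) *\<^sub>C sc_sys Q j l)"
    and res_res_block: "1 \<le> j \<Longrightarrow> j < k \<Longrightarrow> k \<le> nres Q \<Longrightarrow> u \<in> res Q k \<Longrightarrow>
        proj_res Q j (coupling Q u) =
          (\<Sum>l<dc_num Q j k.
            (complex_of_real (dc_coeff Q j k l) * cinner (dc_right Q j k l) u) *\<^sub>C dc_left Q j k l)"
    and sc_coeff_pos: "j \<in> {1..nres Q} \<Longrightarrow> l < sc_num Q j \<Longrightarrow> 0 < sc_coeff Q j l"
    and sc_vectors: "j \<in> {1..nres Q} \<Longrightarrow> l < sc_num Q j \<Longrightarrow> sc_sys Q j l \<in> sys Q \<and> sc_res Q j l \<in> res Q j"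
    and sc_orthonormal: "j \<in> {1..nres Q} \<Longrightarrow>
        orthonormal_family (sc_num Q j) (sc_sys Q j) \<and> orthonormal_family (sc_num Q j) (sc_res Q j)"
    and dc_coeff_pos: "1 \<le> j \<Longrightarrow> j < k \<Longrightarrow> k \<le> nres Q \<Longrightarrow> l < dc_num Q j k \<Longrightarrow> 0 < dc_coeff Q j k l"
    and dc_vectors: "1 \<le> j \<Longrightarrow> j < k \<Longrightarrow> k \<le> nres Q \<Longrightarrow> l < dc_num Q j k \<Longrightarrow>
        dc_left Q j k l \<in> res Q j \<and> dc_right Q j k l \<in> res Q k"
    and dc_orthonormal: "1 \<le> j \<Longrightarrow> j < k \<Longrightarrow> k \<le> nres Q \<Longrightarrow>
        orthonormal_family (dc_num Q j k) (dc_left Q j k) \<and>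
        orthonormal_family (dc_num Q j k) (dc_right Q j k)"

locale scattering_system = coupled_system +
  assumes propag0: "unitary_group_of (dom0 Q) (ham0 Q) (propag0 Q)"
    and propag: "unitary_group_of (dom0 Q) (ham Q) (propag Q)"
    and moller_limit:
      "((\<lambda>t. propag Q t (propag0 Q (- t) (proj0 Q u))) \<longlongrightarrow> moller Q b u) (branch_time b)"
    and moller_isometric: "u \<in> range (proj0 Q) \<Longrightarrow> norm (moller Q b u) = norm u"
    and moller_range: "moller Q b ` range (proj0 Q) = ac_subspace (propag Q)"
    and Smat_multiplication: "u \<in> range (proj0 Q) \<Longrightarrow> j \<in> {1..nres Q} \<Longrightarrow>
        AE E in lebesgue_on (sigma0 Q). four Q j (proj_res Q j (scattering_op Q u)) E =
          (\<Sum>k=1..nres Q. Smat Q j k E * four Q k (proj_res Q k u) E)"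
    and Smat_unitary: "AE E in lebesgue_on (sigma0 Q). \<forall>j\<in>{1..nres Q}. \<forall>k\<in>{1..nres Q}.
        (\<Sum>l=1..nres Q. cnj (Smat Q l j E) * Smat Q l k E) = (if j = k then 1 else 0) \<and>
        (\<Sum>l=1..nres Q. Smat Q j l E * cnj (Smat Q k l E)) = (if j = k then 1 else 0)"

text \<open>Smoothness is only demanded in the interior of \<open>sigma0\<close>. In \<open>psi_spectral\<close>, the map
  $u\mapsto(\langle\psi^\pm_{j,E},u\rangle)_j$ extends to the whole space so that it vanishes on the
  orthogonal complement of the absolutely continuous subspace of \<open>H\<close> and gives a spectral
  representation on that subspace. In \<open>lippmann_schwinger\<close>, the vector $(H_0-E\mp i0)^{-1}V\psi$ of
  the dual space is a limit in the weak sense.\<close>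

locale regular_scattering_system = scattering_system +
  assumes coupling_vectors_nuc: "k \<in> {1..nres Q} \<Longrightarrow> coupling_vectors Q k \<subseteq> nuc Q k"
    and coupling_vectors_smooth: "k \<in> {1..nres Q} \<Longrightarrow> f \<in> coupling_vectors Q k \<Longrightarrow>
        smooth_fun_on (interior (sigma0 Q)) (\<lambda>E. psi0 Q k E f)"
    and exc_discrete: "discrete (exc Q)"
    and psi_moller: "E \<in> sigma0 Q - exc Q \<Longrightarrow>
        \<exists>X. bounded_extension (range (proj0 Q)) (nuc_reservoirs Q) (nuc_total Q) (nuc_total_ip Q)
              (moller Q b) X \<and>
            (\<forall>j\<in>{1..nres Q}. \<forall>u\<in>nuc_total Q. psi Q b j E u = X (psi0_total Q j E) u)"
    and psi_eigen: "E \<in> sigma0 Q - exc Q \<Longrightarrow> j \<in> {1..nres Q} \<Longrightarrow>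
        generalized_eigenfunction (nuc_total Q) (dom0 Q) (ham Q) E (psi Q b j E)"
    and psi_spectral: "\<exists>G.
        spectral_rep (ac_subspace (propag Q)) (dom0 Q) (ham Q) {1..nres Q} (sigma0 Q) G \<and>
        (\<forall>u\<in>nuc_total Q. \<forall>j\<in>{1..nres Q}. AE E in lebesgue_on (sigma0 Q).
           G j (orth_proj (ac_subspace (propag Q)) u) E = psi Q b j E u)"
    and lippmann_schwinger: "E \<in> sigma0 Q - exc Q \<Longrightarrow> j \<in> {1..nres Q} \<Longrightarrow> u \<in> nuc_total Q \<Longrightarrow>
        ((\<lambda>\<epsilon>. cinner (resolvent (dom0 Q) (ham0 Q) (Complex E (branch_sign b * \<epsilon>))
                  (coupling_dual Q (psi Q b j E))) u)
          \<longlongrightarrow> psi0_total Q j E u - psi Q b j E u) (at_right 0)"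
    and Tmat_formula: "E \<in> sigma0 Q - exc Q \<Longrightarrow> j \<in> {1..nres Q} \<Longrightarrow> k \<in> {1..nres Q} \<Longrightarrow>
        Tmat Q j k E = psi0_total Q j E (coupling_dual Q (psi Q Plus k E))"
    and energy_commutator: "k \<in> {1..nres Q} \<Longrightarrow>
        \<exists>C. finite_rank C \<and>
            is_commutator (dom0 Q) (coupling Q) (\<lambda>u. proj_res Q k (ham0 Q (proj_res Q k u))) C"


section \<open>Steady currents and entropy production\<close>

definition fermi_dirac :: "real \<Rightarrow> real \<Rightarrow> real \<Rightarrow> real" where
  "fermi_dirac \<beta> \<mu> x = 1 / (1 + exp (\<beta> * (x - \<mu>)))"

definition initial_density ::
    "'h::chilbert_space open_system \<Rightarrow> (nat \<Rightarrow> real) \<Rightarrow> (nat \<Rightarrow> real) \<Rightarrow> 'h \<Rightarrow> 'h" where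
  "initial_density Q \<beta> \<mu> u =
     (\<Sum>j=1..nres Q. spectral_fun (res Q j) (sigma0 Q) (four Q j) (fermi_dirac (\<beta> j) (\<mu> j))
        (proj_res Q j u))"

definition steady_density ::
    "'h::chilbert_space open_system \<Rightarrow> (nat \<Rightarrow> real) \<Rightarrow> (nat \<Rightarrow> real) \<Rightarrow> 'h \<Rightarrow> 'h" where
  "steady_density Q \<beta> \<mu> u =
     moller Q Plus (initial_density Q \<beta> \<mu> (cadjoint (moller Q Plus) u))"

definition particle_current ::
    "'h::chilbert_space open_system \<Rightarrow> (nat \<Rightarrow> real) \<Rightarrow> (nat \<Rightarrow> real) \<Rightarrow> nat \<Rightarrow> complex" where
  "particle_current Q \<beta> \<mu> k =
     - \<i> * op_trace (\<lambda>u. steady_density Q \<beta> \<mu>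
              (coupling Q (proj_res Q k u) - proj_res Q k (coupling Q u)))"

definition energy_current ::
    "'h::chilbert_space open_system \<Rightarrow> (nat \<Rightarrow> real) \<Rightarrow> (nat \<Rightarrow> real) \<Rightarrow> nat \<Rightarrow> complex" where
  "energy_current Q \<beta> \<mu> k =
     - \<i> * op_trace (\<lambda>u. steady_density Q \<beta> \<mu>
              (commutator (dom0 Q) (coupling Q) (\<lambda>u. proj_res Q k (ham0 Q (proj_res Q k u))) u))"

definition entropy_production ::
    "'h::chilbert_space open_system \<Rightarrow> (nat \<Rightarrow> real) \<Rightarrow> (nat \<Rightarrow> real) \<Rightarrow> complex" where
  "entropy_production Q \<beta> \<mu> =
     - (\<Sum>k=1..nres Q. complex_of_real (\<beta> k) *
          (energy_current Q \<beta> \<mu> k - complex_of_real (\<mu> k) * particle_current Q \<beta> \<mu> k))"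

end

theory Submission
  imports Defs
begin

text \<open>The currents are computed by following scattering trajectories. Let \<open>\<Omega>\<close> be the wave operator
  \<open>\<Omega>\<^sub>+\<close>, \<open>A\<close> the observable \<open>\<Pi>\<^sub>k\<close> or \<open>\<Pi>\<^sub>k H\<^sub>0 \<Pi>\<^sub>k\<close>, and \<open>C\<close> its commutator with \<open>V\<close>. Along
  $u(t) = e^{-itH} \Omega w$ the function $\Phi(t) = \langle u(t), A u(t)\rangle$ has derivative
  $i \langle u(t), C u(t)\rangle$ and, since $u$ is asymptotically free, tends to
  $\langle w, A w\rangle$ for $t \to -\infty$ and to $\langle S w, A S w\rangle$ for $t \to \infty$.
  Expanding the finite-rank operator \<open>C\<close> writes $\Phi'$ as a finite sum of products of Fourier transforms, so that
  Plancherel's identity evaluates the total increment of $\Phi$. If \<open>w\<close> lies in reservoir \<open>j\<close> and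
  has energy representation equal to the square root of the Fermi--Dirac function $f_j$, the result is
  the contribution of reservoir \<open>j\<close> to the trace defining the current. This gives the
  Landauer--Buettiker formula
  $\mathcal{I}_k = \frac{1}{2\pi} \int \sum_j (\delta_{jk} - |S_{kj}|^2) f_j \, dE$, and the same with a factor \<open>E\<close>
  for the energy current. With $x_k = \beta_k (E - \mu_k)$ the entropy production has the density
  $\frac{1}{2\pi} \sum_{k,j} x_k (|S_{kj}|^2 - \delta_{jk}) f_j$. As $|S_{kj}|^2$ is doubly stochastic and $f_j = -\ell'(x_j)$ with
  $\ell(x) = \ln (1 + e^{-x})$ strictly convex, it is nonnegative, and positive if
  $x_j \neq x_k$ for some $j, k$ with $S_{kj} \neq 0$.\<close>

section \<open>Hilbert space geometry and traces of finite-rank operators\<close>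

section \<open>Inner products\<close>

text \<open>Why orbits compute a trace over the steady density: formally, the time integral of the
  rank-one operators |w(t)><w(t)| along the free orbit w(t) of \<open>w\<close> is 2 pi times
  multiplication by |w(E)|^2. Since each H_j has simple spectrum, a single vector with |w(E)|^2 =
  f_j therefore represents the whole reservoir, and 2 pi is the constant of the Landauer-Buettiker
  formula. Carried over by \<Omega>, the contribution of reservoir j to the trace against C is the
  time integral of <u, C u> divided by 2 pi, which is an increment of \<Phi> up to the factor i. Two
  features of f_j make this rigorous. It is bounded by 1, so that the functions in Plancherel's
  identity are square integrable and not merely integrable. It decays exponentially on the spectrum,
  which lies in [0, \<infinity>), so that \<open>w\<close> has all energy moments and the orbit
  stays in the domain of the unbounded observable. Energy representations are only determined up to
  null sets and measurable only in the sense of Lebesgue. They are replaced by Borel functions on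
  the whole line that vanish off \<open>sigma0 Q\<close>, and statements about them hold almost
  everywhere.\<close>

lemma cinner_add_left: "cinner (x + y) z = cinner x z + cinner y z"
  by (subst (1 2 3) cinner_commute) (simp add: cinner_add_right)

lemma cinner_scaleC_left: "cinner (a *\<^sub>C x) y = cnj a * cinner x y"
  by (subst (1 2) cinner_commute) (simp add: cinner_scaleC_right)

lemma norm_scaleC: "norm (a *\<^sub>C x) = cmod a * norm x"
proof -
  have "complex_of_real ((norm (a *\<^sub>C x))\<^sup>2) = complex_of_real ((cmod a * norm x)\<^sup>2)"
    unfolding cinner_self[symmetric] cinner_scaleC_left cinner_scaleC_right
    unfolding power_mult_distrib of_real_mult complex_norm_square cinner_self by simp
  thus ?thesis unfolding of_real_eq_iff by (simp add: power2_eq_iff_nonneg)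
qed

lemma cinner_scaleR_right: "cinner x (r *\<^sub>R y) = r *\<^sub>R cinner x y"
  by (simp add: scaleC_of_real[symmetric] cinner_scaleC_right scaleR_conv_of_real)

lemma cinner_scaleR_left: "cinner (r *\<^sub>R x) y = r *\<^sub>R cinner x y"
  by (simp add: scaleC_of_real[symmetric] cinner_scaleC_left scaleR_conv_of_real)

lemma norm_add_square: "(norm (x + y :: 'a::chilbert_space))\<^sup>2 = (norm x)\<^sup>2 + 2 * Re (cinner x y) + (norm y)\<^sup>2"
proof -
  have "cinner (x + y) (x + y) = cinner x x + cinner x y + cnj (cinner x y) + cinner y y"
    unfolding cinner_commute[of y x, symmetric] by (simp add: cinner_add_left cinner_add_right)
  thus ?thesis by (simp add: cinner_self complex_eq_iff del: of_real_power)
qed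

lemma cinner_zero_left [simp]: "cinner 0 x = 0"
  using cinner_scaleR_left[of 0 0 x] by simp

lemma cinner_zero_right [simp]: "cinner x 0 = 0"
  using cinner_scaleR_right[of x 0 0] by simp

lemma Cauchy_Schwarz_cinner: "cmod (cinner x y) \<le> norm x * norm y"
proof (cases "y = 0")
  case False
  \<comment> \<open>With this \<open>a\<close> the vector \<open>x + a *\<^sub>C y\<close> is the
    component of \<open>x\<close> orthogonal to \<open>y\<close>; that its squared norm is
    nonnegative is the inequality.\<close>
  define a where "a = - cinner y x / complex_of_real ((norm y)\<^sup>2)"
  have n: "(norm y)\<^sup>2 > 0" using False by simp
  have c: "cinner x y * cinner y x = complex_of_real ((cmod (cinner x y))\<^sup>2)"
    unfolding cinner_commute[of y x] by (simp add: complex_norm_square del: of_real_power)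
  have "0 \<le> (norm (x + a *\<^sub>C y))\<^sup>2" by simp
  also have "\<dots> = (norm x)\<^sup>2 + 2 * Re (a * cinner x y) + (cmod a)\<^sup>2 * (norm y)\<^sup>2"
    by (simp add: norm_add_square cinner_scaleC_right norm_scaleC power_mult_distrib)
  also have "a * cinner x y = - complex_of_real ((cmod (cinner x y))\<^sup>2 / (norm y)\<^sup>2)"
    using c by (simp add: a_def mult.commute del: of_real_power)
  also have "Re \<dots> = - ((cmod (cinner x y))\<^sup>2 / (norm y)\<^sup>2)" by (simp del: of_real_power of_real_divide)
  also have "(cmod a)\<^sup>2 * (norm y)\<^sup>2 = (cmod (cinner x y))\<^sup>2 / (norm y)\<^sup>2"
    using False unfolding a_def cinner_commute[of y x]
    by (simp add: norm_divide norm_mult power_divide power2_eq_square[of "(norm y)\<^sup>2"] field_simps norm_power)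
  finally have "(cmod (cinner x y))\<^sup>2 / (norm y)\<^sup>2 \<le> (norm x)\<^sup>2" by simp
  hence "(cmod (cinner x y))\<^sup>2 \<le> (norm x * norm y)\<^sup>2"
    using n by (simp add: divide_le_eq power_mult_distrib)
  thus ?thesis by (rule power2_le_imp_le) simp
qed simp

text \<open>Over the reals the sesquilinear inner product is bilinear, so this supplies the rules
  for limits, continuity, sums and signs.\<close>

global_interpretation cinner: bounded_bilinear "cinner :: 'a::chilbert_space \<Rightarrow> 'a \<Rightarrow> complex"
proof
  show "\<exists>K. \<forall>a b. norm (cinner a (b::'a)) \<le> norm a * norm b * K"
    by (rule exI[of _ 1]) (simp add: Cauchy_Schwarz_cinner)
qed (simp_all add: cinner_add_left cinner_add_right cinner_scaleR_left cinner_scaleR_right)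

lemma bounded_linear_scaleC: "bounded_linear (\<lambda>x. a *\<^sub>C x)"
proof
  show "\<exists>K. \<forall>x. norm (a *\<^sub>C x) \<le> norm x * K"
    by (rule exI[of _ "cmod a"]) (simp add: norm_scaleC)
qed (simp_all add: scaleC_add_right scaleC_of_real[symmetric] scaleC_scaleC mult.commute)

lemma cinner_eq_zeroD: "(\<And>y. cinner y x = 0) \<Longrightarrow> x = 0"
  using cinner_self[of x] by simp

lemma cinner_ext: "(\<And>y. cinner y x = cinner y x') \<Longrightarrow> x = x'"
  using cinner_eq_zeroD[of "x - x'"] by (simp add: cinner.diff_right)

lemma scaleC_minus1: "(-1) *\<^sub>C x = - x"
  using scaleC_of_real[of "-1" x] by simp

lemma csubspace_iff:
  "csubspace S \<longleftrightarrow> 0 \<in> S \<and> (\<forall>x\<in>S. \<forall>y\<in>S. x + y \<in> S) \<and> (\<forall>c. \<forall>x\<in>S. c *\<^sub>C x \<in> S)"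
  by (rule complex_vector.subspace_def)

lemma csubspace_scaleR: "csubspace S \<Longrightarrow> x \<in> S \<Longrightarrow> r *\<^sub>R x \<in> S"
  by (metis complex_vector.subspace_scale scaleC_of_real)

lemma csubspace_diff: "csubspace S \<Longrightarrow> x \<in> S \<Longrightarrow> y \<in> S \<Longrightarrow> x - y \<in> S"
  by (rule complex_vector.subspace_diff)

lemma csubspace_sum: "csubspace S \<Longrightarrow> (\<And>i. i \<in> I \<Longrightarrow> f i \<in> S) \<Longrightarrow> sum f I \<in> S"
  by (rule complex_vector.subspace_sum)

lemma csubspace_closure:
  assumes "csubspace (S :: 'a::chilbert_space set)"
  shows "csubspace (closure S)"
  unfolding csubspace_iff
proof (intro conjI ballI allI)
  show "0 \<in> closure S"
    using assms closure_subset unfolding csubspace_iff by blast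
  fix x assume x: "x \<in> closure S"
  then obtain f where f: "\<And>n. f n \<in> S" "f \<longlonglongrightarrow> x" unfolding closure_sequential by blast
  show "x + y \<in> closure S" if "y \<in> closure S" for y
  proof -
    obtain g where "\<And>n. g n \<in> S" "g \<longlonglongrightarrow> y" using \<open>y \<in> closure S\<close> unfolding closure_sequential by blast
    thus ?thesis using f assms unfolding closure_sequential csubspace_iff
      by (intro exI[of _ "\<lambda>n. f n + g n"]) (auto intro!: tendsto_add)
  qed
  show "c *\<^sub>C x \<in> closure S" for c
    using f assms unfolding closure_sequential csubspace_iff
    by (intro exI[of _ "\<lambda>n. c *\<^sub>C f n"]) (auto intro!: bounded_linear.tendsto[OF bounded_linear_scaleC])
qed

section \<open>Orthogonal projections and adjoints\<close>

lemma parallelogram: "(norm (x + y :: 'a::chilbert_space))\<^sup>2 + (norm (x - y))\<^sup>2 = 2 * (norm x)\<^sup>2 + 2 * (norm y)\<^sup>2"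
  using norm_add_square[of x y] norm_add_square[of x "- y"] by (simp add: cinner.minus_right)

text \<open>A small step against the \<open>w\<close>-component of \<open>x\<close> would lower the
  norm at first order in the step size, while the increase is only of second order.\<close>

lemma orthogonal_if_minimal:
  fixes x w :: "'a::chilbert_space"
  assumes "\<And>c. (norm x)\<^sup>2 \<le> (norm (x - c *\<^sub>C w))\<^sup>2"
  shows "cinner w x = 0"
proof -
  \<comment> \<open>The step size has to satisfy \<open>s * (norm w)\<^sup>2 \<le> 1\<close>; the
    summand 1 keeps it defined for \<open>w = 0\<close>.\<close>
  define s where "s = 1 / ((norm w)\<^sup>2 + 1)"
  define \<alpha> where "\<alpha> = cinner w x"
  have "0 < (norm w)\<^sup>2 + 1" by (simp add: add_nonneg_pos)
  hence s: "s > 0" "s * (norm w)\<^sup>2 \<le> 1" by (simp_all add: s_def divide_simps)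
  have "cinner x ((- complex_of_real s * \<alpha>) *\<^sub>C w) = - complex_of_real s * (\<alpha> * cnj \<alpha>)"
    by (simp add: cinner_scaleC_right \<alpha>_def cinner_commute[of w x] cinner.minus_right)
  also have "\<dots> = complex_of_real (- s * (cmod \<alpha>)\<^sup>2)"
    by (simp add: complex_norm_square[symmetric])
  finally have c: "Re (cinner x ((- complex_of_real s * \<alpha>) *\<^sub>C w)) = - s * (cmod \<alpha>)\<^sup>2"
    by (simp del: of_real_power)
  have "(norm x)\<^sup>2 \<le> (norm (x + (- complex_of_real s * \<alpha>) *\<^sub>C w))\<^sup>2"
    using assms[of "complex_of_real s * \<alpha>"] by simp
  also have "\<dots> = (norm x)\<^sup>2 - 2 * (s * (cmod \<alpha>)\<^sup>2) + s * (s * (norm w)\<^sup>2) * (cmod \<alpha>)\<^sup>2"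
    unfolding norm_add_square c norm_scaleC using s by (simp add: norm_mult power_mult_distrib power2_eq_square)
  also have "\<dots> \<le> (norm x)\<^sup>2 - 2 * (s * (cmod \<alpha>)\<^sup>2) + s * 1 * (cmod \<alpha>)\<^sup>2"
    using s by (intro add_left_mono mult_right_mono mult_left_mono) auto
  finally have "s * (cmod \<alpha>)\<^sup>2 \<le> 0" by simp
  hence "(cmod \<alpha>)\<^sup>2 \<le> 0" using s by (simp add: mult_le_0_iff)
  thus ?thesis by (simp add: \<alpha>_def)
qed

text \<open>The midpoint of two nearly closest points of \<open>K\<close> is again in
  \<open>K\<close>, so the parallelogram law bounds their distance and a minimizing sequence is
  Cauchy. Its limit cannot be improved by any shift along \<open>K\<close>, which is
  orthogonality.\<close>

lemma orthogonal_projection_exists: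
  fixes K :: "'a::chilbert_space set"
  assumes K: "csubspace K" "closed K"
  obtains v where "v \<in> K" "\<And>w. w \<in> K \<Longrightarrow> cinner w (u - v) = 0"
proof -
  define D where "D = (\<lambda>k. (norm (u - k))\<^sup>2) ` K"
  define d where "d = Inf D"
  have K0: "0 \<in> K" using K(1) unfolding csubspace_iff by blast
  have D: "D \<noteq> {}" "bdd_below D" using K0 by (auto simp: D_def intro!: bdd_belowI2[of _ 0])
  have dle: "d \<le> (norm (u - k))\<^sup>2" if "k \<in> K" for k
    unfolding d_def using D that by (intro cInf_lower) (auto simp: D_def)
  have "\<exists>k\<in>K. (norm (u - k))\<^sup>2 < d + 1 / real (Suc n)" for n
    using cInf_lessD[OF D(1), of "d + 1 / real (Suc n)"] unfolding d_def by (auto simp: D_def)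
  then obtain k where k: "\<And>n. k n \<in> K" "\<And>n. (norm (u - k n))\<^sup>2 < d + 1 / real (Suc n)" by metis
  have diff: "(norm (k m - k n))\<^sup>2 \<le> 2 / real (Suc m) + 2 / real (Suc n)" for m n
  proof -
    have mid: "(1/2) *\<^sub>R (k m + k n) \<in> K"
      using K(1) k(1) by (intro csubspace_scaleR) (auto simp: csubspace_iff)
    have "(u - k m) + (u - k n) = 2 *\<^sub>R (u - (1/2) *\<^sub>R (k m + k n))"
      by (simp add: algebra_simps scaleR_2)
    hence "(norm ((u - k m) + (u - k n)))\<^sup>2 = 4 * (norm (u - (1/2) *\<^sub>R (k m + k n)))\<^sup>2"
      by (simp add: power_mult_distrib)
    also have "\<dots> \<ge> 4 * d" using dle[OF mid] by simp
    finally have "4 * d \<le> (norm ((u - k m) + (u - k n)))\<^sup>2" .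
    moreover have "(u - k m) - (u - k n) = - (k m - k n)" by simp
    hence "(norm ((u - k m) - (u - k n)))\<^sup>2 = (norm (k m - k n))\<^sup>2" by (simp only: norm_minus_cancel)
    ultimately show ?thesis
      using parallelogram[of "u - k m" "u - k n"] k(2)[of m] k(2)[of n]
      by (simp add: distrib_left)
  qed
  have "Cauchy k"
  proof (rule CauchyI)
    fix e :: real assume e: "e > 0"
    obtain N where N: "4 / e\<^sup>2 < real N" using reals_Archimedean2 by blast
    have N0: "real N > 0" using e by (intro order.strict_trans[OF _ N]) simp
    show "\<exists>M. \<forall>m\<ge>M. \<forall>n\<ge>M. norm (k m - k n) < e"
    proof (intro exI allI impI)
      fix m n assume "m \<ge> N" "n \<ge> N"
      have "(norm (k m - k n))\<^sup>2 \<le> 2 / real (Suc m) + 2 / real (Suc n)" by (rule diff)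
      also have "\<dots> \<le> 2 / real N + 2 / real N"
        using \<open>m \<ge> N\<close> \<open>n \<ge> N\<close> N0 by (intro add_mono divide_left_mono) auto
      also have "\<dots> < e\<^sup>2" using N N0 e by (simp add: field_simps)
      finally show "norm (k m - k n) < e" using e by (simp add: power_less_imp_less_base)
    qed
  qed
  then obtain v where v: "k \<longlonglongrightarrow> v" using Cauchy_convergent_iff convergent_def by blast
  have vK: "v \<in> K" using closed_sequentially[OF K(2)] k(1) v by blast
  have "(norm (u - v))\<^sup>2 \<le> d"
  proof (rule LIMSEQ_le)
    show "(\<lambda>n. (norm (u - k n))\<^sup>2) \<longlonglongrightarrow> (norm (u - v))\<^sup>2" by (intro tendsto_intros v)
    have "(\<lambda>n. d + 1 / real (Suc n)) \<longlonglongrightarrow> d + 0"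
      by (intro tendsto_add tendsto_const LIMSEQ_inverse_real_of_nat[unfolded inverse_eq_divide])
    thus "(\<lambda>n. d + 1 / real (Suc n)) \<longlonglongrightarrow> d" by simp
    show "\<exists>N. \<forall>n\<ge>N. (norm (u - k n))\<^sup>2 \<le> d + 1 / real (Suc n)" using k(2) less_imp_le by blast
  qed
  hence min: "(norm (u - v))\<^sup>2 \<le> (norm (u - w))\<^sup>2" if "w \<in> K" for w using dle[OF that] by (rule order_trans)
  have "cinner w (u - v) = 0" if w: "w \<in> K" for w
  proof (rule orthogonal_if_minimal)
    fix c
    have "v + c *\<^sub>C w \<in> K" using K(1) vK w unfolding csubspace_iff by blast
    from min[OF this] show "(norm (u - v))\<^sup>2 \<le> (norm (u - v - c *\<^sub>C w))\<^sup>2"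
      by (simp add: diff_diff_add)
  qed
  with vK show ?thesis using that by blast
qed

lemma orth_proj_eqI:
  assumes "csubspace K" "v \<in> K" "\<And>w. w \<in> K \<Longrightarrow> cinner w (u - v) = 0"
  shows "orth_proj K u = v"
  unfolding orth_proj_def
proof (rule the_equality)
  fix v' assume v': "v' \<in> K \<and> (\<forall>w\<in>K. cinner w (u - v') = 0)"
  have "v - v' \<in> K" using assms v' by (intro csubspace_diff) auto
  hence "cinner (v - v') ((u - v') - (u - v)) = 0"
    using assms(3) v' by (simp only: cinner.diff_right) simp
  thus "v' = v" using cinner_self[of "v - v'"] by simp
qed (use assms in auto)

text \<open>A nonzero functional is fixed by one vector \<open>z\<close> orthogonal to its closed
  kernel: for every \<open>x\<close> the combination
  \<open>f z *\<^sub>C x - f x *\<^sub>C z\<close> lies in the kernel, and pairing it with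
  \<open>z\<close> solves for \<open>f x\<close>.\<close>

lemma riesz_representation:
  fixes f :: "'a::chilbert_space \<Rightarrow> complex"
  assumes f: "bounded_linear f" and fC: "\<And>c x. f (c *\<^sub>C x) = c * f x"
  obtains w where "\<And>x. f x = cinner w x"
proof (cases "\<forall>x. f x = 0")
  case True
  thus ?thesis using that[of 0] by simp
next
  case False
  interpret f: bounded_linear f by fact
  define K where "K = {x. f x = 0}"
  have K: "csubspace K" unfolding K_def csubspace_iff by (auto simp: f.add fC f.zero)
  have "closed K" unfolding K_def
    by (intro closed_Collect_eq continuous_intros f.continuous_on)
  obtain x0 where x0: "f x0 \<noteq> 0" using False by blast
  obtain v where v: "v \<in> K" "\<And>w. w \<in> K \<Longrightarrow> cinner w (x0 - v) = 0"
    using orthogonal_projection_exists[OF K \<open>closed K\<close>] by metis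
  define z where "z = x0 - v"
  have fz: "f z \<noteq> 0" using v(1) x0 by (simp add: z_def f.diff K_def)
  hence z: "z \<noteq> 0" by (auto simp: f.zero)
  have orth: "cinner z y = 0" if "f y = 0" for y
    using v(2)[of y] that cinner_commute[of z y] by (simp add: K_def z_def)
  \<comment> \<open>The conjugate compensates antilinearity in the first argument; the scaling gives
    \<open>cinner w z = f z\<close>.\<close>
  define w where "w = (cnj (f z) / complex_of_real ((norm z)\<^sup>2)) *\<^sub>C z"
  have "f x = cinner w x" for x
  proof -
    have "cinner z (f z *\<^sub>C x - f x *\<^sub>C z) = 0"
      by (intro orth) (simp add: f.diff fC)
    hence "f z * cinner z x = f x * complex_of_real ((norm z)\<^sup>2)"
      by (simp add: cinner.diff_right cinner_scaleC_right cinner_self)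
    thus ?thesis using z by (simp add: w_def cinner_scaleC_left divide_simps mult.commute)
  qed
  thus ?thesis by (rule that)
qed

lemma cadjoint_eqI:
  assumes "\<And>u v. cinner (A u) v = cinner u (B v)"
  shows "cadjoint A = B"
  unfolding cadjoint_def
proof (rule the_equality)
  fix B' assume "\<forall>u v. cinner (A u) v = cinner u (B' v)"
  thus "B' = B" using assms by (intro ext cinner_ext) metis
qed (use assms in blast)

lemma bounded_clinearD:
  assumes "bounded_clinear A"
  shows "bounded_linear A" "A (c *\<^sub>C u) = c *\<^sub>C A u" "A (u + v) = A u + A v" "A (u - v) = A u - A v"
    "A 0 = 0" "A (- u) = - A u" "A (sum g I) = (\<Sum>i\<in>I. A (g i))"
proof -
  show *: "bounded_linear A" "A (c *\<^sub>C u) = c *\<^sub>C A u" using assms unfolding bounded_clinear_def by blast+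
  interpret bounded_linear A by fact
  show "A (u + v) = A u + A v" "A (u - v) = A u - A v"
    "A 0 = 0" "A (- u) = - A u" "A (sum g I) = (\<Sum>i\<in>I. A (g i))"
    by (simp_all add: add diff zero neg sum)
qed

text \<open>The description in \<open>cadjoint\<close> denotes the adjoint only once existence is
  known; this is Riesz representation of \<open>\<lambda>x. cinner v (A x)\<close> for each
  \<open>v\<close>.\<close>

lemma cinner_cadjoint:
  assumes A: "bounded_clinear A"
  shows "cinner (A u) v = cinner u (cadjoint A v)"
proof -
  have "\<exists>w. \<forall>x. cinner v (A x) = cinner w x" for v
  proof -
    have "bounded_linear (\<lambda>x. cinner v (A x))"
      by (rule bounded_linear_compose[OF cinner.bounded_linear_right bounded_clinearD(1)[OF A]])
    moreover have "cinner v (A (c *\<^sub>C x)) = c * cinner v (A x)" for c x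
      by (simp add: bounded_clinearD(2)[OF A] cinner_scaleC_right)
    ultimately show ?thesis by (metis riesz_representation[of "\<lambda>x. cinner v (A x)"])
  qed
  then obtain B where B: "\<And>v x. cinner v (A x) = cinner (B v) x" by metis
  have "cinner (A u) v = cinner u (B v)" for u v
    using B[of v u] by (metis cinner_commute)
  moreover from this have "cadjoint A = B" by (rule cadjoint_eqI)
  ultimately show ?thesis by simp
qed

text \<open>Polarization: the norm of \<open>u + v\<close> gives the real part, and replacing
  \<open>v\<close> by i times \<open>v\<close> gives the imaginary part. It is relative to a
  subspace because the wave operators are isometric only on the range of
  \<open>proj0 Q\<close>.\<close>

lemma cinner_isometry:
  assumes add: "\<And>u v. u \<in> S \<Longrightarrow> v \<in> S \<Longrightarrow> A (u + v) = A u + (A v :: 'b::chilbert_space)"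
    and scale: "\<And>c u. u \<in> S \<Longrightarrow> A (c *\<^sub>C u) = c *\<^sub>C A u"
    and iso: "\<And>u. u \<in> S \<Longrightarrow> norm (A u) = norm (u :: 'a::chilbert_space)"
    and S: "csubspace S" and u: "u \<in> S" and v: "v \<in> S"
  shows "cinner (A u) (A v) = cinner u v"
proof -
  have re: "Re (cinner (A u) (A v)) = Re (cinner u v)" if "u \<in> S" "v \<in> S" for u v
  proof -
    have "u + v \<in> S" using S that unfolding csubspace_iff by blast
    from iso[OF this] show ?thesis
      using norm_add_square[of u v] norm_add_square[of "A u" "A v"] iso[of u] iso[of v] that add[of u v] by simp
  qed
  have iv: "\<i> *\<^sub>C v \<in> S" using S v unfolding csubspace_iff by blast
  have "Re (\<i> * cinner (A u) (A v)) = Re (\<i> * cinner u v)"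
    using re[OF u iv] v by (simp add: scale cinner_scaleC_right)
  thus ?thesis using re[OF u v] by (simp add: complex_eq_iff)
qed

section \<open>Orthonormal bases and the trace\<close>

text \<open>\<open>op_trace\<close> selects its basis by \<open>SOME\<close>, so existence has to be
  shown. Zorn yields a maximal orthonormal set; a nonzero vector orthogonal to it could be
  normalized and adjoined.\<close>

lemma orthonormal_basis_exists: "\<exists>B :: 'h::chilbert_space set. orthonormal_basis B"
proof -
  define ON where "ON = {B :: 'h set. \<forall>e\<in>B. \<forall>e'\<in>B. cinner e e' = (if e = e' then 1 else 0)}"
  have "\<exists>M\<in>ON. \<forall>X\<in>ON. M \<subseteq> X \<longrightarrow> X = M"
  proof (rule subset_Zorn')
    fix C assume C: "subset.chain ON C"
    show "\<Union>C \<in> ON" unfolding ON_def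
    proof (intro CollectI ballI)
      fix e e' assume "e \<in> \<Union>C" "e' \<in> \<Union>C"
      then obtain X Y where XY: "X \<in> C" "e \<in> X" "Y \<in> C" "e' \<in> Y" by blast
      hence "X \<subseteq> Y \<or> Y \<subseteq> X" "X \<in> ON" "Y \<in> ON" using C unfolding subset.chain_def by blast+
      then obtain Z where "Z \<in> ON" "e \<in> Z" "e' \<in> Z" using XY by blast
      thus "cinner e e' = (if e = e' then 1 else 0)" unfolding ON_def by blast
    qed
  qed
  then obtain M where M: "M \<in> ON" "\<And>X. X \<in> ON \<Longrightarrow> M \<subseteq> X \<Longrightarrow> X = M" by blast
  have "u = 0" if u: "\<forall>e\<in>M. cinner e u = 0" for u
  proof (rule ccontr)
    assume u0: "u \<noteq> 0"
    define v where "v = complex_of_real (inverse (norm u)) *\<^sub>C u"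
    have vv: "cinner v v = 1" using u0 unfolding cinner_self v_def norm_scaleC
      by (simp del: of_real_inverse)
    have ev: "cinner e v = 0" "cinner v e = 0" if "e \<in> M" for e
      using u that cinner_commute[of u e] by (simp_all add: v_def cinner_scaleC_right cinner_scaleC_left)
    hence "insert v M \<in> ON" using M(1) vv unfolding ON_def by auto
    hence "v \<in> M" using M(2)[of "insert v M"] by blast
    thus False using ev(1)[of v] vv by simp
  qed
  thus ?thesis using M(1) unfolding orthonormal_basis_def ON_def by blast
qed

lemma cinner_finite_orthonormal_sum:
  assumes "finite F" "\<And>e e'. e \<in> F \<Longrightarrow> e' \<in> F \<Longrightarrow> cinner e e' = (if e = e' then 1 else 0)" "e \<in> F"
  shows "cinner e (\<Sum>x\<in>F. c x *\<^sub>C x) = c e"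
proof -
  have "cinner e (\<Sum>x\<in>F. c x *\<^sub>C x) = (\<Sum>x\<in>F. c x * (if e = x then 1 else 0))"
    using assms by (simp add: cinner.sum_right cinner_scaleC_right)
  also have "\<dots> = c e" using assms by (simp add: if_distrib[of "\<lambda>x. _ * x"] cong: if_cong)
  finally show ?thesis .
qed

text \<open>Pythagoras: the projection differs from \<open>v\<close> by an element of the span, to
  which the error of the projection is orthogonal.\<close>

lemma best_approximation:
  assumes F: "finite F" "\<And>e e'. e \<in> F \<Longrightarrow> e' \<in> F \<Longrightarrow> cinner e e' = (if e = e' then 1 else 0)"
    and v: "v \<in> cspan F"
  shows "norm (u - (\<Sum>e\<in>F. cinner e u *\<^sub>C e)) \<le> norm (u - v)"
proof -
  define p where "p = (\<Sum>e\<in>F. cinner e u *\<^sub>C e)"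
  have "cinner e (u - p) = 0" if "e \<in> F" for e
    unfolding p_def cinner.diff_right using cinner_finite_orthonormal_sum[OF F that] by simp
  hence "cinner (u - p) e = 0" if "e \<in> F" for e using that cinner_commute[of "u - p" e] by simp
  moreover have "csubspace {x. cinner (u - p) x = 0}"
    unfolding csubspace_iff by (auto simp: cinner.add_right cinner_scaleC_right)
  ultimately have "cspan F \<subseteq> {x. cinner (u - p) x = 0}"
    by (intro complex_vector.span_minimal) auto
  moreover have "p - v \<in> cspan F" unfolding p_def
    by (intro complex_vector.span_diff complex_vector.span_sum complex_vector.span_scale
        complex_vector.span_base v)
  ultimately have "cinner (u - p) (p - v) = 0" by auto
  hence "(norm ((u - p) + (p - v)))\<^sup>2 = (norm (u - p))\<^sup>2 + (norm (p - v))\<^sup>2"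
    unfolding norm_add_square by simp
  hence "(norm (u - p))\<^sup>2 \<le> (norm (u - v))\<^sup>2" by simp
  thus ?thesis unfolding p_def by (rule power2_le_imp_le) simp
qed

text \<open>Totality makes the span dense. If \<open>y\<close> in the span of a finite
  \<open>F\<close> is close to \<open>u\<close>, then by best approximation the partial sum over any
  finite set containing \<open>F\<close> is at least as close. This is unordered convergence, also
  for an uncountable basis.\<close>

lemma orthonormal_basis_expansion:
  assumes B: "orthonormal_basis (B :: 'h::chilbert_space set)"
  shows "((\<lambda>e. cinner e u *\<^sub>C e) has_sum u) B"
proof -
  have on: "\<And>e e'. e \<in> B \<Longrightarrow> e' \<in> B \<Longrightarrow> cinner e e' = (if e = e' then 1 else 0)"
    and tot: "\<And>u. (\<forall>e\<in>B. cinner e u = 0) \<Longrightarrow> u = 0" using B unfolding orthonormal_basis_def by blast+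
  have "csubspace (closure (cspan B))" by (intro csubspace_closure complex_vector.subspace_span)
  then obtain v where v: "v \<in> closure (cspan B)" "\<And>w. w \<in> closure (cspan B) \<Longrightarrow> cinner w (u - v) = 0"
    using orthogonal_projection_exists[of "closure (cspan B)" u] by auto
  have "cinner e (u - v) = 0" if "e \<in> B" for e
    using that closure_subset complex_vector.span_base by (intro v(2)) blast
  hence "u - v = 0" by (intro tot) blast
  hence u: "u \<in> closure (cspan B)" using v(1) by simp
  show ?thesis unfolding has_sum_def tendsto_iff eventually_finite_subsets_at_top
  proof (intro allI impI)
    fix \<epsilon> :: real assume "\<epsilon> > 0"
    then obtain y where y: "y \<in> cspan B" "dist y u < \<epsilon>" using u unfolding closure_approachable by blast
    obtain F where F: "F \<subseteq> B" "finite F" "y \<in> cspan F"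
    proof -
      obtain F r where *: "F \<subseteq> B" "finite F" "y = (\<Sum>a\<in>F. r a *\<^sub>C a)"
        using y(1) unfolding complex_vector.span_explicit by blast
      have "y \<in> cspan F" unfolding *(3)
        by (intro complex_vector.span_sum complex_vector.span_scale complex_vector.span_base)
      with * show ?thesis using that by blast
    qed
    show "\<exists>X. finite X \<and> X \<subseteq> B \<and> (\<forall>Y. finite Y \<and> X \<subseteq> Y \<and> Y \<subseteq> B \<longrightarrow> dist (sum (\<lambda>e. cinner e u *\<^sub>C e) Y) u < \<epsilon>)"
    proof (intro exI[of _ F] conjI allI impI)
      fix Y assume Y: "finite Y \<and> F \<subseteq> Y \<and> Y \<subseteq> B"
      have "norm (u - (\<Sum>e\<in>Y. cinner e u *\<^sub>C e)) \<le> norm (u - y)"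
      proof (rule best_approximation)
        show "cinner e e' = (if e = e' then 1 else 0)" if "e \<in> Y" "e' \<in> Y" for e e'
          using Y that by (intro on) auto
        show "y \<in> cspan Y" using Y F(3) complex_vector.span_mono[of F Y] by auto
      qed (use Y in simp)
      thus "dist (\<Sum>e\<in>Y. cinner e u *\<^sub>C e) u < \<epsilon>" using y(2) by (simp add: dist_norm norm_minus_commute)
    qed (use F in auto)
  qed
qed

text \<open>Expanding each \<open>a l\<close> in the chosen basis sums the diagonal of |a l><b l| to
  \<open>cinner (b l) (a l)\<close>. From here on the choice of basis is invisible.\<close>

lemma op_trace_sum_rank_one:
  fixes A :: "'h::chilbert_space \<Rightarrow> 'h"
  assumes I: "finite I" and A: "\<And>u. A u = (\<Sum>l\<in>I. cinner (b l) u *\<^sub>C a l)"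
  shows "op_trace A = (\<Sum>l\<in>I. cinner (b l) (a l))"
proof -
  define B :: "'h set" where "B = (SOME B. orthonormal_basis B)"
  have B: "orthonormal_basis B" unfolding B_def using orthonormal_basis_exists by (rule someI_ex)
  have *: "((\<lambda>e. cinner (b l) e * cinner e (a l)) has_sum cinner (b l) (a l)) B" for l
    using has_sum_bounded_linear[OF cinner.bounded_linear_right orthonormal_basis_expansion[OF B], of "b l" "a l"]
    by (simp add: o_def cinner_scaleC_right mult.commute)
  have "((\<lambda>e. \<Sum>l\<in>I. cinner (b l) e * cinner e (a l)) has_sum (\<Sum>l\<in>I. cinner (b l) (a l))) B"
    using I
  proof (induction I rule: finite_induct)
    case (insert l I)
    thus ?case by (simp add: has_sum_add *)
  qed simp
  moreover have "(\<Sum>l\<in>I. cinner (b l) e * cinner e (a l)) = cinner e (A e)" for e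
    by (simp add: A cinner.sum_right cinner_scaleC_right)
  ultimately show ?thesis unfolding op_trace_def B_def[symmetric] by (simp add: infsumI)
qed

text \<open>Gram-Schmidt: of each new vector the normalized component orthogonal to the earlier ones
  is adjoined, or nothing if that component vanishes.\<close>

lemma finite_orthonormal_span:
  assumes "finite (B :: 'h::chilbert_space set)"
  obtains F where "finite F" "\<And>e e'. e \<in> F \<Longrightarrow> e' \<in> F \<Longrightarrow> cinner e e' = (if e = e' then 1 else 0)"
    "B \<subseteq> cspan F"
  using assms
proof (induction B arbitrary: thesis rule: finite_induct)
  case empty
  show ?case by (rule empty[of "{}"]) auto
next
  case (insert x B)
  obtain F where F: "finite F" "\<And>e e'. e \<in> F \<Longrightarrow> e' \<in> F \<Longrightarrow> cinner e e' = (if e = e' then 1 else 0)"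
    "B \<subseteq> cspan F" using insert.IH by blast
  define p where "p = (\<Sum>e\<in>F. cinner e x *\<^sub>C e)"
  have p: "p \<in> cspan F" unfolding p_def
    by (intro complex_vector.span_sum complex_vector.span_scale complex_vector.span_base)
  have orth: "cinner e (x - p) = 0" if "e \<in> F" for e
    unfolding p_def cinner.diff_right using cinner_finite_orthonormal_sum[OF F(1,2) that] by simp
  show ?case
  proof (cases "x = p")
    case True
    thus ?thesis using F p by (intro insert.prems[of F]) auto
  next
    case False
    define v where "v = complex_of_real (inverse (norm (x - p))) *\<^sub>C (x - p)"
    have vv: "cinner v v = 1" using False unfolding cinner_self v_def norm_scaleC
      by (simp del: of_real_inverse)
    have ev: "cinner e v = 0" "cinner v e = 0" if "e \<in> F" for e
      using orth[OF that] cinner_commute[of "x - p" e] by (simp_all add: v_def cinner_scaleC_right cinner_scaleC_left)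
    have "x - p = complex_of_real (norm (x - p)) *\<^sub>C v"
      unfolding v_def scaleC_scaleC of_real_mult[symmetric] using False scaleC_of_real[of 1] by simp
    hence "x - p \<in> cspan (insert v F)"
      by (metis complex_vector.span_base complex_vector.span_scale insertI1)
    moreover have mono: "cspan F \<subseteq> cspan (insert v F)" by (intro complex_vector.span_mono) auto
    ultimately have "x - p + p \<in> cspan (insert v F)" using p by (intro complex_vector.span_add) auto
    hence "x \<in> cspan (insert v F)" by simp
    thus ?thesis using F ev vv mono by (intro insert.prems[of "insert v F"]) auto
  qed
qed

text \<open>This sum of rank-one operators is the form in which finite rank enters the trace, the
  decay of the coupling and the Fourier expansion of the current.\<close>

lemma finite_rank_expansion:
  assumes "finite_rank (C :: 'h::chilbert_space \<Rightarrow> 'h)"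
  obtains F where "finite F" "\<And>u. C u = (\<Sum>e\<in>F. cinner e (C u) *\<^sub>C e)"
proof -
  obtain B where B: "finite B" "range C \<subseteq> cspan B" using assms unfolding finite_rank_def by blast
  obtain F where F: "finite F" "\<And>e e'. e \<in> F \<Longrightarrow> e' \<in> F \<Longrightarrow> cinner e e' = (if e = e' then 1 else 0)"
    "B \<subseteq> cspan F" using finite_orthonormal_span[OF B(1)] by metis
  have "cspan B \<subseteq> cspan F"
    using F(3) by (intro complex_vector.span_minimal complex_vector.subspace_span)
  hence "C u \<in> cspan F" for u using B(2) by blast
  hence "C u = (\<Sum>e\<in>F. cinner e (C u) *\<^sub>C e)" for u
    using best_approximation[OF F(1,2), of "C u" "C u"] by simp
  thus ?thesis using that F(1) by blast
qed

section \<open>Fourier analysis on the line, from translations to Plancherel's identity\<close>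

section \<open>Translations in L1\<close>

lemma integrable_translation:
  fixes f :: "real \<Rightarrow> 'a::{banach, second_countable_topology}"
  assumes "integrable lborel f"
  shows "integrable lborel (\<lambda>x. f (x + s))"
  using lborel_integrable_real_affine[OF assms, of 1 s] by (simp add: add.commute)

lemma integral_translation:
  fixes f :: "real \<Rightarrow> 'a::{banach, second_countable_topology}"
  shows "(LBINT x. f (x + s)) = (LBINT x. f x)"
  using lborel_integral_real_affine[of 1 f s] by (simp add: add.commute)

text \<open>Translation preserves the L1 norm, so the shift error of \<open>f\<close> exceeds that
  of \<open>g\<close> by at most twice the distance of \<open>f\<close> and \<open>g\<close>. It
  serves two cases of the induction below: indicators approximated by open sets, and limits.\<close>

lemma L1_translation_approx:
  fixes f :: "real \<Rightarrow> complex" and s :: "nat \<Rightarrow> real"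
  assumes f: "integrable lborel f"
    and approx: "\<And>e. e > 0 \<Longrightarrow> \<exists>g. integrable lborel g \<and> (LBINT x. norm (f x - g x)) < e \<and>
        (\<lambda>n. LBINT x. norm (g (x + s n) - g x)) \<longlonglongrightarrow> 0"
  shows "(\<lambda>n. LBINT x. norm (f (x + s n) - f x)) \<longlonglongrightarrow> 0"
proof (rule LIMSEQ_I)
  fix e :: real assume e: "e > 0"
  then obtain g where g: "integrable lborel g" "(LBINT x. norm (f x - g x)) < e/3"
    "(\<lambda>n. LBINT x. norm (g (x + s n) - g x)) \<longlonglongrightarrow> 0" using approx[of "e/3"] by auto
  obtain N where N: "\<And>n. n \<ge> N \<Longrightarrow> norm ((LBINT x. norm (g (x + s n) - g x)) - 0) < e/3"
    using LIMSEQ_D[OF g(3), of "e/3"] e by auto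
  show "\<exists>no. \<forall>n\<ge>no. norm ((LBINT x. norm (f (x + s n) - f x)) - 0) < e"
  proof (intro exI allI impI)
    fix n assume n: "n \<ge> N"
    note [intro] = f g(1) integrable_translation[OF f] integrable_translation[OF g(1)]
    have i: "integrable lborel (\<lambda>x. norm (f x - g x))" by (intro integrable_norm Bochner_Integration.integrable_diff) auto
    have "(LBINT x. norm (f (x + s n) - f x)) \<le>
        (LBINT x. norm (f (x + s n) - g (x + s n)) + norm (g (x + s n) - g x) + norm (f x - g x))"
    proof (rule integral_mono)
      fix x
      have "f (x + s n) - f x = (f (x + s n) - g (x + s n)) + (g (x + s n) - g x) - (f x - g x)" by simp
      thus "norm (f (x + s n) - f x) \<le> norm (f (x + s n) - g (x + s n)) + norm (g (x + s n) - g x) + norm (f x - g x)"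
        by (metis (no_types, lifting) add_right_mono norm_triangle_ineq norm_triangle_ineq4 order_trans)
    qed (intro Bochner_Integration.integrable_add integrable_norm Bochner_Integration.integrable_diff; auto)+
    also have "\<dots> = (LBINT x. norm (f (x + s n) - g (x + s n))) + (LBINT x. norm (g (x + s n) - g x))
        + (LBINT x. norm (f x - g x))"
      using i integrable_norm[OF Bochner_Integration.integrable_diff[OF integrable_translation[OF g(1), of "s n"] g(1)]]
        integrable_translation[OF i, of "s n"] by simp
    also have "(LBINT x. norm (f (x + s n) - g (x + s n))) = (LBINT x. norm (f x - g x))"
      by (rule integral_translation)
    also have "\<dots> + (LBINT x. norm (g (x + s n) - g x)) + (LBINT x. norm (f x - g x)) < e"
      using g(2) N[OF n] by simp
    finally show "norm ((LBINT x. norm (f (x + s n) - f x)) - 0) < e" by simp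
  qed
qed

text \<open>An open set contains \<open>x + s n\<close> eventually if it contains \<open>x\<close>, so dominated convergence applies to the
  measure of its overlap with the translates; nothing is needed about its boundary.\<close>

lemma L1_translation_open:
  fixes s :: "nat \<Rightarrow> real" and c :: complex
  assumes U: "open U" "emeasure lborel U < \<infinity>" and s: "s \<longlonglongrightarrow> 0"
  shows "(\<lambda>n. LBINT x. norm (indicator U (x + s n) *\<^sub>R c - indicator U x *\<^sub>R c)) \<longlonglongrightarrow> 0"
proof -
  let ?i = "indicator U :: real \<Rightarrow> real"
  have [measurable]: "U \<in> sets borel" using U by simp
  have i: "integrable lborel ?i" using U by (intro integrable_real_indicator) auto
  have prod: "integrable lborel (\<lambda>x. ?i x * ?i (x + s n))" for n
    by (rule Bochner_Integration.integrable_bound[OF i]) (auto simp: indicator_def)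
  have lim: "(\<lambda>n. LBINT x. ?i x * ?i (x + s n)) \<longlonglongrightarrow> (LBINT x. ?i x)"
  proof (rule integral_dominated_convergence[where w = ?i])
    show "AE x in lborel. (\<lambda>n. ?i x * ?i (x + s n)) \<longlonglongrightarrow> ?i x"
    proof (intro AE_I2)
      fix x
      show "(\<lambda>n. ?i x * ?i (x + s n)) \<longlonglongrightarrow> ?i x"
      proof (cases "x \<in> U")
        case True
        have "(\<lambda>n. x + s n) \<longlonglongrightarrow> x" using tendsto_add[OF tendsto_const s, of x] by simp
        hence "eventually (\<lambda>n. x + s n \<in> U) sequentially" using U(1) True by (rule topological_tendstoD)
        thus ?thesis using True by (intro tendsto_eventually) (auto elim: eventually_mono)
      qed simp
    qed
  qed (use i in \<open>auto simp: indicator_def\<close>)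
  have eq: "(LBINT x. norm (?i (x + s n) *\<^sub>R c - ?i x *\<^sub>R c))
      = (2 * (LBINT x. ?i x) - 2 * (LBINT x. ?i x * ?i (x + s n))) * norm c" for n
  proof -
    have "norm (?i (x + s n) *\<^sub>R c - ?i x *\<^sub>R c) = (?i (x + s n) + ?i x - 2 * (?i x * ?i (x + s n))) * norm c" for x
      by (auto simp: indicator_def)
    hence "(LBINT x. norm (?i (x + s n) *\<^sub>R c - ?i x *\<^sub>R c))
      = (LBINT x. (?i (x + s n) + ?i x - 2 * (?i x * ?i (x + s n))) * norm c)" by (simp only:)
    also have "\<dots> = ((LBINT x. ?i (x + s n)) + (LBINT x. ?i x) - 2 * (LBINT x. ?i x * ?i (x + s n))) * norm c"
      using i prod integrable_translation[OF i] by simp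
    finally show ?thesis using integral_translation[of ?i] by simp
  qed
  have "(\<lambda>n. (2 * (LBINT x. ?i x) - 2 * (LBINT x. ?i x * ?i (x + s n))) * norm c)
     \<longlonglongrightarrow> (2 * (LBINT x. ?i x) - 2 * (LBINT x. ?i x)) * norm c"
    by (intro tendsto_intros lim)
  thus ?thesis unfolding eq by simp
qed

text \<open>Outer regularity replaces a Borel set by an open set of nearly the same measure, where
  the previous lemma applies; sums and dominated limits then reach every integrable
  function.\<close>

lemma L1_translation_continuous:
  fixes f :: "real \<Rightarrow> complex" and s :: "nat \<Rightarrow> real"
  assumes f: "integrable lborel f" and s: "s \<longlonglongrightarrow> 0"
  shows "(\<lambda>n. LBINT x. norm (f (x + s n) - f x)) \<longlonglongrightarrow> 0"
  using f
proof (induction rule: integrable_induct)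
  case (base A c)
  have A [measurable]: "A \<in> sets borel" using base by simp
  have iA: "integrable lborel (\<lambda>x. indicator A x *\<^sub>R c)" using base by (intro integrable_scaleR_left integrable_real_indicator) auto
  show ?case
  proof (rule L1_translation_approx[OF iA])
    fix e :: real assume e: "e > 0"
    \<comment> \<open>The summand 1 gives \<open>e' * norm c < e\<close> also for
      \<open>c = 0\<close>.\<close>
    define e' where "e' = e / (norm c + 1)"
    have e': "e' > 0" unfolding e'_def using e by (intro divide_pos_pos) (auto simp: add_nonneg_pos)
    obtain U where U: "open U" "A \<subseteq> U" "emeasure lebesgue (U - A) < ennreal e'"
      using sets_lebesgue_outer_open[of A e'] e' A by auto
    have [measurable]: "U \<in> sets borel" using U by simp
    have UA: "emeasure lborel (U - A) < ennreal e'" using U(3) by (simp add: emeasure_completion)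
    have "emeasure lborel U \<le> emeasure lborel A + emeasure lborel (U - A)"
      using U(2) by (intro order_trans[OF _ emeasure_subadditive] emeasure_mono) auto
    also have "\<dots> < \<infinity>" using base UA by (auto simp: less_top[symmetric] top_unique)
    finally have fin: "emeasure lborel U < \<infinity>" .
    have iU: "integrable lborel (\<lambda>x. indicator U x *\<^sub>R c)" using fin by (intro integrable_scaleR_left integrable_real_indicator) auto
    have "norm (indicator A x *\<^sub>R c - indicator U x *\<^sub>R c) = indicator (U - A) x * norm c" for x
      using U(2) by (auto simp: indicator_def)
    hence "(LBINT x. norm (indicator A x *\<^sub>R c - indicator U x *\<^sub>R c)) = measure lborel (U - A) * norm c" by simp
    also have "\<dots> \<le> e' * norm c"
      using UA e' by (intro mult_right_mono) (auto simp: measure_def intro!: enn2real_leI)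
    also have "\<dots> < e' * (norm c + 1)" using e' by simp
    also have "\<dots> = e" unfolding e'_def by (simp add: add_nonneg_eq_0_iff)
    finally show "\<exists>g. integrable lborel g \<and> (LBINT x. norm (indicator A x *\<^sub>R c - g x)) < e \<and>
        (\<lambda>n. LBINT x. norm (g (x + s n) - g x)) \<longlonglongrightarrow> 0"
      using iU L1_translation_open[OF U(1) fin s, of c] by (intro exI[of _ "\<lambda>x. indicator U x *\<^sub>R c"]) blast
  qed
next
  case (add f g)
  have "(\<lambda>n. (LBINT x. norm (f (x + s n) - f x)) + (LBINT x. norm (g (x + s n) - g x))) \<longlonglongrightarrow> 0 + 0"
    by (intro tendsto_add add.IH)
  hence lim: "(\<lambda>n. (LBINT x. norm (f (x + s n) - f x)) + (LBINT x. norm (g (x + s n) - g x))) \<longlonglongrightarrow> 0" by simp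
  note [intro] = add.hyps integrable_translation[OF add.hyps(1)] integrable_translation[OF add.hyps(2)]
  show ?case
  proof (rule tendsto_sandwich[OF _ _ tendsto_const lim])
    show "eventually (\<lambda>n. (LBINT x. norm (f (x + s n) + g (x + s n) - (f x + g x)))
       \<le> (LBINT x. norm (f (x + s n) - f x)) + (LBINT x. norm (g (x + s n) - g x))) sequentially"
    proof (intro always_eventually allI)
      fix n
      have "(LBINT x. norm (f (x + s n) + g (x + s n) - (f x + g x)))
         \<le> (LBINT x. norm (f (x + s n) - f x) + norm (g (x + s n) - g x))"
      proof (rule integral_mono)
        fix x show "norm (f (x + s n) + g (x + s n) - (f x + g x)) \<le> norm (f (x + s n) - f x) + norm (g (x + s n) - g x)"
          by (metis add_diff_add norm_triangle_ineq)
      qed (intro Bochner_Integration.integrable_add integrable_norm Bochner_Integration.integrable_diff; auto)+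
      also have "\<dots> = (LBINT x. norm (f (x + s n) - f x)) + (LBINT x. norm (g (x + s n) - g x))"
        by (intro Bochner_Integration.integral_add integrable_norm Bochner_Integration.integrable_diff; auto)
      finally show "(LBINT x. norm (f (x + s n) + g (x + s n) - (f x + g x)))
       \<le> (LBINT x. norm (f (x + s n) - f x)) + (LBINT x. norm (g (x + s n) - g x))" .
    qed
  qed (simp add: always_eventually)
next
  case (lim f g)
  note [measurable] = borel_measurable_integrable[OF lim.hyps(1)] borel_measurable_integrable[OF lim.hyps(4)]
  have "(\<lambda>i. LBINT x. norm (f x - g i x)) \<longlonglongrightarrow> (\<integral>x. 0 \<partial>(lborel :: real measure))"
  proof (rule integral_dominated_convergence[where w = "\<lambda>x. 3 * norm (f x)"])
    show "AE x in lborel. (\<lambda>i. norm (f x - g i x)) \<longlonglongrightarrow> 0"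
    proof (intro AE_I2 tendsto_norm_zero)
      fix x
      have "(\<lambda>i. f x - g i x) \<longlonglongrightarrow> f x - f x" by (intro tendsto_diff tendsto_const lim.hyps(2)) simp
      thus "(\<lambda>i. f x - g i x) \<longlonglongrightarrow> 0" by simp
    qed
    show "AE x in lborel. norm (norm (f x - g i x)) \<le> 3 * norm (f x)" for i
    proof (intro AE_I2)
      fix x
      have "norm (f x - g i x) \<le> norm (f x) + norm (g i x)" by (rule norm_triangle_ineq4)
      also have "\<dots> \<le> 3 * norm (f x)" using lim.hyps(3)[of x i] by simp
      finally show "norm (norm (f x - g i x)) \<le> 3 * norm (f x)" by simp
    qed
  qed (use lim.hyps(4) in auto)
  hence l: "(\<lambda>i. LBINT x. norm (f x - g i x)) \<longlonglongrightarrow> 0" by simp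
  show ?case
  proof (rule L1_translation_approx[OF lim.hyps(4)])
    fix e :: real assume "e > 0"
    then obtain i where "norm ((LBINT x. norm (f x - g i x)) - 0) < e" using LIMSEQ_D[OF l, of e] by auto
    thus "\<exists>g. integrable lborel g \<and> (LBINT x. norm (f x - g x)) < e \<and>
        (\<lambda>n. LBINT x. norm (g (x + s n) - g x)) \<longlonglongrightarrow> 0"
      using lim.hyps(1) lim.IH by (intro exI[of _ "g i"]) auto
  qed
qed

section \<open>Fourier integrals\<close>

lemma iexp_add: "iexp (x + y) = iexp x * iexp y"
  by (simp add: distrib_left exp_add)

lemma integrable_iexp_mult:
  assumes "integrable lborel (g :: real \<Rightarrow> complex)"
  shows "integrable lborel (\<lambda>x. iexp (t * x) * g x)"
  using borel_measurable_integrable[OF assms]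
  by (intro Bochner_Integration.integrable_bound[OF assms]) (auto simp: norm_mult)

text \<open>Shifting the variable by \<open>pi / t\<close> flips the sign of the exponential. Hence
  twice the Fourier integral is an integral against the difference of \<open>g\<close> and its
  translate, which is small in L1.\<close>

lemma Riemann_Lebesgue:
  fixes g :: "real \<Rightarrow> complex"
  assumes g: "integrable lborel g"
  shows "((\<lambda>t. LBINT x. iexp (t * x) * g x) \<longlongrightarrow> 0) at_infinity"
proof -
  have bound: "cmod (LBINT x. iexp (t * x) * g x) \<le> (LBINT x. norm (g (x + pi / t) - g x))" if "t \<noteq> 0" for t
  proof -
    note it = integrable_translation[OF g, of "pi / t"]
    have "(LBINT x. iexp (t * x) * g (x + pi / t)) = (LBINT x. - (iexp (t * (x + pi / t)) * g (x + pi / t)))"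
    proof (rule Bochner_Integration.integral_cong)
      fix x
      have "t * (x + pi / t) = t * x + pi" using that by (simp add: field_simps)
      hence "iexp (t * (x + pi / t)) = iexp (t * x) * iexp pi" by (simp only: iexp_add)
      also have "iexp pi = -1" by (simp add: mult.commute[of \<i>] exp_pi_i)
      finally have "iexp (t * (x + pi / t)) = - iexp (t * x)" by simp
      thus "iexp (t * x) * g (x + pi / t) = - (iexp (t * (x + pi / t)) * g (x + pi / t))"
        by (simp only: mult_minus_left minus_minus)
    qed simp
    also have "\<dots> = - (LBINT x. iexp (t * x) * g x)"
      using integral_translation[of "\<lambda>y. iexp (t * y) * g y" "pi / t"] by simp
    finally have "- 2 * (LBINT x. iexp (t * x) * g x) = (LBINT x. iexp (t * x) * g (x + pi / t)) - (LBINT x. iexp (t * x) * g x)"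
      by simp
    also have "\<dots> = (LBINT x. iexp (t * x) * g (x + pi / t) - iexp (t * x) * g x)"
      by (intro Bochner_Integration.integral_diff[symmetric] integrable_iexp_mult g it)
    also have "cmod \<dots> \<le> (LBINT x. cmod (iexp (t * x) * g (x + pi / t) - iexp (t * x) * g x))"
      by (rule integral_norm_bound)
    also have "\<dots> = (LBINT x. norm (g (x + pi / t) - g x))"
      by (simp add: right_diff_distrib[symmetric] norm_mult)
    finally have "2 * cmod (LBINT x. iexp (t * x) * g x) \<le> (LBINT x. norm (g (x + pi / t) - g x))"
      by (simp add: norm_mult)
    thus ?thesis using norm_ge_zero[of "LBINT x. iexp (t * x) * g x"] by linarith
  qed
  define G where "G s = (LBINT x. norm (g (x + s) - g x))" for s
  have "(G \<longlongrightarrow> 0) (at 0)"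
    unfolding tendsto_at_iff_sequentially
    using L1_translation_continuous[OF g] by (auto simp: o_def G_def)
  moreover have "filterlim (\<lambda>t::real. pi / t) (at 0) at_infinity"
    unfolding filterlim_at
  proof
    show "eventually (\<lambda>t::real. pi / t \<in> UNIV \<and> pi / t \<noteq> 0) at_infinity"
      unfolding eventually_at_infinity by (intro exI[of _ 1]) auto
    show "((\<lambda>t::real. pi / t) \<longlongrightarrow> 0) at_infinity"
      by (intro tendsto_divide_0[OF tendsto_const] filterlim_ident)
  qed
  ultimately have "((\<lambda>t. G (pi / t)) \<longlongrightarrow> 0) at_infinity" by (rule filterlim_compose)
  moreover have "eventually (\<lambda>t. norm (LBINT x. iexp (t * x) * g x) \<le> G (pi / t)) at_infinity"
    unfolding eventually_at_infinity G_def using bound by (intro exI[of _ 1]) auto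
  ultimately show ?thesis by (rule Lim_null_comparison[rotated])
qed

text \<open>Shifting one variable by the other merges the two exponentials, and Fubini reorders the
  integrals. A product of transforms at opposite frequencies thus becomes one transform, whose
  inversion at 0 is Plancherel's identity.\<close>

lemma cross_correlation:
  fixes g h :: "real \<Rightarrow> complex"
  assumes g: "integrable lborel g" and h: "integrable lborel h"
  shows integrable_cross_correlation: "integrable lborel (\<lambda>s. LBINT x. h x * g (x + s))" (is ?int)
    and Fourier_cross_correlation: "(LBINT x. iexp (t * x) * g x) * (LBINT x. iexp (- t * x) * h x) =
       (LBINT s. iexp (t * s) * (LBINT x. h x * g (x + s)))" (is ?eq)
proof -
  note [measurable] = borel_measurable_integrable[OF g] borel_measurable_integrable[OF h]
  have tr: "integrable lborel (\<lambda>s. g (x + s))" for x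
    using integrable_translation[OF g, of x] by (simp add: add.commute)
  have P: "integrable (lborel \<Otimes>\<^sub>M lborel) (\<lambda>(x, s). iexp (t * s) * (h x * g (x + s)))" for t
  proof (rule lborel_pair.Fubini_integrable)
    have "(LBINT y. norm (case (x, y) of (x, s) \<Rightarrow> iexp (t * s) * (h x * g (x + s)))) = cmod (h x) * (LBINT y. norm (g y))" for x
      using integral_translation[of "\<lambda>y. norm (g y)" x] by (simp add: norm_mult add.commute)
    thus "integrable lborel (\<lambda>x. LBINT y. norm (case (x, y) of (x, s) \<Rightarrow> iexp (t * s) * (h x * g (x + s))))"
      using h by simp
    show "AE x in lborel. integrable lborel (\<lambda>y. case (x, y) of (x, s) \<Rightarrow> iexp (t * s) * (h x * g (x + s)))"
    proof (intro AE_I2)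
      fix x
      have "integrable lborel (\<lambda>y. h x * g (x + y))" using tr by simp
      from integrable_iexp_mult[OF this, of t]
      show "integrable lborel (\<lambda>y. case (x, y) of (x, s) \<Rightarrow> iexp (t * s) * (h x * g (x + s)))" by simp
    qed
  qed (simp add: split_beta')
  from lborel_pair.integrable_snd[OF P[of 0]] show ?int by simp
  have "(LBINT x. iexp (t * x) * g x) * (LBINT x. iexp (- t * x) * h x)
     = (LBINT x. (LBINT y. iexp (t * y) * g y) * (iexp (- t * x) * h x))" by simp
  also have "\<dots> = (LBINT x. (LBINT s. iexp (t * s) * (h x * g (x + s))))"
  proof (rule Bochner_Integration.integral_cong)
    fix x
    have "(LBINT y. iexp (t * y) * g y) = (LBINT s. iexp (t * (x + s)) * g (x + s))"
      using integral_translation[of "\<lambda>y. iexp (t * y) * g y" x] by (simp add: add.commute)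
    hence "(LBINT y. iexp (t * y) * g y) * (iexp (- t * x) * h x) = (LBINT s. iexp (t * (x + s)) * g (x + s) * (iexp (- t * x) * h x))"
      by simp
    also have "\<dots> = (LBINT s. iexp (t * s) * (h x * g (x + s)))"
    proof (rule Bochner_Integration.integral_cong)
      fix s
      have "iexp (t * (x + s)) * iexp (- t * x) = iexp (t * s)"
        unfolding iexp_add[symmetric] by (simp add: algebra_simps)
      thus "iexp (t * (x + s)) * g (x + s) * (iexp (- t * x) * h x) = iexp (t * s) * (h x * g (x + s))"
        by (metis (no_types, opaque_lifting) mult.assoc mult.commute)
    qed simp
    finally show "(LBINT y. iexp (t * y) * g y) * (iexp (- t * x) * h x) = (LBINT s. iexp (t * s) * (h x * g (x + s)))" .
  qed simp
  also have "\<dots> = (LBINT s. (LBINT x. iexp (t * s) * (h x * g (x + s))))"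
    using lborel_pair.Fubini_integral[OF P] by simp
  finally show ?eq by simp
qed

lemma cross_correlation_bound:
  fixes g h :: "real \<Rightarrow> complex"
  assumes [measurable]: "g \<in> borel_measurable lborel" "h \<in> borel_measurable lborel"
    and g2: "integrable lborel (\<lambda>x. (cmod (g x))\<^sup>2)" and h2: "integrable lborel (\<lambda>x. (cmod (h x))\<^sup>2)"
  shows "cmod (LBINT x. h x * g (x + s)) \<le> (LBINT x. (cmod (h x))\<^sup>2) + (LBINT x. (cmod (g x))\<^sup>2)"
proof -
  note g2s = integrable_translation[OF g2, of s]
  have le: "cmod (h x * g (x + s)) \<le> (cmod (h x))\<^sup>2 + (cmod (g (x + s)))\<^sup>2" for x
    using sum_squares_bound[of "cmod (h x)" "cmod (g (x + s))"] zero_le_power2[of "cmod (h x)"] zero_le_power2[of "cmod (g (x + s))"]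
    unfolding norm_mult by linarith
  have "integrable lborel (\<lambda>x. h x * g (x + s))"
    by (rule Bochner_Integration.integrable_bound[OF Bochner_Integration.integrable_add[OF h2 g2s]]) (use le in \<open>auto intro!: AE_I2\<close>)
  hence "cmod (LBINT x. h x * g (x + s)) \<le> (LBINT x. (cmod (h x))\<^sup>2 + (cmod (g (x + s)))\<^sup>2)"
    using h2 g2s le by (intro order_trans[OF integral_norm_bound] integral_mono) auto
  also have "\<dots> = (LBINT x. (cmod (h x))\<^sup>2) + (LBINT x. (cmod (g x))\<^sup>2)"
    using h2 g2s integral_translation[of "\<lambda>x. (cmod (g x))\<^sup>2" s] by simp
  finally show ?thesis .
qed

lemma Young_square:
  fixes a b K :: real assumes "K > 0"
  shows "a * b \<le> K * a\<^sup>2 + b\<^sup>2 / K"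
proof -
  have "0 \<le> (K * a - b)\<^sup>2 / K + K * a\<^sup>2 + b\<^sup>2 / K" using assms by simp
  also have "\<dots> = 2 * (K * a\<^sup>2 + b\<^sup>2 / K - a * b)" using assms by (simp add: field_simps power2_eq_square)
  finally show ?thesis by simp
qed

text \<open>Where \<open>h\<close> is bounded by \<open>m\<close> the increment is at most
  \<open>m\<close> times the L1 translation error of \<open>g\<close>. The tail of \<open>h\<close>
  beyond \<open>m\<close> is small in L2 and is paired with \<open>g\<close> by the weighted
  inequality \<open>Young_square\<close>.\<close>

lemma cross_correlation_continuous:
  fixes g h :: "real \<Rightarrow> complex" and s :: "nat \<Rightarrow> real"
  assumes g: "integrable lborel g" "integrable lborel (\<lambda>x. (cmod (g x))\<^sup>2)"
    and h: "integrable lborel h" "integrable lborel (\<lambda>x. (cmod (h x))\<^sup>2)" and s: "s \<longlonglongrightarrow> 0"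
  shows "(\<lambda>n. LBINT x. h x * g (x + s n)) \<longlonglongrightarrow> (LBINT x. h x * g x)"
proof (rule LIMSEQ_I)
  fix e :: real assume e: "e > 0"
  note [measurable] = borel_measurable_integrable[OF g(1)] borel_measurable_integrable[OF h(1)]
  define M where "M = (LBINT x. (cmod (g x))\<^sup>2)"
  have M: "M \<ge> 0" unfolding M_def by (intro Bochner_Integration.integral_nonneg) simp
  \<comment> \<open>Chosen so that the term \<open>4 * M / K\<close> stays below
    \<open>e / 3\<close>; the summand 1 keeps \<open>K\<close> positive if
    \<open>M = 0\<close>.\<close>
  define K where "K = 12 * (M + 1) / e"
  have K: "K > 0" using e M by (auto simp: K_def intro!: divide_pos_pos)
  define tl where "tl m x = (if cmod (h x) \<le> real m then 0 else h x)" for m x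
  have [measurable]: "tl m \<in> borel_measurable lborel" for m unfolding tl_def by measurable
  have tlh: "cmod (tl m x) \<le> cmod (h x)" for m x by (simp add: tl_def)
  have "(\<lambda>m. LBINT x. (cmod (tl m x))\<^sup>2) \<longlonglongrightarrow> (\<integral>x. 0 \<partial>(lborel :: real measure))"
  proof (rule integral_dominated_convergence[where w = "\<lambda>x. (cmod (h x))\<^sup>2"])
    show "AE x in lborel. (\<lambda>m. (cmod (tl m x))\<^sup>2) \<longlonglongrightarrow> 0"
    proof (intro AE_I2 tendsto_eventually)
      fix x
      obtain m0 where "cmod (h x) \<le> real m0" using real_arch_simple by blast
      thus "eventually (\<lambda>m. (cmod (tl m x))\<^sup>2 = 0) sequentially"
        unfolding eventually_sequentially by (intro exI[of _ m0]) (auto simp: tl_def)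
    qed
    show "AE x in lborel. norm ((cmod (tl m x))\<^sup>2) \<le> (cmod (h x))\<^sup>2" for m
      using tlh by (auto intro!: AE_I2 power_mono)
  qed (use h in auto)
  hence "eventually (\<lambda>m. (LBINT x. (cmod (tl m x))\<^sup>2) < e / (3 * K)) sequentially"
    using e K by (intro order_tendstoD(2)) auto
  then obtain m where m: "(LBINT x. (cmod (tl m x))\<^sup>2) < e / (3 * K)"
    unfolding eventually_sequentially by blast
  have itl: "integrable lborel (\<lambda>x. (cmod (tl m x))\<^sup>2)"
    using tlh by (intro Bochner_Integration.integrable_bound[OF h(2)]) (auto intro!: AE_I2 power_mono)
  have "(\<lambda>n. real m * (LBINT x. norm (g (x + s n) - g x))) \<longlonglongrightarrow> real m * 0"
    by (intro tendsto_mult tendsto_const L1_translation_continuous g s)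
  hence "eventually (\<lambda>n. real m * (LBINT x. norm (g (x + s n) - g x)) < e / 3) sequentially"
    using e by (intro order_tendstoD(2)) auto
  then obtain N where N: "\<And>n. n \<ge> N \<Longrightarrow> real m * (LBINT x. norm (g (x + s n) - g x)) < e / 3"
    unfolding eventually_sequentially by blast
  show "\<exists>no. \<forall>n\<ge>no. norm ((LBINT x. h x * g (x + s n)) - (LBINT x. h x * g x)) < e"
  proof (intro exI allI impI)
    fix n assume n: "n \<ge> N"
    note g1 = integrable_translation[OF g(1), of "s n"] and g2 = integrable_translation[OF g(2), of "s n"]
    have hg: "integrable lborel (\<lambda>x. h x * g (x + r))" for r
      by (rule Bochner_Integration.integrable_bound[OF Bochner_Integration.integrable_add[OF h(2) integrable_translation[OF g(2), of r]]])
        (use Young_square[of 1 "cmod (h _)" "cmod (g _)"] in \<open>auto intro!: AE_I2 simp: norm_mult\<close>)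
    have pt: "cmod (h x * g (x + s n) - h x * g x) \<le>
        real m * norm (g (x + s n) - g x) + (K * (cmod (tl m x))\<^sup>2 + (2 * (cmod (g (x + s n)))\<^sup>2 + 2 * (cmod (g x))\<^sup>2) / K)" for x
    proof -
      have "cmod (g (x + s n) - g x) ^ 2 \<le> (cmod (g (x + s n)) + cmod (g x))\<^sup>2"
        by (intro power_mono norm_triangle_ineq4) simp
      also have "\<dots> \<le> 2 * (cmod (g (x + s n)))\<^sup>2 + 2 * (cmod (g x))\<^sup>2"
        using sum_squares_bound[of "cmod (g (x + s n))" "cmod (g x)"] by (simp add: power2_sum)
      finally have sq: "cmod (g (x + s n) - g x) ^ 2 \<le> 2 * (cmod (g (x + s n)))\<^sup>2 + 2 * (cmod (g x))\<^sup>2" .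
      show ?thesis
      proof (cases "cmod (h x) \<le> real m")
        case True
        have "cmod (h x * g (x + s n) - h x * g x) = cmod (h x) * cmod (g (x + s n) - g x)"
          by (simp add: right_diff_distrib[symmetric] norm_mult)
        also have "\<dots> \<le> real m * cmod (g (x + s n) - g x)" using True by (intro mult_right_mono) auto
        also have "\<dots> \<le> real m * cmod (g (x + s n) - g x) + (K * (cmod (tl m x))\<^sup>2 + (2 * (cmod (g (x + s n)))\<^sup>2 + 2 * (cmod (g x))\<^sup>2) / K)"
          using K by simp
        finally show ?thesis .
      next
        case False
        have "cmod (h x * g (x + s n) - h x * g x) = cmod (tl m x) * cmod (g (x + s n) - g x)"
          using False by (simp add: right_diff_distrib[symmetric] norm_mult tl_def)
        also have "\<dots> \<le> K * (cmod (tl m x))\<^sup>2 + (cmod (g (x + s n) - g x))\<^sup>2 / K" by (rule Young_square[OF K])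
        also have "\<dots> \<le> K * (cmod (tl m x))\<^sup>2 + (2 * (cmod (g (x + s n)))\<^sup>2 + 2 * (cmod (g x))\<^sup>2) / K"
          using sq K by (intro add_left_mono divide_right_mono) auto
        also have "\<dots> \<le> real m * cmod (g (x + s n) - g x) + (K * (cmod (tl m x))\<^sup>2 + (2 * (cmod (g (x + s n)))\<^sup>2 + 2 * (cmod (g x))\<^sup>2) / K)"
          by simp
        finally show ?thesis .
      qed
    qed
    have "(LBINT x. h x * g (x + s n)) - (LBINT x. h x * g x) = (LBINT x. h x * g (x + s n) - h x * g x)"
      using hg[of "s n"] hg[of 0] by simp
    also have "cmod \<dots> \<le> (LBINT x. cmod (h x * g (x + s n) - h x * g x))" by (rule integral_norm_bound)
    also have "\<dots> \<le> (LBINT x. real m * norm (g (x + s n) - g x) + (K * (cmod (tl m x))\<^sup>2 + (2 * (cmod (g (x + s n)))\<^sup>2 + 2 * (cmod (g x))\<^sup>2) / K))"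
      using hg[of "s n"] hg[of 0] g g1 g2 itl by (intro integral_mono pt) auto
    also have "\<dots> = real m * (LBINT x. norm (g (x + s n) - g x)) + (K * (LBINT x. (cmod (tl m x))\<^sup>2) + (2 * M + 2 * M) / K)"
      using g g1 g2 itl integral_translation[of "\<lambda>x. (cmod (g x))\<^sup>2" "s n"] by (simp add: M_def)
    also have "\<dots> < e / 3 + (e / 3 + e / 3)"
    proof (intro add_strict_mono)
      show "real m * (LBINT x. norm (g (x + s n) - g x)) < e / 3" by (rule N[OF n])
      show "K * (LBINT x. (cmod (tl m x))\<^sup>2) < e / 3" using m K by (simp add: field_simps)
      show "(2 * M + 2 * M) / K < e / 3" using M e by (simp add: K_def field_simps)
    qed
    finally show "norm ((LBINT x. h x * g (x + s n)) - (LBINT x. h x * g x)) < e" by simp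
  qed
qed

section \<open>Gaussian regularization and Plancherel's identity\<close>

text \<open>Not normalized, so that \<open>gauss 0 = 1\<close> and the cutoff
  \<open>gauss (d * t)\<close> tends to 1 as \<open>d\<close> tends to 0.\<close>

definition gauss :: "real \<Rightarrow> real" where
  "gauss x = exp (- x\<^sup>2 / 2)"

lemma gauss_std_normal_density: "gauss x = sqrt (2 * pi) * std_normal_density x"
  by (simp add: gauss_def std_normal_density_def)

lemma gauss_bounds: "0 \<le> gauss x" "gauss x \<le> 1" "gauss 0 = 1" "gauss x > 0"
  by (simp_all add: gauss_def)

lemma gauss_measurable [measurable]: "gauss \<in> borel_measurable borel"
  unfolding gauss_def[abs_def] by measurable

lemma integrable_gauss: "integrable lborel gauss"
  using integrable_mult_right[OF integrable_std_normal_moment[of 0], of "sqrt (2 * pi)"]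
  by (simp add: gauss_std_normal_density[abs_def])

lemma integral_gauss: "(LBINT x. gauss x) = sqrt (2 * pi)"
  using integral_std_normal_moment_even[of 0] by (simp add: gauss_std_normal_density)

lemma has_derivative_gauss: "(gauss has_vector_derivative - x * gauss x) (at x)"
  unfolding gauss_def[abs_def] has_real_derivative_iff_has_vector_derivative[symmetric]
  by (auto intro!: derivative_eq_intros)

lemma integrable_scaled:
  fixes f :: "real \<Rightarrow> 'a::{banach, second_countable_topology}"
  shows "integrable lborel f \<Longrightarrow> c \<noteq> 0 \<Longrightarrow> integrable lborel (\<lambda>x. f (c * x))"
  using lborel_integrable_real_affine[of f c 0] by simp

text \<open>The characteristic function of the standard normal distribution, rescaled.\<close>

lemma Fourier_gauss:
  assumes d: "d > 0"
  shows "(LBINT t. complex_of_real (gauss (d * t)) * iexp (t * s)) = complex_of_real (sqrt (2 * pi) / d * gauss (s / d))"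
proof -
  have "(LBINT x. gauss x *\<^sub>R iexp ((s / d) * x)) = sqrt (2 * pi) *\<^sub>R (LBINT x. std_normal_density x *\<^sub>R iexp ((s / d) * x))"
    by (simp add: gauss_std_normal_density scaleR_scaleR[symmetric] del: scaleR_scaleR of_real_mult of_real_divide)
  also have "(LBINT x. std_normal_density x *\<^sub>R iexp ((s / d) * x)) = char std_normal_distribution (s / d)"
    unfolding char_def by (subst integral_density) (auto simp: normal_density_nonneg)
  also have "\<dots> = complex_of_real (gauss (s / d))" by (simp only: char_std_normal_distribution gauss_def)
  finally have 1: "(LBINT x. gauss x *\<^sub>R iexp ((s / d) * x)) = complex_of_real (sqrt (2 * pi) * gauss (s / d))"
    by (simp add: scaleR_conv_of_real)
  have "(LBINT x. gauss x *\<^sub>R iexp ((s / d) * x)) = d *\<^sub>R (LBINT t. gauss (d * t) *\<^sub>R iexp ((s / d) * (d * t)))"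
    using lborel_integral_real_affine[of d "\<lambda>x. gauss x *\<^sub>R iexp ((s / d) * x)" 0] d by (simp del: of_real_mult of_real_divide)
  also have "(\<lambda>t. gauss (d * t) *\<^sub>R iexp ((s / d) * (d * t))) = (\<lambda>t. complex_of_real (gauss (d * t)) * iexp (t * s))"
    using d by (auto simp: scaleR_conv_of_real field_simps)
  finally have "d *\<^sub>R (LBINT t. complex_of_real (gauss (d * t)) * iexp (t * s)) = complex_of_real (sqrt (2 * pi) * gauss (s / d))"
    using 1 by simp
  thus ?thesis using d by (simp add: scaleR_conv_of_real field_simps)
qed

text \<open>By Fubini the cutoff integral of the transform is a Gaussian average of \<open>c\<close>
  over a window of width \<open>d n\<close> around 0, so continuity at that point decides the limit.
  One factor \<open>sqrt (2 * pi)\<close> comes from the transform of the Gaussian, the other from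
  its integral.\<close>

lemma gauss_Fourier_inversion:
  fixes c :: "real \<Rightarrow> complex" and d :: "nat \<Rightarrow> real"
  assumes c: "integrable lborel c" and b: "\<And>s. cmod (c s) \<le> B"
    and cont: "\<And>s. s \<longlonglongrightarrow> 0 \<Longrightarrow> (\<lambda>n. c (s n)) \<longlonglongrightarrow> c 0"
    and d: "\<And>n. d n > 0" "d \<longlonglongrightarrow> 0"
  shows "(\<lambda>n. LBINT t. complex_of_real (gauss (d n * t)) * (LBINT s. iexp (t * s) * c s)) \<longlonglongrightarrow> 2 * pi * c 0"
proof -
  note [measurable] = borel_measurable_integrable[OF c]
  have eq: "(LBINT t. complex_of_real (gauss (\<delta> * t)) * (LBINT s. iexp (t * s) * c s))
     = sqrt (2 * pi) * (LBINT z. gauss z * c (\<delta> * z))" if \<delta>: "\<delta> > 0" for \<delta>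
  proof -
    have ig: "integrable lborel (\<lambda>t. gauss (\<delta> * t))" using integrable_scaled[OF integrable_gauss, of \<delta>] \<delta> by simp
    have P: "integrable (lborel \<Otimes>\<^sub>M lborel) (\<lambda>(t, s). complex_of_real (gauss (\<delta> * t)) * (iexp (t * s) * c s))"
    proof (rule lborel_pair.Fubini_integrable)
      have "(LBINT s. norm (case (t, s) of (t, s) \<Rightarrow> complex_of_real (gauss (\<delta> * t)) * (iexp (t * s) * c s))) = gauss (\<delta> * t) * (LBINT s. norm (c s))" for t
        by (simp add: norm_mult gauss_bounds)
      thus "integrable lborel (\<lambda>t. LBINT s. norm (case (t, s) of (t, s) \<Rightarrow> complex_of_real (gauss (\<delta> * t)) * (iexp (t * s) * c s)))"
        using ig by simp
      show "AE t in lborel. integrable lborel (\<lambda>s. case (t, s) of (t, s) \<Rightarrow> complex_of_real (gauss (\<delta> * t)) * (iexp (t * s) * c s))"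
      proof (intro AE_I2)
        fix t
        from integrable_mult_right[OF integrable_iexp_mult[OF c, of t], of "complex_of_real (gauss (\<delta> * t))"]
        show "integrable lborel (\<lambda>s. case (t, s) of (t, s) \<Rightarrow> complex_of_real (gauss (\<delta> * t)) * (iexp (t * s) * c s))" by simp
      qed
    qed (simp add: split_beta')
    have "(LBINT t. complex_of_real (gauss (\<delta> * t)) * (LBINT s. iexp (t * s) * c s))
      = (LBINT t. (LBINT s. complex_of_real (gauss (\<delta> * t)) * (iexp (t * s) * c s)))" by simp
    also have "\<dots> = (LBINT s. (LBINT t. complex_of_real (gauss (\<delta> * t)) * (iexp (t * s) * c s)))"
      using lborel_pair.Fubini_integral[OF P] by simp
    also have "\<dots> = (LBINT s. (LBINT t. complex_of_real (gauss (\<delta> * t)) * iexp (t * s)) * c s)"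
      by (simp add: mult.assoc[symmetric])
    also have "\<dots> = (LBINT s. complex_of_real (sqrt (2 * pi) / \<delta> * gauss (s / \<delta>)) * c s)"
      by (simp only: Fourier_gauss[OF \<delta>])
    also have "\<dots> = \<delta> *\<^sub>R (LBINT z. complex_of_real (sqrt (2 * pi) / \<delta> * gauss ((\<delta> * z) / \<delta>)) * c (\<delta> * z))"
      using lborel_integral_real_affine[of \<delta> "\<lambda>s. complex_of_real (sqrt (2 * pi) / \<delta> * gauss (s / \<delta>)) * c s" 0] \<delta> by simp
    also have "\<dots> = sqrt (2 * pi) * (LBINT z. gauss z * c (\<delta> * z))"
      using \<delta> by (simp add: scaleR_conv_of_real mult.assoc)
    finally show ?thesis .
  qed
  have "(\<lambda>n. LBINT z. gauss z * c (d n * z)) \<longlonglongrightarrow> (LBINT z. gauss z * c 0)"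
  proof (rule integral_dominated_convergence[where w = "\<lambda>z. gauss z * B"])
    show "AE z in lborel. (\<lambda>n. gauss z * c (d n * z)) \<longlonglongrightarrow> gauss z * c 0"
      using d(2) by (intro AE_I2 tendsto_mult tendsto_const cont tendsto_mult_left_zero)
    show "AE z in lborel. norm (gauss z * c (d n * z)) \<le> gauss z * B" for n
      using b by (intro AE_I2) (auto simp: norm_mult gauss_bounds intro!: mult_left_mono)
  qed (use integrable_gauss in auto)
  hence "(\<lambda>n. sqrt (2 * pi) * (LBINT z. gauss z * c (d n * z))) \<longlonglongrightarrow> sqrt (2 * pi) * (sqrt (2 * pi) * c 0)"
    using integrable_gauss by (intro tendsto_mult tendsto_const) (simp add: integral_gauss)
  also have "sqrt (2 * pi) * (sqrt (2 * pi) * c 0) = 2 * pi * c 0"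
    unfolding mult.assoc[symmetric] of_real_mult[symmetric] by simp
  finally show ?thesis by (simp only: eq[OF d(1)])
qed

lemma gauss_moments:
  shows "integrable lborel (\<lambda>z. z * gauss z)" "integrable lborel (\<lambda>z. \<bar>z\<bar> * gauss z)"
    "(LBINT z. z * gauss z) = 0" "(LBINT z. \<bar>z\<bar> * gauss z) = 2"
proof -
  have eq: "z * gauss z = sqrt (2 * pi) * (std_normal_density z * z ^ 1)"
    "\<bar>z\<bar> * gauss z = sqrt (2 * pi) * (std_normal_density z * \<bar>z\<bar> ^ 1)" for z
    by (simp_all add: gauss_std_normal_density)
  show "integrable lborel (\<lambda>z. z * gauss z)" "integrable lborel (\<lambda>z. \<bar>z\<bar> * gauss z)"
    unfolding eq by (intro integrable_mult_right integrable_std_normal_moment integrable_std_normal_moment_abs)+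
  show "(LBINT z. z * gauss z) = 0"
    unfolding eq using integral_std_normal_moment_odd[of 0] by simp
  have "(LBINT z. \<bar>z\<bar> * gauss z) = sqrt (2 * pi) * sqrt (2 / pi)"
    unfolding eq using integral_std_normal_moment_abs_odd[of 0] by simp
  also have "\<dots> = 2" by (simp add: real_sqrt_mult[symmetric])
  finally show "(LBINT z. \<bar>z\<bar> * gauss z) = 2" .
qed

text \<open>Integration by parts moves the derivative onto the cutoff. After rescaling, the weight
  \<open>z * gauss z\<close> is integrated against \<open>\<Phi> (z / d n)\<close>, which tends to
  \<open>Lp\<close> or \<open>Lm\<close> according to the sign of \<open>z\<close>.\<close>

lemma gauss_increment:
  fixes \<Phi> \<Phi>' :: "real \<Rightarrow> complex" and d :: "nat \<Rightarrow> real"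
  assumes deriv: "\<And>t. (\<Phi> has_vector_derivative \<Phi>' t) (at t)" and cont: "continuous_on UNIV \<Phi>'"
    and b: "\<And>t. cmod (\<Phi> t) \<le> B" and b': "\<And>t. cmod (\<Phi>' t) \<le> B'"
    and lim: "(\<Phi> \<longlongrightarrow> Lp) at_top" "(\<Phi> \<longlongrightarrow> Lm) at_bot"
    and d: "\<And>n. d n > 0" "d \<longlonglongrightarrow> 0"
  shows "(\<lambda>n. LBINT t. complex_of_real (gauss (d n * t)) * \<Phi>' t) \<longlonglongrightarrow> Lp - Lm"
proof -
  have "isCont \<Phi> t" for t using deriv has_vector_derivative_continuous by blast
  hence cont\<Phi>: "continuous_on UNIV \<Phi>" by (simp add: continuous_on_eq_continuous_at)
  have [measurable]: "\<Phi> \<in> borel_measurable borel" "\<Phi>' \<in> borel_measurable borel"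
    using cont cont\<Phi> by (auto intro: borel_measurable_continuous_onI)
  have eq: "(LBINT t. complex_of_real (gauss (\<delta> * t)) * \<Phi>' t) = (LBINT z. complex_of_real (z * gauss z) * \<Phi> (z / \<delta>))"
    if \<delta>: "\<delta> > 0" for \<delta>
  proof -
    define G where "G t = gauss (\<delta> * t) *\<^sub>R \<Phi> t" for t
    define G' where "G' t = gauss (\<delta> * t) *\<^sub>R \<Phi>' t + (\<delta> * (- (\<delta> * t) * gauss (\<delta> * t))) *\<^sub>R \<Phi> t" for t
    have "((\<lambda>t. gauss (\<delta> * t)) has_vector_derivative \<delta> * (- (\<delta> * t) * gauss (\<delta> * t))) (at t)" for t
    proof -
      have "((\<lambda>t. \<delta> * t) has_vector_derivative \<delta>) (at t)" by (auto intro!: derivative_eq_intros)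
      from vector_diff_chain_at[OF this has_derivative_gauss[of "\<delta> * t"]] show ?thesis by (simp add: o_def)
    qed
    hence DG: "(G has_vector_derivative G' t) (at t)" for t
      unfolding G_def[abs_def] G'_def by (intro has_vector_derivative_scaleR deriv) (simp add: has_real_derivative_iff_has_vector_derivative)
    have i1: "integrable lborel (\<lambda>t. gauss (\<delta> * t) *\<^sub>R \<Phi>' t)"
    proof (rule Bochner_Integration.integrable_bound)
      show "integrable lborel (\<lambda>t. gauss (\<delta> * t) * B')"
        using integrable_scaled[OF integrable_gauss, of \<delta>] \<delta> by simp
      have "0 \<le> B'" using b'[of 0] norm_ge_zero order_trans by blast
      thus "AE t in lborel. norm (gauss (\<delta> * t) *\<^sub>R \<Phi>' t) \<le> norm (gauss (\<delta> * t) * B')"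
        using b' by (intro AE_I2) (auto simp: abs_mult gauss_bounds intro!: mult_left_mono)
    qed simp
    have i2: "integrable lborel (\<lambda>t. (\<delta> * (- (\<delta> * t) * gauss (\<delta> * t))) *\<^sub>R \<Phi> t)"
    proof (rule Bochner_Integration.integrable_bound)
      show "integrable lborel (\<lambda>t. (B * \<delta>) * (\<bar>\<delta> * t\<bar> * gauss (\<delta> * t)))"
        using integrable_scaled[OF gauss_moments(2), of \<delta>] \<delta> by (intro integrable_mult_right) auto
      have "0 \<le> B" using b[of 0] norm_ge_zero order_trans by blast
      show "AE t in lborel. norm ((\<delta> * (- (\<delta> * t) * gauss (\<delta> * t))) *\<^sub>R \<Phi> t) \<le> norm ((B * \<delta>) * (\<bar>\<delta> * t\<bar> * gauss (\<delta> * t)))"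
      proof (intro AE_I2)
        fix t
        have "norm ((\<delta> * (- (\<delta> * t) * gauss (\<delta> * t))) *\<^sub>R \<Phi> t) = (\<delta> * (\<bar>\<delta> * t\<bar> * gauss (\<delta> * t))) * cmod (\<Phi> t)"
          using \<delta> by (simp add: abs_mult gauss_bounds)
        also have "\<dots> \<le> (\<delta> * (\<bar>\<delta> * t\<bar> * gauss (\<delta> * t))) * B"
          using \<delta> b by (intro mult_left_mono) (auto simp: gauss_bounds)
        also have "\<dots> = norm ((B * \<delta>) * (\<bar>\<delta> * t\<bar> * gauss (\<delta> * t)))"
          using \<delta> \<open>0 \<le> B\<close> by (simp add: abs_mult gauss_bounds)
        finally show "norm ((\<delta> * (- (\<delta> * t) * gauss (\<delta> * t))) *\<^sub>R \<Phi> t) \<le> norm ((B * \<delta>) * (\<bar>\<delta> * t\<bar> * gauss (\<delta> * t)))" .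
      qed
    qed simp
    have iG: "integrable lborel G'" unfolding G'_def[abs_def] by (intro Bochner_Integration.integrable_add i1 i2)
    have contG': "isCont G' t" for t
    proof -
      have "continuous_on UNIV G'" unfolding G'_def[abs_def] gauss_def
        by (intro continuous_intros cont cont\<Phi>) auto
      thus ?thesis by (simp add: continuous_on_eq_continuous_at)
    qed
    have glim: "(gauss \<longlongrightarrow> 0) at_infinity"
    proof (rule Lim_null_comparison)
      show "\<forall>\<^sub>F x in at_infinity. norm (gauss x) \<le> 2 * (inverse x)\<^sup>2"
        unfolding eventually_at_infinity
      proof (intro exI[of _ 1] allI impI)
        fix x :: real assume "1 \<le> norm x"
        hence x: "x \<noteq> 0" by auto
        have "x\<^sup>2 / 2 \<le> exp (x\<^sup>2 / 2)" using exp_ge_add_one_self[of "x\<^sup>2 / 2"] by linarith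
        hence "gauss x \<le> inverse (x\<^sup>2 / 2)" unfolding gauss_def minus_divide_left[symmetric] exp_minus
          using x by (intro le_imp_inverse_le) auto
        thus "norm (gauss x) \<le> 2 * (inverse x)\<^sup>2" by (simp add: gauss_bounds field_simps)
      qed
      have "((\<lambda>x. 2 * (inverse x)\<^sup>2) \<longlongrightarrow> 2 * 0\<^sup>2) (at_infinity :: real filter)" by (intro tendsto_intros tendsto_inverse_0)
      thus "((\<lambda>x. 2 * (inverse x)\<^sup>2) \<longlongrightarrow> 0) (at_infinity :: real filter)" by simp
    qed
    have "filterlim (\<lambda>t. \<delta> * t) at_top at_top" "filterlim (\<lambda>t. \<delta> * t) at_bot at_bot"
      using \<delta> by (auto intro: filterlim_tendsto_pos_mult_at_top filterlim_tendsto_pos_mult_at_bot filterlim_ident tendsto_const)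
    hence "((\<lambda>t. gauss (\<delta> * t)) \<longlongrightarrow> 0) at_top" "((\<lambda>t. gauss (\<delta> * t)) \<longlongrightarrow> 0) at_bot"
      using glim by (auto intro: filterlim_compose[of gauss] filterlim_at_top_imp_at_infinity filterlim_at_bot_imp_at_infinity)
    from tendsto_scaleR[OF this(1) lim(1)] tendsto_scaleR[OF this(2) lim(2)]
    have "(G \<longlongrightarrow> 0) at_top" "(G \<longlongrightarrow> 0) at_bot" unfolding G_def[abs_def] by simp_all
    hence "(LBINT x=-\<infinity>..\<infinity>. G' x) = 0 - 0"
      by (intro interval_integral_FTC_integrable[where F = G])
        (use iG DG contG' in \<open>simp_all add: ereal_tendsto_simps set_integrable_def\<close>)
    hence "(LBINT t. G' t) = 0" by (simp add: interval_lebesgue_integral_def set_lebesgue_integral_def)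
    hence "(LBINT t. gauss (\<delta> * t) *\<^sub>R \<Phi>' t) = - (LBINT t. (\<delta> * (- (\<delta> * t) * gauss (\<delta> * t))) *\<^sub>R \<Phi> t)"
      unfolding G'_def Bochner_Integration.integral_add[OF i1 i2] by (simp add: add_eq_0_iff2)
    also have "\<dots> = \<delta> *\<^sub>R (LBINT t. ((\<delta> * t) * gauss (\<delta> * t)) *\<^sub>R \<Phi> ((\<delta> * t) / \<delta>))"
      using \<delta> by (simp add: scaleR_scaleR[symmetric] mult.assoc del: scaleR_scaleR)
    also have "\<dots> = (LBINT z. (z * gauss z) *\<^sub>R \<Phi> (z / \<delta>))"
      using lborel_integral_real_affine[of \<delta> "\<lambda>z. (z * gauss z) *\<^sub>R \<Phi> (z / \<delta>)" 0] \<delta> by simp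
    finally show ?thesis by (simp add: scaleR_conv_of_real)
  qed
  \<comment> \<open>The value at 0 is arbitrary because the weight \<open>z * gauss z\<close>
    vanishes there.\<close>
  define J where "J z = (if z > 0 then Lp else Lm)" for z :: real
  have "(\<lambda>n. LBINT z. complex_of_real (z * gauss z) * \<Phi> (z / d n)) \<longlonglongrightarrow> (LBINT z. complex_of_real (z * gauss z) * J z)"
  proof (rule integral_dominated_convergence[where w = "\<lambda>z. \<bar>z\<bar> * gauss z * B"])
    show "AE z in lborel. norm (complex_of_real (z * gauss z) * \<Phi> (z / d n)) \<le> \<bar>z\<bar> * gauss z * B" for n
      using b by (intro AE_I2) (auto simp: norm_mult gauss_bounds intro!: mult_left_mono)
    show "AE z in lborel. (\<lambda>n. complex_of_real (z * gauss z) * \<Phi> (z / d n)) \<longlonglongrightarrow> complex_of_real (z * gauss z) * J z"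
    proof (intro AE_I2)
      fix z :: real
      have inv: "filterlim (\<lambda>n. inverse (d n)) at_top sequentially"
        using d by (intro filterlim_inverse_at_top) auto
      consider "z > 0" | "z = 0" | "z < 0" by linarith
      thus "(\<lambda>n. complex_of_real (z * gauss z) * \<Phi> (z / d n)) \<longlonglongrightarrow> complex_of_real (z * gauss z) * J z"
      proof cases
        case 1
        have "filterlim (\<lambda>n. z * inverse (d n)) at_top sequentially"
          by (intro filterlim_tendsto_pos_mult_at_top[OF tendsto_const 1 inv])
        from filterlim_compose[OF lim(1) this] show ?thesis
          using 1 by (intro tendsto_mult tendsto_const) (simp add: J_def divide_inverse)
      next
        case 3
        have "filterlim (\<lambda>n. z * inverse (d n)) at_bot sequentially"
          by (intro filterlim_tendsto_neg_mult_at_bot[OF tendsto_const 3 inv])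
        from filterlim_compose[OF lim(2) this] show ?thesis
          using 3 by (intro tendsto_mult tendsto_const) (simp add: J_def divide_inverse)
      qed simp
    qed
  qed (use gauss_moments(2) in \<open>auto simp: J_def\<close>)
  \<comment> \<open>\<open>J\<close> is split into its mean and a multiple of the sign of
    \<open>z\<close>: the odd moment removes the mean, and the absolute moment 2 cancels the factor
    1/2 of the difference.\<close>
  also have "(LBINT z. complex_of_real (z * gauss z) * J z)
     = (LBINT z. complex_of_real (z * gauss z) * ((Lp + Lm) / 2) + complex_of_real (\<bar>z\<bar> * gauss z) * ((Lp - Lm) / 2))"
    by (intro Bochner_Integration.integral_cong) (auto simp: J_def field_simps)
  also have "\<dots> = complex_of_real (LBINT z. z * gauss z) * ((Lp + Lm) / 2) + complex_of_real (LBINT z. \<bar>z\<bar> * gauss z) * ((Lp - Lm) / 2)"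
    using gauss_moments(1,2) by (subst Bochner_Integration.integral_add) (auto simp del: of_real_mult)
  also have "\<dots> = Lp - Lm" by (simp add: gauss_moments)
  finally show ?thesis by (simp only: eq[OF d(1)])
qed

text \<open>The integral of \<open>\<Phi>'\<close> over the line need not converge absolutely; its Gaussian regularizations do, and
  they are evaluated in two ways.\<close>

theorem Plancherel_increment:
  fixes g h :: "'l \<Rightarrow> real \<Rightarrow> complex" and \<Phi> \<Phi>' :: "real \<Rightarrow> complex"
  assumes g: "\<And>l. l \<in> I \<Longrightarrow> integrable lborel (g l)" "\<And>l. l \<in> I \<Longrightarrow> integrable lborel (\<lambda>x. (cmod (g l x))\<^sup>2)"
    and h: "\<And>l. l \<in> I \<Longrightarrow> integrable lborel (h l)" "\<And>l. l \<in> I \<Longrightarrow> integrable lborel (\<lambda>x. (cmod (h l x))\<^sup>2)"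
    and deriv: "\<And>t. (\<Phi> has_vector_derivative \<Phi>' t) (at t)" and cont: "continuous_on UNIV \<Phi>'"
    and \<Phi>': "\<And>t. \<Phi>' t = (\<Sum>l\<in>I. (LBINT x. iexp (t * x) * g l x) * (LBINT x. iexp (- t * x) * h l x))"
    and b: "\<And>t. cmod (\<Phi> t) \<le> B"
    and lim: "(\<Phi> \<longlongrightarrow> Lp) at_top" "(\<Phi> \<longlongrightarrow> Lm) at_bot"
  shows "Lp - Lm = 2 * pi * (\<Sum>l\<in>I. LBINT x. h l x * g l x)"
proof -
  define c where "c l s = (LBINT x. h l x * g l (x + s))" for l s
  define d where "d n = 1 / real (Suc n)" for n
  have d: "\<And>n. d n > 0" "d \<longlonglongrightarrow> 0"
    unfolding d_def using LIMSEQ_inverse_real_of_nat by (auto simp: inverse_eq_divide)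
  have fb: "cmod (LBINT x. iexp (t * x) * f x) \<le> (LBINT x. cmod (f x))" for t f
    by (rule order_trans[OF integral_norm_bound]) (simp add: norm_mult)
  have b': "cmod (\<Phi>' t) \<le> (\<Sum>l\<in>I. (LBINT x. cmod (g l x)) * (LBINT x. cmod (h l x)))" for t
    unfolding \<Phi>' by (intro order_trans[OF norm_sum] sum_mono)
      (simp only: norm_mult, intro mult_mono fb Bochner_Integration.integral_nonneg norm_ge_zero)
  have 1: "(\<lambda>n. LBINT t. complex_of_real (gauss (d n * t)) * \<Phi>' t) \<longlonglongrightarrow> Lp - Lm"
    by (rule gauss_increment[OF deriv cont b b' lim d])
  have FT: "\<Phi>' t = (\<Sum>l\<in>I. LBINT s. iexp (t * s) * c l s)" for t
    unfolding \<Phi>' c_def by (intro sum.cong refl Fourier_cross_correlation g h)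
  have ic: "integrable lborel (c l)" if "l \<in> I" for l
    unfolding c_def[abs_def] by (intro integrable_cross_correlation g h that)
  have m: "(\<lambda>t. LBINT s. iexp (t * s) * c l s) \<in> borel_measurable lborel" if "l \<in> I" for l
  proof -
    note [measurable] = borel_measurable_integrable[OF ic[OF that]]
    show ?thesis by measurable
  qed
  have int: "integrable lborel (\<lambda>t. complex_of_real (gauss (d n * t)) * (LBINT s. iexp (t * s) * c l s))" if "l \<in> I" for n l
  proof (rule Bochner_Integration.integrable_bound)
    show "integrable lborel (\<lambda>t. gauss (d n * t) * (LBINT s. cmod (c l s)))"
      using d(1)[of n] integrable_scaled[OF integrable_gauss, of "d n"] by simp
    show "AE t in lborel. norm (complex_of_real (gauss (d n * t)) * (LBINT s. iexp (t * s) * c l s)) \<le> norm (gauss (d n * t) * (LBINT s. cmod (c l s)))"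
      using fb[of _ "c l"] by (intro AE_I2) (auto simp: norm_mult gauss_bounds abs_mult intro!: mult_left_mono order_trans[OF _ abs_ge_self])
    show "(\<lambda>t. complex_of_real (gauss (d n * t)) * (LBINT s. iexp (t * s) * c l s)) \<in> borel_measurable lborel"
      using m[OF that] by simp
  qed
  have "(\<lambda>n. \<Sum>l\<in>I. LBINT t. complex_of_real (gauss (d n * t)) * (LBINT s. iexp (t * s) * c l s)) \<longlonglongrightarrow> (\<Sum>l\<in>I. 2 * pi * c l 0)"
  proof (intro tendsto_sum gauss_Fourier_inversion d ic)
    fix l assume l: "l \<in> I"
    show "cmod (c l s) \<le> (LBINT x. (cmod (h l x))\<^sup>2) + (LBINT x. (cmod (g l x))\<^sup>2)" for s
      unfolding c_def by (intro cross_correlation_bound borel_measurable_integrable g h l)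
    show "(\<lambda>n. c l (s n)) \<longlonglongrightarrow> c l 0" if "s \<longlonglongrightarrow> 0" for s
      unfolding c_def using cross_correlation_continuous[OF g[OF l] h[OF l] that] by simp
  qed
  also have "(\<lambda>n. \<Sum>l\<in>I. LBINT t. complex_of_real (gauss (d n * t)) * (LBINT s. iexp (t * s) * c l s))
     = (\<lambda>n. LBINT t. complex_of_real (gauss (d n * t)) * \<Phi>' t)"
    unfolding FT sum_distrib_left by (intro ext Bochner_Integration.integral_sum[symmetric] int)
  finally have "Lp - Lm = (\<Sum>l\<in>I. 2 * pi * c l 0)" by (rule LIMSEQ_unique[OF 1])
  thus ?thesis by (simp add: c_def sum_distrib_left)
qed

section \<open>Representations in L2, unitary groups and projections\<close>

section \<open>L2 representations by Borel functions\<close>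

lemma AE_lebesgue_on_iff:
  "W \<in> sets borel \<Longrightarrow> (AE E in lebesgue_on W. P E) \<longleftrightarrow> (AE E in lborel. E \<in> W \<longrightarrow> P E)"
  by (simp add: AE_restrict_space_iff AE_completion_iff)

text \<open>Integrals over \<open>lebesgue_on W\<close> are to become integrals over
  \<open>lborel\<close>, where translation, scaling and Fubini are available. Real and imaginary
  parts are replaced by Borel functions separately, and the result is extended by 0.\<close>

lemma ex_borel_version:
  fixes f :: "real \<Rightarrow> complex"
  assumes W [measurable]: "W \<in> sets borel" and f: "f \<in> borel_measurable (lebesgue_on W)"
  shows "\<exists>g. g \<in> borel_measurable borel \<and> (\<forall>E. E \<notin> W \<longrightarrow> g E = 0) \<and> (AE E in lebesgue_on W. f E = g E)"
proof -
  have *: "(\<lambda>E. indicator W E *\<^sub>R f E) \<in> borel_measurable lebesgue"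
    using f by (subst (asm) borel_measurable_restrict_space_iff) auto
  have re_im: "(\<lambda>E. Re (indicator W E *\<^sub>R f E)) \<in> borel_measurable lebesgue" "(\<lambda>E. Im (indicator W E *\<^sub>R f E)) \<in> borel_measurable lebesgue"
    by (rule measurable_compose[OF *], simp)+
  obtain r i where [measurable]: "r \<in> borel_measurable lborel" "i \<in> borel_measurable lborel"
    and ri: "AE E in lborel. Re (indicator W E *\<^sub>R f E) = r E" "AE E in lborel. Im (indicator W E *\<^sub>R f E) = i E"
    using re_im[THEN completion_ex_borel_measurable_real] by blast
  define g where "g E = indicator W E *\<^sub>R Complex (r E) (i E)" for E
  have "g \<in> borel_measurable borel" unfolding g_def[abs_def] Complex_eq by measurable
  moreover have "AE E in lborel. E \<in> W \<longrightarrow> f E = g E"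
    using ri by eventually_elim (auto simp: g_def complex_eq_iff)
  ultimately show ?thesis
    by (intro exI[of _ g]) (auto simp: AE_lebesgue_on_iff g_def)
qed

definition borel_version :: "real set \<Rightarrow> (real \<Rightarrow> complex) \<Rightarrow> real \<Rightarrow> complex" where
  "borel_version W f = (SOME g. g \<in> borel_measurable borel \<and> (\<forall>E. E \<notin> W \<longrightarrow> g E = 0) \<and> (AE E in lebesgue_on W. f E = g E))"

lemma borel_version:
  assumes "W \<in> sets borel" "f \<in> borel_measurable (lebesgue_on W)"
  shows "borel_version W f \<in> borel_measurable borel" "E \<notin> W \<Longrightarrow> borel_version W f E = 0"
    "AE E in lebesgue_on W. f E = borel_version W f E"
  using someI_ex[OF ex_borel_version[OF assms], folded borel_version_def] by blast+

lemma borel_measurable_lebesgue_on: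
  "g \<in> borel_measurable borel \<Longrightarrow> (g :: real \<Rightarrow> complex) \<in> borel_measurable (lebesgue_on W)"
  by (intro measurable_restrict_space1 measurable_completion) simp

lemma integral_lebesgue_on_eq:
  fixes f g :: "real \<Rightarrow> 'a::{banach, second_countable_topology}"
  assumes W: "W \<in> sets borel" and f: "f \<in> borel_measurable (lebesgue_on W)" and g: "g \<in> borel_measurable borel" "\<And>E. E \<notin> W \<Longrightarrow> g E = 0"
    and eq: "AE E in lebesgue_on W. f E = g E"
  shows "integrable (lebesgue_on W) f \<longleftrightarrow> integrable lborel g" "integral\<^sup>L (lebesgue_on W) f = integral\<^sup>L lborel g"
proof -
  have g': "g \<in> borel_measurable (lebesgue_on W)"
    using g(1) by (intro measurable_restrict_space1 measurable_completion) simp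
  have ig: "(\<lambda>E. indicator W E *\<^sub>R g E) = g" using g(2) by (auto simp: indicator_def)
  have "integrable (lebesgue_on W) f \<longleftrightarrow> integrable (lebesgue_on W) g"
    by (rule integrable_cong_AE[OF f g' eq])
  also have "\<dots> \<longleftrightarrow> integrable lebesgue g" using W by (subst integrable_restrict_space) (auto simp: ig)
  also have "\<dots> \<longleftrightarrow> integrable lborel g" using g(1) by (intro integrable_completion) simp
  finally show "integrable (lebesgue_on W) f \<longleftrightarrow> integrable lborel g" .
  have "integral\<^sup>L (lebesgue_on W) f = integral\<^sup>L (lebesgue_on W) g"
    by (rule integral_cong_AE[OF f g' eq])
  also have "\<dots> = integral\<^sup>L lebesgue g" using W by (subst integral_restrict_space) (auto simp: ig)
  also have "\<dots> = integral\<^sup>L lborel g" using g(1) by (intro integral_completion) simp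
  finally show "integral\<^sup>L (lebesgue_on W) f = integral\<^sup>L lborel g" .
qed

lemma borel_measurable_cnj [measurable]: "cnj \<in> borel_measurable borel"
  by (intro borel_measurable_continuous_onI continuous_intros)

lemma cmod_add_square: "(cmod (x + y))\<^sup>2 = (cmod x)\<^sup>2 + 2 * Re (cnj x * y) + (cmod y)\<^sup>2"
  by (simp add: cmod_power2 power2_sum)

text \<open>A unitary map onto L2 of \<open>W\<close> in terms of Borel functions on the line that
  vanish off \<open>W\<close>. Linearity holds only almost everywhere because a version is chosen
  for each vector independently.\<close>

locale L2_rep =
  fixes K :: "'h::chilbert_space set" and W :: "real set" and F :: "'h \<Rightarrow> real \<Rightarrow> complex"
  assumes K: "csubspace K" and W [measurable]: "W \<in> sets borel"
    and meas: "u \<in> K \<Longrightarrow> F u \<in> borel_measurable borel"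
    and supp: "u \<in> K \<Longrightarrow> E \<notin> W \<Longrightarrow> F u E = 0"
    and sq: "u \<in> K \<Longrightarrow> integrable lborel (\<lambda>E. (cmod (F u E))\<^sup>2)"
    and add: "u \<in> K \<Longrightarrow> v \<in> K \<Longrightarrow> AE E in lborel. F (u + v) E = F u E + F v E"
    and scale: "u \<in> K \<Longrightarrow> AE E in lborel. F (c *\<^sub>C u) E = c * F u E"
    and norm_eq: "u \<in> K \<Longrightarrow> (norm u)\<^sup>2 = (LBINT E. (cmod (F u E))\<^sup>2)"
    and surj: "g \<in> borel_measurable borel \<Longrightarrow> (\<And>E. E \<notin> W \<Longrightarrow> g E = 0) \<Longrightarrow> integrable lborel (\<lambda>E. (cmod (g E))\<^sup>2) \<Longrightarrow>
        \<exists>u\<in>K. AE E in lborel. F u E = g E"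

lemma L2_rep_borel_version:
  assumes U: "L2_unitary K {j} W G" and K: "csubspace K" and W [measurable]: "W \<in> sets borel"
  shows "L2_rep K W (\<lambda>u. borel_version W (G j u))"
proof -
  let ?F = "\<lambda>u. borel_version W (G j u)"
  have sqi: "square_int_on W (G j u)" if "u \<in> K" for u using U that unfolding L2_unitary_def by blast
  hence Gm: "G j u \<in> borel_measurable (lebesgue_on W)" if "u \<in> K" for u using that unfolding square_int_on_def by blast
  note F = borel_version[OF W Gm]
  have sqm: "(\<lambda>E. (cmod (G j u E))\<^sup>2) \<in> borel_measurable (lebesgue_on W)" if "u \<in> K" for u
    using Gm[OF that] by measurable
  have sqF: "(\<lambda>E. (cmod (?F u E))\<^sup>2) \<in> borel_measurable borel" if "u \<in> K" for u
    using F(1)[OF that] by measurable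
  have sqAE: "AE E in lebesgue_on W. (cmod (G j u E))\<^sup>2 = (cmod (?F u E))\<^sup>2" if "u \<in> K" for u
    using F(3)[OF that] by eventually_elim simp
  note sqeq = integral_lebesgue_on_eq[OF W sqm sqF _ sqAE]
  \<comment> \<open>\<open>P 0 0 0\<close> covers the points off \<open>W\<close>, where all
    versions vanish.\<close>
  have transfer: "AE E in lborel. P (?F u E) (?F v E) (?F w E)"
    if "AE E in lebesgue_on W. P (G j u E) (G j v E) (G j w E)" "P 0 0 0" "u \<in> K" "v \<in> K" "w \<in> K" for P u v w
  proof -
    have "AE E in lebesgue_on W. P (?F u E) (?F v E) (?F w E)"
      using that(1) F(3)[OF that(3)] F(3)[OF that(4)] F(3)[OF that(5)] by eventually_elim simp
    hence "AE E in lborel. E \<in> W \<longrightarrow> P (?F u E) (?F v E) (?F w E)" by (simp add: AE_lebesgue_on_iff W)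
    thus ?thesis by eventually_elim (use F(2) that in fastforce)
  qed
  show ?thesis
  proof
    show "?F u \<in> borel_measurable borel" if "u \<in> K" for u by (rule F(1)[OF that])
    show "?F u E = 0" if "u \<in> K" "E \<notin> W" for u E by (rule F(2)[OF that])
    show "integrable lborel (\<lambda>E. (cmod (?F u E))\<^sup>2)" if "u \<in> K" for u
      using sqi[OF that] sqeq(1)[OF that that] F(2)[OF that] that unfolding square_int_on_def by simp
    show "AE E in lborel. ?F (u + v) E = ?F u E + ?F v E" if "u \<in> K" "v \<in> K" for u v
      using U K that unfolding L2_unitary_def csubspace_iff
      by (intro transfer[of "\<lambda>x y z. x = y + z" "u + v" u v]) auto
    show "AE E in lborel. ?F (c *\<^sub>C u) E = c * ?F u E" if "u \<in> K" for c u
      using U K that unfolding L2_unitary_def csubspace_iff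
      by (intro transfer[of "\<lambda>x y z. x = c * y" "c *\<^sub>C u" u u]) auto
    show "(norm u)\<^sup>2 = (LBINT E. (cmod (?F u E))\<^sup>2)" if "u \<in> K" for u
    proof -
      have "(norm u)\<^sup>2 = (\<integral>E. (cmod (G j u E))\<^sup>2 \<partial>lebesgue_on W)"
        using U that unfolding L2_unitary_def by auto
      thus ?thesis using sqeq(2)[OF that that] F(2)[OF that] that by simp
    qed
    show "\<exists>u\<in>K. AE E in lborel. ?F u E = g E" if g: "g \<in> borel_measurable borel" "\<And>E. E \<notin> W \<Longrightarrow> g E = 0"
      "integrable lborel (\<lambda>E. (cmod (g E))\<^sup>2)" for g
    proof -
      have gm: "g \<in> borel_measurable (lebesgue_on W)" by (rule borel_measurable_lebesgue_on[OF g(1)])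
      have "(\<lambda>E. (cmod (g E))\<^sup>2) \<in> borel_measurable (lebesgue_on W)" "(\<lambda>E. (cmod (g E))\<^sup>2) \<in> borel_measurable borel"
        using gm g(1) by measurable
      from integral_lebesgue_on_eq(1)[OF W this] g(2,3) have "square_int_on W g"
        unfolding square_int_on_def using gm by simp
      hence "\<forall>j'\<in>{j}. square_int_on W ((\<lambda>_. g) j')" by simp
      moreover have "\<forall>g. (\<forall>j'\<in>{j}. square_int_on W (g j')) \<longrightarrow>
        (\<exists>u\<in>K. \<forall>j'\<in>{j}. AE E in lebesgue_on W. G j' u E = g j' E)" using U unfolding L2_unitary_def by blast
      ultimately obtain u where u: "u \<in> K" "AE E in lebesgue_on W. G j u E = g E" by fastforce
      have "AE E in lebesgue_on W. ?F u E = g E" using u(2) F(3)[OF u(1)] by eventually_elim simp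
      hence "AE E in lborel. E \<in> W \<longrightarrow> ?F u E = g E" by (simp add: AE_lebesgue_on_iff W)
      hence "AE E in lborel. ?F u E = g E" by eventually_elim (use F(2)[OF u(1)] g(2) in fastforce)
      with u(1) show ?thesis by blast
    qed
  qed (use K W in auto)
qed

context L2_rep
begin

lemma integrable_cnj_mult:
  assumes "u \<in> K" "v \<in> K"
  shows "integrable lborel (\<lambda>E. cnj (F u E) * F v E)"
proof (rule Bochner_Integration.integrable_bound[OF Bochner_Integration.integrable_add[OF sq[OF assms(1)] sq[OF assms(2)]]])
  note [measurable] = meas[OF assms(1)] meas[OF assms(2)]
  show "(\<lambda>E. cnj (F u E) * F v E) \<in> borel_measurable lborel" by measurable
  show "AE E in lborel. norm (cnj (F u E) * F v E) \<le> norm ((cmod (F u E))\<^sup>2 + (cmod (F v E))\<^sup>2)"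
    using Young_square[of 1 "cmod (F u _)" "cmod (F v _)"] by (auto intro!: AE_I2 simp: norm_mult)
qed

text \<open>Polarization: the norms of \<open>u\<close>, \<open>v\<close> and \<open>u + v\<close>
  determine the real part. \<open>cinner_eq\<close> then obtains the imaginary part by multiplying
  \<open>v\<close> by i.\<close>

lemma Re_cinner_eq:
  assumes "u \<in> K" "v \<in> K"
  shows "Re (cinner u v) = (LBINT E. Re (cnj (F u E) * F v E))"
proof -
  note [measurable] = meas[OF assms(1)] meas[OF assms(2)]
  have uv: "u + v \<in> K" using K assms unfolding csubspace_iff by blast
  note [measurable] = meas[OF uv]
  have i: "integrable lborel (\<lambda>E. Re (cnj (F u E) * F v E))"
    using integrable_cnj_mult[OF assms] by (rule integrable_Re)
  have "(norm (u + v))\<^sup>2 = (LBINT E. (cmod (F (u + v) E))\<^sup>2)" by (rule norm_eq[OF uv])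
  also have "\<dots> = (LBINT E. (cmod (F u E))\<^sup>2 + 2 * Re (cnj (F u E) * F v E) + (cmod (F v E))\<^sup>2)"
  proof (rule integral_cong_AE)
    show "AE E in lborel. (cmod (F (u + v) E))\<^sup>2 = (cmod (F u E))\<^sup>2 + 2 * Re (cnj (F u E) * F v E) + (cmod (F v E))\<^sup>2"
      using add[OF assms] by eventually_elim (simp only: cmod_add_square)
  qed measurable
  also have "\<dots> = (norm u)\<^sup>2 + 2 * (LBINT E. Re (cnj (F u E) * F v E)) + (norm v)\<^sup>2"
    unfolding norm_eq[OF assms(1)] norm_eq[OF assms(2)]
      Bochner_Integration.integral_add[OF Bochner_Integration.integrable_add[OF sq[OF assms(1)] integrable_mult_right[OF i, of 2]] sq[OF assms(2)]]
      Bochner_Integration.integral_add[OF sq[OF assms(1)] integrable_mult_right[OF i, of 2]]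
    by (simp only: integral_mult_right_zero)
  finally show ?thesis unfolding norm_add_square by simp
qed

lemma cinner_eq:
  assumes "u \<in> K" "v \<in> K"
  shows "cinner u v = (LBINT E. cnj (F u E) * F v E)"
proof -
  have iv: "\<i> *\<^sub>C v \<in> K" using K assms unfolding csubspace_iff by blast
  note [measurable] = meas[OF assms(1)] meas[OF assms(2)] meas[OF iv]
  note i = integrable_cnj_mult[OF assms]
  have "Re (cinner u (\<i> *\<^sub>C v)) = (LBINT E. Re (cnj (F u E) * F (\<i> *\<^sub>C v) E))" by (rule Re_cinner_eq[OF assms(1) iv])
  also have "\<dots> = (LBINT E. - Im (cnj (F u E) * F v E))"
  proof (rule integral_cong_AE)
    show "AE E in lborel. Re (cnj (F u E) * F (\<i> *\<^sub>C v) E) = - Im (cnj (F u E) * F v E)"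
      using scale[OF assms(2), of \<i>] by eventually_elim (simp add: algebra_simps)
  qed measurable
  also have "\<dots> = - Im (LBINT E. cnj (F u E) * F v E)"
    by (simp only: integral_Im[OF i] Bochner_Integration.integral_minus)
  finally have "Im (cinner u v) = Im (LBINT E. cnj (F u E) * F v E)" by (simp add: cinner_scaleC_right)
  moreover have "Re (cinner u v) = Re (LBINT E. cnj (F u E) * F v E)"
    using Re_cinner_eq[OF assms] integral_Re[OF i] by simp
  ultimately show ?thesis by (simp add: complex_eq_iff)
qed

lemma diff:
  assumes "u \<in> K" "v \<in> K"
  shows "AE E in lborel. F (u - v) E = F u E - F v E"
proof -
  have mv: "(-1) *\<^sub>C v \<in> K" using K assms unfolding csubspace_iff by blast
  from add[OF assms(1) mv] scale[OF assms(2), of "-1"] show ?thesis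
    by eventually_elim (simp add: scaleC_minus1)
qed

lemma norm_diff_eq:
  assumes "u \<in> K" "v \<in> K"
  shows "(norm (u - v))\<^sup>2 = (LBINT E. (cmod (F u E - F v E))\<^sup>2)"
proof -
  have uv: "u - v \<in> K" using K assms by (rule csubspace_diff)
  note [measurable] = meas[OF assms(1)] meas[OF assms(2)] meas[OF uv]
  show ?thesis unfolding norm_eq[OF uv]
  proof (rule integral_cong_AE)
    show "AE E in lborel. (cmod (F (u - v) E))\<^sup>2 = (cmod (F u E - F v E))\<^sup>2"
      using diff[OF assms] by eventually_elim simp
  qed measurable
qed

lemma eqI:
  assumes "u \<in> K" "v \<in> K" "AE E in lborel. F u E = F v E"
  shows "u = v"
proof -
  note [measurable] = meas[OF assms(1)] meas[OF assms(2)]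
  have "(norm (u - v))\<^sup>2 = (\<integral>E. 0 \<partial>(lborel :: real measure))"
    unfolding norm_diff_eq[OF assms(1,2)] by (rule integral_cong_AE) (use assms(3) in auto)
  thus ?thesis by simp
qed

end

section \<open>Unitary groups\<close>

locale unitary_group =
  fixes D :: "'h::chilbert_space set" and A :: "'h \<Rightarrow> 'h" and U :: "real \<Rightarrow> 'h \<Rightarrow> 'h"
  assumes group: "unitary_group_of D A U"
begin

lemma bounded_clinear_U: "bounded_clinear (U t)" and norm_U [simp]: "norm (U t u) = norm u"
  and U_0 [simp]: "U 0 u = u" and U_add: "U (s + t) u = U s (U t u)"
  and U_cont: "continuous_on UNIV (\<lambda>t. U t u)"
  and U_generator: "((\<lambda>t. U t u) has_vector_derivative v) (at 0) \<longleftrightarrow> u \<in> D \<and> v = \<i> *\<^sub>C A u"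
  using group unfolding unitary_group_of_def by blast+

lemmas U_linear = bounded_clinearD[OF bounded_clinear_U]

lemma U_inverse [simp]: "U t (U (- t) u) = u" "U (- t) (U t u) = u"
  using U_add[of t "- t" u] U_add[of "- t" t u] by simp_all

lemma cinner_U: "cinner (U t u) (U t v) = cinner u v"
  by (rule cinner_isometry[where S = UNIV]) (auto simp: U_linear csubspace_iff)

text \<open>\<open>U t\<close> commutes with the group, so it maps a differentiable orbit to a
  differentiable one; the generator clause, being an equivalence, turns this back into membership in
  \<open>D\<close>.\<close>

lemma U_domain:
  assumes "u \<in> D"
  shows "U t u \<in> D" "A (U t u) = U t (A u)"
proof -
  have "((\<lambda>s. U s u) has_vector_derivative \<i> *\<^sub>C A u) (at 0)" using assms U_generator by blast
  hence "((\<lambda>s. U t (U s u)) has_vector_derivative U t (\<i> *\<^sub>C A u)) (at 0)"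
    by (rule bounded_linear.has_vector_derivative[OF U_linear(1)])
  hence "((\<lambda>s. U s (U t u)) has_vector_derivative \<i> *\<^sub>C U t (A u)) (at 0)"
    by (simp add: U_linear(2) U_add[symmetric] add.commute)
  hence *: "U t u \<in> D" "\<i> *\<^sub>C U t (A u) = \<i> *\<^sub>C A (U t u)" using U_generator by blast+
  thus "U t u \<in> D" by blast
  have "(-\<i>) *\<^sub>C (\<i> *\<^sub>C U t (A u)) = (-\<i>) *\<^sub>C (\<i> *\<^sub>C A (U t u))" using * by simp
  thus "A (U t u) = U t (A u)" unfolding scaleC_scaleC using scaleC_of_real[of 1] by simp
qed

lemma U_derivative:
  assumes "u \<in> D"
  shows "((\<lambda>t. U t u) has_vector_derivative \<i> *\<^sub>C A (U t u)) (at t)"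
proof -
  have "((\<lambda>s. U s (U t u)) has_vector_derivative \<i> *\<^sub>C A (U t u)) (at 0)"
    using U_generator U_domain(1)[OF assms] by blast
  hence "(((\<lambda>s. U s (U t u)) \<circ> (\<lambda>s. s - t)) has_vector_derivative 1 *\<^sub>R (\<i> *\<^sub>C A (U t u))) (at t)"
    by (intro vector_diff_chain_at) (auto intro!: derivative_eq_intros)
  thus ?thesis by (simp add: o_def U_add[symmetric])
qed

text \<open>Pulled back by \<open>U (- t)\<close> the curve is constant: by isometry its increments
  have the norm of \<open>x (t + h) - U h (x t)\<close>, the difference of two curves with the same
  value and velocity at \<open>h = 0\<close>. This identifies concrete solutions with the
  group.\<close>

lemma generator_unique:
  assumes x: "\<And>t. x t \<in> D" "\<And>t. (x has_vector_derivative \<i> *\<^sub>C A (x t)) (at t)"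
  shows "x t = U t (x 0)"
proof -
  define y where "y t = U (- t) (x t)" for t
  have "(y has_derivative (\<lambda>h. 0)) (at t)" for t
  proof -
    define k where "k h = x (t + h) - U h (x t)" for h
    have "((\<lambda>h. x (t + h)) has_vector_derivative \<i> *\<^sub>C A (x t)) (at 0)"
    proof -
      have "((x \<circ> (\<lambda>h. t + h)) has_vector_derivative 1 *\<^sub>R (\<i> *\<^sub>C A (x t))) (at 0)"
        using x(2)[of t] by (intro vector_diff_chain_at) (auto intro!: derivative_eq_intros)
      thus ?thesis by (simp add: o_def)
    qed
    moreover have "((\<lambda>h. U h (x t)) has_vector_derivative \<i> *\<^sub>C A (x t)) (at 0)"
      using U_generator x(1) by blast
    ultimately have "(k has_vector_derivative \<i> *\<^sub>C A (x t) - \<i> *\<^sub>C A (x t)) (at 0)"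
      unfolding k_def by (rule has_vector_derivative_diff)
    hence "(k has_derivative (\<lambda>h. 0)) (at 0)" by (simp add: has_vector_derivative_def)
    hence lim: "(\<lambda>h. norm (k h) / norm h) \<midarrow>0\<rightarrow> 0" unfolding has_derivative_at by (simp add: k_def)
    have "norm (y (t + h) - y t) = norm (k h)" for h
    proof -
      have "y (t + h) - y t = U (- (t + h)) (k h)"
        unfolding y_def k_def U_linear(4) U_add[symmetric] by simp
      thus ?thesis by simp
    qed
    with lim show ?thesis unfolding has_derivative_at by simp
  qed
  then obtain c where c: "\<And>t. y t = c" using has_derivative_zero_constant[of UNIV y] by auto
  have "U (- t) (x t) = x 0" using c[of t] c[of 0] by (simp add: y_def)
  hence "U t (U (- t) (x t)) = U t (x 0)" by simp
  thus ?thesis by simp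
qed

end

section \<open>Orthogonal projections onto complemented subspaces\<close>

text \<open>Existence of the projection is the assumption because it has two sources: closedness for
  the reservoirs, the orthogonal decomposition for the system space.\<close>

locale projection_space =
  fixes K :: "'h::chilbert_space set"
  assumes K: "csubspace K" and complemented: "\<exists>v\<in>K. \<forall>w\<in>K. cinner w (u - v) = 0"
begin

lemma proj_in: "orth_proj K u \<in> K" and proj_orth: "w \<in> K \<Longrightarrow> cinner w (u - orth_proj K u) = 0"
proof -
  obtain v where "v \<in> K" "\<forall>w\<in>K. cinner w (u - v) = 0" using complemented by blast
  moreover from this have "orth_proj K u = v" by (intro orth_proj_eqI K) auto
  ultimately show "orth_proj K u \<in> K" "w \<in> K \<Longrightarrow> cinner w (u - orth_proj K u) = 0" by auto
qed

lemma cinner_proj_right: "w \<in> K \<Longrightarrow> cinner w (orth_proj K u) = cinner w u"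
  using proj_orth[of w u] by (simp add: cinner.diff_right)

lemma proj_symmetric: "cinner (orth_proj K u) v = cinner u (orth_proj K v)"
proof -
  have "cinner (orth_proj K u) v = cinner (orth_proj K u) (orth_proj K v)"
    using cinner_proj_right[OF proj_in, of u v] by simp
  also have "\<dots> = cnj (cinner (orth_proj K v) (orth_proj K u))" by (rule cinner_commute)
  also have "\<dots> = cnj (cinner (orth_proj K v) u)" using cinner_proj_right[OF proj_in, of v u] by simp
  also have "\<dots> = cinner u (orth_proj K v)" by (rule cinner_commute[symmetric])
  finally show ?thesis .
qed

lemma norm_proj_le: "norm (orth_proj K u) \<le> norm u"
proof -
  have "cinner (orth_proj K u) (u - orth_proj K u) = 0" by (intro proj_orth proj_in)
  hence "(norm (orth_proj K u + (u - orth_proj K u)))\<^sup>2 = (norm (orth_proj K u))\<^sup>2 + (norm (u - orth_proj K u))\<^sup>2"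
    unfolding norm_add_square by simp
  hence "(norm (orth_proj K u))\<^sup>2 \<le> (norm u)\<^sup>2" by simp
  thus ?thesis by (rule power2_le_imp_le) simp
qed

lemma bounded_clinear_proj: "bounded_clinear (orth_proj K)"
proof -
  have add: "orth_proj K (u + v) = orth_proj K u + orth_proj K v" for u v
    using K proj_in unfolding csubspace_iff
    by (intro orth_proj_eqI K) (auto simp: cinner.diff_right cinner.add_right cinner_proj_right)
  have sc: "orth_proj K (c *\<^sub>C u) = c *\<^sub>C orth_proj K u" for c u
    using K proj_in unfolding csubspace_iff
    by (intro orth_proj_eqI K) (auto simp: cinner.diff_right cinner_scaleC_right cinner_proj_right)
  have "bounded_linear (orth_proj K)"
  proof
    show "orth_proj K (r *\<^sub>R u) = r *\<^sub>R orth_proj K u" for r u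
      using sc[of "complex_of_real r" u] by (simp add: scaleC_of_real)
    show "\<exists>C. \<forall>u. norm (orth_proj K u) \<le> norm u * C" using norm_proj_le by (intro exI[of _ 1]) auto
  qed (rule add)
  thus ?thesis unfolding bounded_clinear_def using sc by blast
qed

end

section \<open>Energy representation and free dynamics of the reservoirs\<close>

section \<open>The decoupled system\<close>

definition energy_rep :: "'h::chilbert_space open_system \<Rightarrow> nat \<Rightarrow> 'h \<Rightarrow> real \<Rightarrow> complex" where
  "energy_rep Q j u = borel_version (sigma0 Q) (four Q j u)"

context decoupled_system
begin

abbreviation J :: "nat set" where "J \<equiv> {1..nres Q}"
abbreviation R :: "nat \<Rightarrow> 'h \<Rightarrow> real \<Rightarrow> complex" where "R \<equiv> energy_rep Q"

lemma csubspace_sys: "csubspace (sys Q)"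
  using sys_finite_dim complex_vector.subspace_span by auto

lemma csubspace_res: "j \<in> J \<Longrightarrow> csubspace (res Q j)"
  using res_subspace by blast

lemma res_orth_sys: "j \<in> J \<Longrightarrow> u \<in> sys Q \<Longrightarrow> v \<in> res Q j \<Longrightarrow> cinner v u = 0"
  using sys_orth_res[of j u v] cinner_commute[of v u] by simp

lemma projection_res: "j \<in> J \<Longrightarrow> projection_space (res Q j)"
proof
  fix u :: 'h assume j: "j \<in> J"
  thus "csubspace (res Q j)" by (rule csubspace_res)
  obtain v where "v \<in> res Q j" "\<And>w. w \<in> res Q j \<Longrightarrow> cinner w (u - v) = 0"
    using orthogonal_projection_exists[of "res Q j" u] res_subspace[OF j] by auto
  thus "\<exists>v\<in>res Q j. \<forall>w\<in>res Q j. cinner w (u - v) = 0" by blast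
qed

lemma cinner_components:
  assumes k: "k \<in> J" and w: "w \<in> res Q k" and s: "s \<in> sys Q" and r: "\<And>j. j \<in> J \<Longrightarrow> r j \<in> res Q j"
  shows "cinner w (s + (\<Sum>j=1..nres Q. r j)) = cinner w (r k)"
proof -
  have "cinner w (\<Sum>j=1..nres Q. r j) = (\<Sum>j=1..nres Q. if j = k then cinner w (r k) else 0)"
    unfolding cinner.sum_right using res_orth_res[OF k _ _ w] r by (intro sum.cong) auto
  also have "\<dots> = cinner w (r k)" using k by simp
  finally show ?thesis using res_orth_sys[OF k s w] by (simp add: cinner.add_right)
qed

lemma proj_res_components:
  assumes k: "k \<in> J" and s: "s \<in> sys Q" and r: "\<And>j. j \<in> J \<Longrightarrow> r j \<in> res Q j"
  shows "proj_res Q k (s + (\<Sum>j=1..nres Q. r j)) = r k"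
  unfolding proj_res_def using cinner_components[OF k _ s r] k r
  by (intro orth_proj_eqI csubspace_res) (auto simp: cinner.diff_right)

lemma proj_sys_components:
  assumes s: "s \<in> sys Q" and r: "\<And>j. j \<in> J \<Longrightarrow> r j \<in> res Q j"
  shows "proj_sys Q (s + (\<Sum>j=1..nres Q. r j)) = s"
  unfolding proj_sys_def using s r sys_orth_res
  by (intro orth_proj_eqI csubspace_sys) (auto simp: cinner.sum_right)

lemma components:
  obtains s r where "s \<in> sys Q" "\<And>j. j \<in> J \<Longrightarrow> r j \<in> res Q j" "u = s + (\<Sum>j=1..nres Q. r j)"
  using orth_sum[of u] by blast

lemma projection_sys: "projection_space (sys Q)"
proof
  fix u :: 'h
  obtain s r where sr: "s \<in> sys Q" "\<And>j. j \<in> J \<Longrightarrow> r j \<in> res Q j" "u = s + (\<Sum>j=1..nres Q. r j)" using components[of u] by blast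
  have "\<forall>w\<in>sys Q. cinner w (u - s) = 0" using sr(2) sys_orth_res by (auto simp: sr(3) cinner.sum_right)
  thus "\<exists>v\<in>sys Q. \<forall>w\<in>sys Q. cinner w (u - v) = 0" using sr(1) by blast
qed (rule csubspace_sys)

lemma decomposition: "u = proj_sys Q u + (\<Sum>j=1..nres Q. proj_res Q j u)"
proof -
  obtain s r where sr: "s \<in> sys Q" "\<And>j. j \<in> J \<Longrightarrow> r j \<in> res Q j" "u = s + (\<Sum>j=1..nres Q. r j)" using components[of u] by blast
  have "proj_sys Q u = s" unfolding sr(3) by (intro proj_sys_components sr)
  moreover have "proj_res Q j u = r j" if "j \<in> J" for j unfolding sr(3) by (intro proj_res_components sr that)
  ultimately show ?thesis using sr(3) by simp
qed

lemma proj_sys_in: "proj_sys Q u \<in> sys Q"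
  unfolding proj_sys_def by (rule projection_space.proj_in[OF projection_sys])

lemma proj_res_in: "j \<in> J \<Longrightarrow> proj_res Q j u \<in> res Q j"
  unfolding proj_res_def by (rule projection_space.proj_in[OF projection_res])

lemma proj_res_clinear: "j \<in> J \<Longrightarrow> bounded_clinear (proj_res Q j)"
  unfolding proj_res_def by (rule projection_space.bounded_clinear_proj[OF projection_res])

lemma proj_res_symmetric: "j \<in> J \<Longrightarrow> cinner (proj_res Q j u) v = cinner u (proj_res Q j v)"
  unfolding proj_res_def by (rule projection_space.proj_symmetric[OF projection_res])

lemma norm_proj_res_le: "j \<in> J \<Longrightarrow> norm (proj_res Q j u) \<le> norm u"
  unfolding proj_res_def by (rule projection_space.norm_proj_le[OF projection_res])

lemma proj_res_res:
  assumes "j \<in> J" "k \<in> J" "v \<in> res Q j"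
  shows "proj_res Q k v = (if j = k then v else 0)"
  unfolding proj_res_def using assms csubspace_res[OF assms(2)] res_orth_res[of k j]
  by (intro orth_proj_eqI) (auto simp: csubspace_iff)

lemma proj_sys_res: "j \<in> J \<Longrightarrow> v \<in> res Q j \<Longrightarrow> proj_sys Q v = 0"
  unfolding proj_sys_def using csubspace_sys sys_orth_res[of j]
  by (intro orth_proj_eqI) (auto simp: csubspace_iff)

lemma proj0_res: "j \<in> J \<Longrightarrow> v \<in> res Q j \<Longrightarrow> proj0 Q v = v"
  unfolding proj0_def by (simp add: proj_res_res)

lemma proj0_clinear: "bounded_clinear (proj0 Q)"
  unfolding proj0_def bounded_clinear_def
  using bounded_clinearD[OF proj_res_clinear]
  by (auto intro!: bounded_linear_sum simp: complex_vector.scale_sum_right)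

lemmas proj_res_linear = bounded_clinearD[OF proj_res_clinear]
lemmas proj0_linear = bounded_clinearD[OF proj0_clinear]

lemma proj0_idem: "proj0 Q (proj0 Q u) = proj0 Q u"
proof -
  have "proj0 Q (proj0 Q u) = (\<Sum>j=1..nres Q. proj0 Q (proj_res Q j u))"
    by (subst (2) proj0_def) (simp add: proj0_linear(7))
  also have "\<dots> = proj0 Q u" unfolding proj0_def[of Q u] by (intro sum.cong refl proj0_res[OF _ proj_res_in])
  finally show ?thesis .
qed

lemma range_proj0_iff: "u \<in> range (proj0 Q) \<longleftrightarrow> proj0 Q u = u"
  by (auto simp: proj0_idem) (metis rangeI)

lemma res_subset_range_proj0: "j \<in> J \<Longrightarrow> v \<in> res Q j \<Longrightarrow> v \<in> range (proj0 Q)"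
  using proj0_res range_proj0_iff by blast

lemma csubspace_range_proj0: "csubspace (range (proj0 Q))"
  unfolding csubspace_iff Ball_def range_proj0_iff by (simp add: proj0_linear)

lemma proj0_symmetric: "cinner (proj0 Q u) v = cinner u (proj0 Q v)"
  unfolding proj0_def by (simp add: cinner.sum_left cinner.sum_right proj_res_symmetric)

lemma norm_proj0_le: "norm (proj0 Q u) \<le> norm u"
proof -
  have "cinner (proj0 Q u) (u - proj0 Q u) = 0"
    by (simp add: proj0_symmetric proj0_linear proj0_idem)
  hence "(norm (proj0 Q u + (u - proj0 Q u)))\<^sup>2 = (norm (proj0 Q u))\<^sup>2 + (norm (u - proj0 Q u))\<^sup>2"
    unfolding norm_add_square by simp
  hence "(norm (proj0 Q u))\<^sup>2 \<le> (norm u)\<^sup>2" by simp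
  thus ?thesis by (rule power2_le_imp_le) simp
qed

lemma ham_res_facts:
  assumes "j \<in> J"
  shows "csubspace (dom_res Q j)" "dom_res Q j \<subseteq> res Q j" "res Q j \<subseteq> closure (dom_res Q j)"
    "u \<in> dom_res Q j \<Longrightarrow> ham_res Q j u \<in> res Q j"
    "u \<in> dom_res Q j \<Longrightarrow> v \<in> dom_res Q j \<Longrightarrow> cinner u (ham_res Q j v) = cinner (ham_res Q j u) v"
    "ham_res Q j 0 = 0" "0 \<in> dom_res Q j"
proof -
  note sa = ham_res_sa[OF assms, unfolded self_adjoint_on_def]
  show sub: "csubspace (dom_res Q j)" "dom_res Q j \<subseteq> res Q j" "res Q j \<subseteq> closure (dom_res Q j)" using sa by blast+
  show in_res: "ham_res Q j u \<in> res Q j" if "u \<in> dom_res Q j" for u using sa that by blast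
  show "cinner u (ham_res Q j v) = cinner (ham_res Q j u) v" if "u \<in> dom_res Q j" "v \<in> dom_res Q j" for u v
    using sa that sub in_res by blast
  show z: "0 \<in> dom_res Q j" using sub(1) unfolding csubspace_iff by blast
  have "ham_res Q j (0 *\<^sub>C 0) = 0 *\<^sub>C ham_res Q j 0" using sa z by blast
  thus "ham_res Q j 0 = 0" by simp
qed

lemma ham_sys_facts: "u \<in> sys Q \<Longrightarrow> ham_sys Q u \<in> sys Q" "ham_sys Q 0 = 0"
proof -
  note sa = ham_sys_sa[unfolded self_adjoint_on_def]
  show "u \<in> sys Q \<Longrightarrow> ham_sys Q u \<in> sys Q" using sa by blast
  have z: "0 \<in> sys Q" using csubspace_sys unfolding csubspace_iff by blast
  have "ham_sys Q (0 *\<^sub>C 0) = 0 *\<^sub>C ham_sys Q 0" using sa z by blast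
  thus "ham_sys Q 0 = 0" by simp
qed

lemma dom0_proj: "u \<in> dom0 Q \<Longrightarrow> j \<in> J \<Longrightarrow> proj_res Q j u \<in> dom_res Q j"
  unfolding dom0_def by blast

lemma dom_res_dom0:
  assumes "j \<in> J" "w \<in> dom_res Q j"
  shows "w \<in> dom0 Q" "ham0 Q w = ham_res Q j w"
proof -
  have w: "w \<in> res Q j" using assms ham_res_facts by blast
  show "w \<in> dom0 Q" unfolding dom0_def using proj_res_res[OF assms(1) _ w] assms ham_res_facts(7) by auto
  have "(\<Sum>k=1..nres Q. ham_res Q k (proj_res Q k w)) = (\<Sum>k=1..nres Q. if k = j then ham_res Q j w else 0)"
    using proj_res_res[OF assms(1) _ w] ham_res_facts(6) by (intro sum.cong) auto
  also have "\<dots> = ham_res Q j w" using assms by simp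
  finally show "ham0 Q w = ham_res Q j w"
    unfolding ham0_def using proj_sys_res[OF assms(1) w] by (simp add: ham_sys_facts)
qed

lemma proj_res_ham0:
  assumes "u \<in> dom0 Q" "k \<in> J"
  shows "proj_res Q k (ham0 Q u) = ham_res Q k (proj_res Q k u)"
  unfolding ham0_def using assms
  by (intro proj_res_components ham_sys_facts proj_sys_in ham_res_facts(4) dom0_proj) auto

lemma ham0_proj_res:
  assumes "u \<in> dom0 Q" "k \<in> J"
  shows "proj_res Q k u \<in> dom0 Q" "ham0 Q (proj_res Q k u) = proj_res Q k (ham0 Q u)"
  using dom_res_dom0[OF assms(2) dom0_proj[OF assms]] proj_res_ham0[OF assms] by simp_all

lemma csubspace_dom0: "csubspace (dom0 Q)"
  unfolding csubspace_iff dom0_def using ham_res_facts(1) unfolding csubspace_iff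
  by (auto simp: proj_res_linear)

lemma dom0_dense: "closure (dom0 Q) = UNIV"
proof -
  have sub: "csubspace (closure (dom0 Q))" by (rule csubspace_closure[OF csubspace_dom0])
  have s: "sys Q \<subseteq> closure (dom0 Q)"
  proof -
    have "proj_res Q j s = 0" if "j \<in> J" "s \<in> sys Q" for j s
      unfolding proj_res_def using that csubspace_res[OF that(1)] res_orth_sys
      by (intro orth_proj_eqI) (auto simp: csubspace_iff)
    hence "sys Q \<subseteq> dom0 Q" unfolding dom0_def using ham_res_facts(7) by auto
    thus ?thesis using closure_subset by blast
  qed
  have r: "res Q j \<subseteq> closure (dom0 Q)" if "j \<in> J" for j
  proof -
    have "dom_res Q j \<subseteq> dom0 Q" using dom_res_dom0(1) that by blast
    thus ?thesis using ham_res_facts(3)[OF that] closure_mono by blast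
  qed
  have "u \<in> closure (dom0 Q)" for u
  proof -
    have "proj_sys Q u + (\<Sum>j=1..nres Q. proj_res Q j u) \<in> closure (dom0 Q)"
      using subsetD[OF r proj_res_in] subsetD[OF s proj_sys_in]
      by (intro complex_vector.subspace_add[OF sub] csubspace_sum[OF sub])
    thus ?thesis using decomposition[of u] by simp
  qed
  thus ?thesis by blast
qed

lemma continuous_eq_on_dom0:
  fixes f g :: "'h \<Rightarrow> 'a::t2_space"
  assumes "continuous_on UNIV f" "continuous_on UNIV g" "\<And>u. u \<in> dom0 Q \<Longrightarrow> f u = g u"
  shows "f u = g u"
proof -
  have "closed {u. f u = g u}" using assms by (intro closed_Collect_eq)
  hence "closure (dom0 Q) \<subseteq> {u. f u = g u}" using assms(3) by (intro closure_minimal) auto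
  thus ?thesis using dom0_dense by auto
qed

text \<open>\<open>dom0 Q\<close> is dense, so the form determines a bounded operator; the equality
  is extended in one argument at a time.\<close>

lemma commutator_eq:
  assumes "is_commutator (dom0 Q) A B C"
  shows "commutator (dom0 Q) A B = C"
  unfolding commutator_def
proof (rule the_equality)
  fix C' assume C': "is_commutator (dom0 Q) A B C'"
  have c: "continuous_on UNIV C" "continuous_on UNIV C'"
    using assms C' bounded_clinearD(1) linear_continuous_on unfolding is_commutator_def by blast+
  have "cinner u (C' v) = cinner u (C v)" for u v
  proof (rule continuous_eq_on_dom0[of "\<lambda>u. cinner u (C' v)" "\<lambda>u. cinner u (C v)"])
    fix u assume u: "u \<in> dom0 Q"
    show "cinner u (C' v) = cinner u (C v)"
    proof (rule continuous_eq_on_dom0[of "\<lambda>v. cinner u (C' v)" "\<lambda>v. cinner u (C v)"])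
      fix v assume "v \<in> dom0 Q"
      thus "cinner u (C' v) = cinner u (C v)" using assms C' u unfolding is_commutator_def by metis
    qed (intro cinner.continuous_on continuous_intros c)+
  qed (intro cinner.continuous_on continuous_intros)+
  thus "C' = C" by (intro ext cinner_ext)
qed (rule assms)

text \<open>Exchanging the arguments and conjugating swaps the two terms of the form. The adjoint of
  \<open>C\<close> is thus \<open>- C\<close>, which accounts for the vectors \<open>- C e\<close>
  below.\<close>

lemma commutator_antisymmetric:
  assumes "is_commutator (dom0 Q) A B C"
  shows "cinner (C u) v = - cinner u (C v)"
proof -
  have c: "continuous_on UNIV C"
    using assms bounded_clinearD(1) linear_continuous_on unfolding is_commutator_def by blast
  show ?thesis
  proof (rule continuous_eq_on_dom0[of "\<lambda>u. cinner (C u) v" "\<lambda>u. - cinner u (C v)"])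
    fix u assume u: "u \<in> dom0 Q"
    show "cinner (C u) v = - cinner u (C v)"
    proof (rule continuous_eq_on_dom0[of "\<lambda>v. cinner (C u) v" "\<lambda>v. - cinner u (C v)"])
      fix v assume v: "v \<in> dom0 Q"
      have eq: "cinner u (C v) = cinner (A u) (B v) - cinner (B u) (A v)" if "u \<in> dom0 Q" "v \<in> dom0 Q" for u v
        using assms that unfolding is_commutator_def by blast
      have "cinner (C u) v = cnj (cinner v (C u))" by (rule cinner_commute)
      also have "\<dots> = cinner (B u) (A v) - cinner (A u) (B v)"
        unfolding eq[OF v u] complex_cnj_diff cinner_commute[symmetric] ..
      finally show "cinner (C u) v = - cinner u (C v)" unfolding eq[OF u v] by simp
    qed (intro cinner.continuous_on continuous_intros c)+
  qed (intro cinner.continuous_on continuous_intros c)+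
qed

lemma rep_res: "j \<in> J \<Longrightarrow> L2_rep (res Q j) (sigma0 Q) (R j)"
  unfolding energy_rep_def
  using four_spectral[of j] unfolding spectral_rep_def
  by (intro L2_rep_borel_version[where G = "four Q" and j = j] csubspace_res sigma0) blast+

lemma four_measurable: "j \<in> J \<Longrightarrow> u \<in> res Q j \<Longrightarrow> four Q j u \<in> borel_measurable (lebesgue_on (sigma0 Q))"
  using four_spectral[of j] unfolding spectral_rep_def L2_unitary_def square_int_on_def by blast

lemma AE_four_rep: "j \<in> J \<Longrightarrow> u \<in> res Q j \<Longrightarrow> AE E in lebesgue_on (sigma0 Q). four Q j u E = R j u E"
  unfolding energy_rep_def by (intro borel_version(3) four_measurable sigma0)

lemma rep_measurable: "j \<in> J \<Longrightarrow> u \<in> res Q j \<Longrightarrow> R j u \<in> borel_measurable borel"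
  by (rule L2_rep.meas[OF rep_res])

lemma dom_res_iff:
  assumes "j \<in> J" "u \<in> res Q j"
  shows "u \<in> dom_res Q j \<longleftrightarrow> integrable lborel (\<lambda>E. E\<^sup>2 * (cmod (R j u E))\<^sup>2)"
proof -
  let ?f = "\<lambda>E. complex_of_real E * four Q j u E"
  note fm [measurable] = four_measurable[OF assms] and rm [measurable] = rep_measurable[OF assms]
  have id: "(\<lambda>E. complex_of_real E) \<in> borel_measurable (lebesgue_on (sigma0 Q))"
    by (rule borel_measurable_lebesgue_on) measurable
  have fm': "?f \<in> borel_measurable (lebesgue_on (sigma0 Q))" using id by measurable
  have "dom_res Q j \<inter> res Q j = {u \<in> res Q j. \<forall>j\<in>{j}. square_int_on (sigma0 Q) (\<lambda>E. complex_of_real E * four Q j u E)}"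
    using four_spectral[OF assms(1)] unfolding spectral_rep_def by blast
  hence "u \<in> dom_res Q j \<longleftrightarrow> square_int_on (sigma0 Q) ?f" using assms(2) ham_res_facts(2)[OF assms(1)] by auto
  also have "\<dots> \<longleftrightarrow> integrable (lebesgue_on (sigma0 Q)) (\<lambda>E. (cmod (?f E))\<^sup>2)"
    unfolding square_int_on_def using fm' by simp
  also have "\<dots> \<longleftrightarrow> integrable lborel (\<lambda>E. E\<^sup>2 * (cmod (R j u E))\<^sup>2)"
  proof (rule integral_lebesgue_on_eq(1)[OF sigma0(1)])
    show "(\<lambda>E. (cmod (?f E))\<^sup>2) \<in> borel_measurable (lebesgue_on (sigma0 Q))" using fm' by measurable
    show "E\<^sup>2 * (cmod (R j u E))\<^sup>2 = 0" if "E \<notin> sigma0 Q" for E using L2_rep.supp[OF rep_res[OF assms(1)] assms(2) that] by simp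
    show "AE E in lebesgue_on (sigma0 Q). (cmod (?f E))\<^sup>2 = E\<^sup>2 * (cmod (R j u E))\<^sup>2"
      using AE_four_rep[OF assms] by eventually_elim (simp add: norm_mult power_mult_distrib)
  qed measurable
  finally show ?thesis .
qed

lemma AE_rep_transfer:
  assumes "AE E in lebesgue_on (sigma0 Q). P E" "\<And>E. E \<notin> sigma0 Q \<Longrightarrow> P E"
  shows "AE E in lborel. P E"
proof -
  have "AE E in lborel. E \<in> sigma0 Q \<longrightarrow> P E" using assms(1) by (simp add: AE_lebesgue_on_iff sigma0)
  thus ?thesis by eventually_elim (use assms(2) in blast)
qed

lemma rep_ham_res:
  assumes "j \<in> J" "u \<in> dom_res Q j"
  shows "AE E in lborel. R j (ham_res Q j u) E = complex_of_real E * R j u E"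
proof (rule AE_rep_transfer)
  have u: "u \<in> res Q j" and Hu: "ham_res Q j u \<in> res Q j" using ham_res_facts(2,4)[OF assms(1)] assms(2) by blast+
  have "AE E in lebesgue_on (sigma0 Q). four Q j (ham_res Q j u) E = complex_of_real E * four Q j u E"
    using four_spectral[OF assms(1)] assms(2) u unfolding spectral_rep_def by blast
  thus "AE E in lebesgue_on (sigma0 Q). R j (ham_res Q j u) E = complex_of_real E * R j u E"
    using AE_four_rep[OF assms(1) u] AE_four_rep[OF assms(1) Hu] by eventually_elim simp
  show "R j (ham_res Q j u) E = complex_of_real E * R j u E" if "E \<notin> sigma0 Q" for E
    using L2_rep.supp[OF rep_res[OF assms(1)] u that] L2_rep.supp[OF rep_res[OF assms(1)] Hu that] by simp
qed

text \<open>Surjectivity of the representation provides the vector and injectivity makes it unique,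
  so the description in \<open>spectral_fun\<close> denotes multiplication by
  \<open>h\<close>.\<close>

lemma spectral_fun_eq:
  assumes j: "j \<in> J" and u: "u \<in> res Q j" and h: "h \<in> borel_measurable borel" "\<And>x. \<bar>h x\<bar> \<le> 1"
  shows "spectral_fun (res Q j) (sigma0 Q) (four Q j) h u \<in> res Q j"
    "AE E in lborel. R j (spectral_fun (res Q j) (sigma0 Q) (four Q j) h u) E = complex_of_real (h E) * R j u E"
proof -
  interpret L2_rep "res Q j" "sigma0 Q" "R j" by (rule rep_res[OF j])
  note [measurable] = h(1) meas[OF u]
  have "\<exists>v\<in>res Q j. AE E in lborel. R j v E = complex_of_real (h E) * R j u E"
  proof (rule surj)
    show "integrable lborel (\<lambda>E. (cmod (complex_of_real (h E) * R j u E))\<^sup>2)"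
    proof (rule Bochner_Integration.integrable_bound[OF sq[OF u]])
      show "AE E in lborel. norm ((cmod (complex_of_real (h E) * R j u E))\<^sup>2) \<le> norm ((cmod (R j u E))\<^sup>2)"
        using h(2) by (auto intro!: AE_I2 power_mono mult_left_le_one_le simp: norm_mult)
    qed measurable
  qed (use supp[OF u] in auto)
  then obtain v where v: "v \<in> res Q j" "AE E in lborel. R j v E = complex_of_real (h E) * R j u E" by blast
  have char: "(AE E in lebesgue_on (sigma0 Q). four Q j v' E = complex_of_real (h E) * four Q j u E) \<longleftrightarrow>
     (AE E in lborel. R j v' E = complex_of_real (h E) * R j u E)" if v': "v' \<in> res Q j" for v'
  proof
    assume "AE E in lebesgue_on (sigma0 Q). four Q j v' E = complex_of_real (h E) * four Q j u E"
    hence "AE E in lebesgue_on (sigma0 Q). R j v' E = complex_of_real (h E) * R j u E"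
      using AE_four_rep[OF j u] AE_four_rep[OF j v'] by eventually_elim simp
    thus "AE E in lborel. R j v' E = complex_of_real (h E) * R j u E"
      by (rule AE_rep_transfer) (simp add: supp[OF u] supp[OF v'])
  next
    assume "AE E in lborel. R j v' E = complex_of_real (h E) * R j u E"
    hence "AE E in lborel. E \<in> sigma0 Q \<longrightarrow> R j v' E = complex_of_real (h E) * R j u E"
      by eventually_elim simp
    hence "AE E in lebesgue_on (sigma0 Q). R j v' E = complex_of_real (h E) * R j u E"
      by (simp add: AE_lebesgue_on_iff sigma0)
    thus "AE E in lebesgue_on (sigma0 Q). four Q j v' E = complex_of_real (h E) * four Q j u E"
      using AE_four_rep[OF j u] AE_four_rep[OF j v'] by eventually_elim simp
  qed
  have "spectral_fun (res Q j) (sigma0 Q) (four Q j) h u = v"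
    unfolding spectral_fun_def
  proof (rule the_equality)
    show "v \<in> res Q j \<and> (AE E in lebesgue_on (sigma0 Q). four Q j v E = complex_of_real (h E) * four Q j u E)"
      using v char by blast
    fix v' assume "v' \<in> res Q j \<and> (AE E in lebesgue_on (sigma0 Q). four Q j v' E = complex_of_real (h E) * four Q j u E)"
    hence v': "v' \<in> res Q j" "AE E in lborel. R j v' E = complex_of_real (h E) * R j u E" using char by blast+
    show "v' = v" by (rule eqI[OF v'(1) v(1)]) (use v(2) v'(2) in eventually_elim, simp)
  qed
  with v show "spectral_fun (res Q j) (sigma0 Q) (four Q j) h u \<in> res Q j"
    "AE E in lborel. R j (spectral_fun (res Q j) (sigma0 Q) (four Q j) h u) E = complex_of_real (h E) * R j u E" by auto
qed

text \<open>The orbit is guessed in the energy representation, where it is multiplication by a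
  phase, and identified by \<open>generator_unique\<close>. The second moment keeps it in the
  domain; the fourth bounds the first-order Taylor remainder in L2 by a multiple of
  \<open>s\<^sup>2\<close>, whence differentiability.\<close>

lemma free_evolution:
  assumes grp: "unitary_group_of (dom0 Q) (ham0 Q) U" and j: "j \<in> J" and w: "w \<in> res Q j"
    and E2: "integrable lborel (\<lambda>E. E\<^sup>2 * (cmod (R j w E))\<^sup>2)" and E4: "integrable lborel (\<lambda>E. E ^ 4 * (cmod (R j w E))\<^sup>2)"
  shows "U t w \<in> res Q j" "AE E in lborel. R j (U t w) E = iexp (t * E) * R j w E"
proof -
  interpret L2_rep "res Q j" "sigma0 Q" "R j" by (rule rep_res[OF j])
  interpret unitary_group "dom0 Q" "ham0 Q" U by unfold_locales (rule grp)
  note [measurable] = meas[OF w]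
  have "\<exists>z\<in>res Q j. AE E in lborel. R j z E = iexp (t * E) * R j w E" for t
    using sq[OF w] supp[OF w] by (intro surj) (auto simp: norm_mult)
  then obtain z where z: "\<And>t. z t \<in> res Q j" "\<And>t. AE E in lborel. R j (z t) E = iexp (t * E) * R j w E" by metis
  have zdom: "z t \<in> dom_res Q j" for t
  proof -
    note [measurable] = meas[OF z(1)]
    have "integrable lborel (\<lambda>E. E\<^sup>2 * (cmod (R j (z t) E))\<^sup>2) \<longleftrightarrow> integrable lborel (\<lambda>E. E\<^sup>2 * (cmod (R j w E))\<^sup>2)"
    proof (rule integrable_cong_AE)
      show "AE E in lborel. E\<^sup>2 * (cmod (R j (z t) E))\<^sup>2 = E\<^sup>2 * (cmod (R j w E))\<^sup>2"
        using z(2)[of t] by eventually_elim (simp add: norm_mult)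
    qed measurable
    thus ?thesis using dom_res_iff[OF j z(1)] E2 by simp
  qed
  define M where "M = (LBINT E. E ^ 4 * (cmod (R j w E))\<^sup>2)"
  have der: "(z has_vector_derivative \<i> *\<^sub>C ham0 Q (z t)) (at t)" for t
  proof -
    let ?H = "ham_res Q j (z t)"
    have H: "?H \<in> res Q j" "ham0 Q (z t) = ?H" using ham_res_facts(4)[OF j zdom] dom_res_dom0(2)[OF j zdom] by auto
    have bound: "norm (z (t + s) - z t - s *\<^sub>R (\<i> *\<^sub>C ?H)) \<le> s\<^sup>2 * sqrt M" for s
    proof -
      \<comment> \<open>The first-order Taylor polynomial of the orbit at time
        \<open>t\<close>.\<close>
      define v where "v = z t + (complex_of_real s * \<i>) *\<^sub>C ?H"
      have cH: "(complex_of_real s * \<i>) *\<^sub>C ?H \<in> res Q j" using H K unfolding csubspace_iff by blast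
      have v: "v \<in> res Q j" unfolding v_def using z(1) cH K unfolding csubspace_iff by blast
      note [measurable] = meas[OF v] meas[OF z(1)]
      have ae: "AE E in lborel. (cmod (R j (z (t + s)) E - R j v E))\<^sup>2 \<le> s ^ 4 * (E ^ 4 * (cmod (R j w E))\<^sup>2)"
        using z(2)[of t] z(2)[of "t + s"] add[OF z(1)[of t] cH] scale[OF H(1), of "complex_of_real s * \<i>"] rep_ham_res[OF j zdom[of t]]
      proof eventually_elim
        case (elim E)
        have "R j (z (t + s)) E - R j v E = iexp (t * E) * R j w E * (iexp (s * E) - (\<Sum>k\<le>1. (\<i> * (s * E)) ^ k / fact k))"
          unfolding v_def elim distrib_right[of t s E] iexp_add by (simp add: algebra_simps)
        hence "cmod (R j (z (t + s)) E - R j v E) = cmod (R j w E) * cmod (iexp (s * E) - (\<Sum>k\<le>1. (\<i> * (s * E)) ^ k / fact k))"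
          by (simp add: norm_mult)
        also have "\<dots> \<le> cmod (R j w E) * (\<bar>s * E\<bar> ^ Suc 1 / fact (Suc 1))"
          by (intro mult_left_mono iexp_approx1) simp
        also have "\<dots> \<le> cmod (R j w E) * (s * E)\<^sup>2"
          by (intro mult_left_mono) (auto simp: power2_eq_square[symmetric] numeral_2_eq_2[symmetric])
        finally have "(cmod (R j (z (t + s)) E - R j v E))\<^sup>2 \<le> (cmod (R j w E) * (s * E)\<^sup>2)\<^sup>2"
          by (intro power_mono) auto
        thus ?case by (simp add: power_mult_distrib mult_ac)
      qed
      have "(norm (z (t + s) - v))\<^sup>2 = (LBINT E. (cmod (R j (z (t + s)) E - R j v E))\<^sup>2)"
        by (rule norm_diff_eq[OF z(1) v])
      also have "\<dots> \<le> (LBINT E. s ^ 4 * (E ^ 4 * (cmod (R j w E))\<^sup>2))"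
      proof (rule integral_mono_AE[OF _ _ ae])
        show i: "integrable lborel (\<lambda>E. s ^ 4 * (E ^ 4 * (cmod (R j w E))\<^sup>2))" using E4 by simp
        show "integrable lborel (\<lambda>E. (cmod (R j (z (t + s)) E - R j v E))\<^sup>2)"
          by (rule Bochner_Integration.integrable_bound[OF i]) (measurable, use ae in auto)
      qed
      also have "\<dots> = s ^ 4 * M" by (simp add: M_def)
      finally have "norm (z (t + s) - v) \<le> sqrt (s ^ 4 * M)" by (rule real_le_rsqrt)
      also have "s ^ 4 * M = (s\<^sup>2)\<^sup>2 * M" by simp
      also have "sqrt ((s\<^sup>2)\<^sup>2 * M) = s\<^sup>2 * sqrt M" unfolding real_sqrt_mult real_sqrt_abs by simp
      also have "z (t + s) - v = z (t + s) - z t - s *\<^sub>R (\<i> *\<^sub>C ?H)"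
        unfolding v_def scaleC_scaleC[symmetric] scaleC_of_real by simp
      finally show ?thesis .
    qed
    have "(\<lambda>s. norm (z (t + s) - z t - s *\<^sub>R (\<i> *\<^sub>C ?H)) / norm s) \<midarrow>0\<rightarrow> 0"
    proof (rule Lim_null_comparison)
      show "\<forall>\<^sub>F s in at 0. norm (norm (z (t + s) - z t - s *\<^sub>R (\<i> *\<^sub>C ?H)) / norm s) \<le> \<bar>s\<bar> * sqrt M"
      proof (intro eventually_at_filter[THEN iffD2] always_eventually allI impI)
        fix s :: real assume "s \<noteq> 0"
        hence "norm (z (t + s) - z t - s *\<^sub>R (\<i> *\<^sub>C ?H)) / norm s \<le> (s\<^sup>2 * sqrt M) / \<bar>s\<bar>"
          using bound[of s] by (simp add: divide_right_mono)
        also have "\<dots> = \<bar>s\<bar> * sqrt M" using \<open>s \<noteq> 0\<close> by (simp add: power2_eq_square abs_if)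
        finally show "norm (norm (z (t + s) - z t - s *\<^sub>R (\<i> *\<^sub>C ?H)) / norm s) \<le> \<bar>s\<bar> * sqrt M" by simp
      qed
      have "(\<lambda>s. \<bar>s\<bar> * sqrt M) \<midarrow>0\<rightarrow> \<bar>0\<bar> * sqrt M" by (intro tendsto_intros)
      thus "(\<lambda>s. \<bar>s\<bar> * sqrt M) \<midarrow>0\<rightarrow> 0" by simp
    qed
    thus ?thesis unfolding has_vector_derivative_def has_derivative_at H(2)
      by (simp add: bounded_linear_scaleR_left)
  qed
  have "z t = U t (z 0)" for t
    by (rule generator_unique[OF dom_res_dom0(1)[OF j zdom] der])
  moreover have "z 0 = w" by (rule eqI[OF z(1) w]) (use z(2)[of 0] in auto)
  ultimately have eq: "U t w = z t" by simp
  show "U t w \<in> res Q j" "AE E in lborel. R j (U t w) E = iexp (t * E) * R j w E" unfolding eq by (rule z)+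
qed

end

section \<open>Scattering orbits and the trace formula\<close>

section \<open>Wave operators\<close>

lemma has_vector_derivative_quotient:
  fixes f :: "real \<Rightarrow> 'a::real_normed_vector"
  shows "(f has_vector_derivative D) (at x) \<longleftrightarrow> ((\<lambda>h. (1 / h) *\<^sub>R (f (x + h) - f x)) \<longlongrightarrow> D) (at 0)"
proof -
  have "(f has_vector_derivative D) (at x) \<longleftrightarrow> ((\<lambda>h. norm (f (x + h) - f x - h *\<^sub>R D) / norm h) \<longlongrightarrow> 0) (at 0)"
    unfolding has_vector_derivative_def has_derivative_at by (simp add: bounded_linear_scaleR_left)
  also have "\<dots> \<longleftrightarrow> ((\<lambda>h. norm ((1 / h) *\<^sub>R (f (x + h) - f x) - D)) \<longlongrightarrow> 0) (at 0)"
  proof (rule tendsto_cong, unfold eventually_at_filter, intro always_eventually allI impI)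
    fix h :: real assume h: "h \<noteq> 0"
    hence "(1 / h) *\<^sub>R (f (x + h) - f x) - D = (1 / h) *\<^sub>R (f (x + h) - f x - h *\<^sub>R D)"
      by (simp add: scaleR_diff_right)
    thus "norm (f (x + h) - f x - h *\<^sub>R D) / norm h = norm ((1 / h) *\<^sub>R (f (x + h) - f x) - D)"
      by simp
  qed
  also have "\<dots> \<longleftrightarrow> ((\<lambda>h. (1 / h) *\<^sub>R (f (x + h) - f x)) \<longlongrightarrow> D) (at 0)"
    by (simp add: tendsto_norm_zero_iff LIM_zero_iff)
  finally show ?thesis .
qed

text \<open>The product rule fails to apply because \<open>A\<close> may be unbounded and
  \<open>A (u t)\<close> need not be differentiable. Symmetry moves \<open>A\<close> off the
  increment of \<open>u\<close> in one of the two terms, after which continuity of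
  \<open>A (u t)\<close> suffices.\<close>

lemma has_vector_derivative_quadratic_form:
  fixes u :: "real \<Rightarrow> 'h::chilbert_space" and A :: "'h \<Rightarrow> 'h"
  assumes u: "(u has_vector_derivative u') (at t)"
    and sym: "\<And>s. cinner (u t) (A (u s)) = cinner (A (u t)) (u s)"
    and cont: "continuous_on UNIV (\<lambda>t. A (u t))"
  shows "((\<lambda>t. cinner (u t) (A (u t))) has_vector_derivative cinner u' (A (u t)) + cinner (A (u t)) u') (at t)"
  unfolding has_vector_derivative_quotient
proof -
  have q: "((\<lambda>h. (1 / h) *\<^sub>R (u (t + h) - u t)) \<longlongrightarrow> u') (at 0)"
    using u unfolding has_vector_derivative_quotient .
  have "((\<lambda>h. A (u (t + h))) \<longlongrightarrow> A (u (t + 0))) (at 0)"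
  proof -
    have "isCont (\<lambda>h. A (u (t + h))) 0"
      using cont continuous_on_compose2[of UNIV "\<lambda>t. A (u t)" UNIV "\<lambda>h. t + h"]
      by (auto simp: continuous_on_eq_continuous_at continuous_intros)
    thus ?thesis by (simp add: isCont_def)
  qed
  hence a: "((\<lambda>h. A (u (t + h))) \<longlongrightarrow> A (u t)) (at 0)" by simp
  have "((\<lambda>h. cinner ((1 / h) *\<^sub>R (u (t + h) - u t)) (A (u (t + h))) + cinner (A (u t)) ((1 / h) *\<^sub>R (u (t + h) - u t)))
      \<longlongrightarrow> cinner u' (A (u t)) + cinner (A (u t)) u') (at 0)"
    by (intro tendsto_add cinner.tendsto q a tendsto_const)
  also have "(\<lambda>h. cinner ((1 / h) *\<^sub>R (u (t + h) - u t)) (A (u (t + h))) + cinner (A (u t)) ((1 / h) *\<^sub>R (u (t + h) - u t)))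
      = (\<lambda>h. (1 / h) *\<^sub>R (cinner (u (t + h)) (A (u (t + h))) - cinner (u t) (A (u t))))"
    unfolding cinner_scaleR_left cinner_scaleR_right scaleR_add_right[symmetric] cinner.diff_left cinner.diff_right
    by (simp add: sym)
  finally show "((\<lambda>h. (1 / h) *\<^sub>R (cinner (u (t + h)) (A (u (t + h))) - cinner (u t) (A (u t))))
      \<longlongrightarrow> cinner u' (A (u t)) + cinner (A (u t)) u') (at 0)" .
qed

text \<open>The second moment places \<open>w\<close> in the domain of H_j; the fourth is the one
  demanded by \<open>free_evolution\<close>.\<close>

definition (in decoupled_system) nice :: "nat \<Rightarrow> 'h \<Rightarrow> bool" where
  "nice j w \<longleftrightarrow> w \<in> res Q j \<and> integrable lborel (\<lambda>E. E\<^sup>2 * (cmod (R j w E))\<^sup>2) \<and>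
     integrable lborel (\<lambda>E. E ^ 4 * (cmod (R j w E))\<^sup>2)"

context scattering_system
begin

sublocale G0: unitary_group "dom0 Q" "ham0 Q" "propag0 Q"
  by unfold_locales (rule propag0)

sublocale G: unitary_group "dom0 Q" "ham Q" "propag Q"
  by unfold_locales (rule propag)

abbreviation "wave \<equiv> moller Q"
abbreviation "wave_adj b \<equiv> cadjoint (wave b)"

lemma branch_time_neq_bot: "branch_time b \<noteq> bot"
  by (cases b) auto

text \<open>On \<open>dom0 Q\<close> the projected orbit solves the same evolution equation, since
  the projection commutes with \<open>ham0 Q\<close>; uniqueness and density do the rest.\<close>

lemma propag0_proj_res:
  assumes j: "j \<in> J"
  shows "proj_res Q j (propag0 Q t u) = propag0 Q t (proj_res Q j u)"
proof (rule continuous_eq_on_dom0[of "\<lambda>u. proj_res Q j (propag0 Q t u)" "\<lambda>u. propag0 Q t (proj_res Q j u)"])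
  have *: "continuous_on UNIV (proj_res Q j)" "continuous_on UNIV (propag0 Q t)"
    by (rule linear_continuous_on, rule proj_res_linear[OF j] G0.U_linear)+
  show "continuous_on UNIV (\<lambda>u. proj_res Q j (propag0 Q t u))" "continuous_on UNIV (\<lambda>u. propag0 Q t (proj_res Q j u))"
    using continuous_on_compose2[OF *(1) *(2)] continuous_on_compose2[OF *(2) *(1)] by auto
  fix u assume u: "u \<in> dom0 Q"
  have "((\<lambda>t. proj_res Q j (propag0 Q t u)) has_vector_derivative \<i> *\<^sub>C ham0 Q (proj_res Q j (propag0 Q t u))) (at t)" for t
    using bounded_linear.has_vector_derivative[OF proj_res_linear(1)[OF j] G0.U_derivative[OF u, of t]]
    by (simp add: proj_res_linear[OF j] ham0_proj_res[OF G0.U_domain(1)[OF u] j])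
  from G0.generator_unique[OF ham0_proj_res(1)[OF G0.U_domain(1)[OF u] j] this]
  show "proj_res Q j (propag0 Q t u) = propag0 Q t (proj_res Q j u)" by simp
qed

lemma propag0_proj0: "proj0 Q (propag0 Q t u) = propag0 Q t (proj0 Q u)"
  unfolding proj0_def by (simp add: propag0_proj_res G0.U_linear)

lemma wave_proj0: "wave b (proj0 Q u) = wave b u"
  using tendsto_unique[OF branch_time_neq_bot moller_limit[of "proj0 Q u" b]] moller_limit[of u b]
  by (simp add: proj0_idem)

lemma norm_wave: "norm (wave b u) = norm (proj0 Q u)"
  using moller_isometric[of "proj0 Q u" b] by (simp add: wave_proj0)

lemma wave_clinear: "bounded_clinear (wave b)"
proof -
  have add: "wave b (u + v) = wave b u + wave b v" for u v
    using tendsto_unique[OF branch_time_neq_bot moller_limit[of "u + v" b]]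
      tendsto_add[OF moller_limit[of u b] moller_limit[of v b]]
    by (simp add: proj0_linear G0.U_linear G.U_linear)
  have sc: "wave b (c *\<^sub>C u) = c *\<^sub>C wave b u" for c u
    using tendsto_unique[OF branch_time_neq_bot moller_limit[of "c *\<^sub>C u" b]]
      bounded_linear.tendsto[OF bounded_linear_scaleC moller_limit[of u b], of c]
    by (simp add: proj0_linear G0.U_linear G.U_linear)
  have "bounded_linear (wave b)"
  proof
    show "wave b (r *\<^sub>R u) = r *\<^sub>R wave b u" for r u
      using sc[of "complex_of_real r" u] by (simp add: scaleC_of_real)
    show "\<exists>C. \<forall>u. norm (wave b u) \<le> norm u * C"
      using norm_proj0_le by (intro exI[of _ 1]) (simp add: norm_wave)
  qed (rule add)
  thus ?thesis unfolding bounded_clinear_def using sc by blast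
qed

lemmas wave_linear = bounded_clinearD[OF wave_clinear]
lemmas cinner_wave = cinner_cadjoint[OF wave_clinear]

lemma cinner_wave_wave: "cinner (wave b u) (wave b v) = cinner (proj0 Q u) (proj0 Q v)"
proof -
  have "cinner (wave b (proj0 Q u)) (wave b (proj0 Q v)) = cinner (proj0 Q u) (proj0 Q v)"
    by (rule cinner_isometry[OF _ _ _ csubspace_range_proj0]) (auto simp: wave_linear moller_isometric)
  thus ?thesis by (simp add: wave_proj0)
qed

lemma wave_adj_wave: "wave_adj b (wave b u) = proj0 Q u"
proof (rule cinner_ext)
  fix y
  have "cinner y (wave_adj b (wave b u)) = cinner (proj0 Q y) (proj0 Q u)"
    using cinner_wave[of b y "wave b u"] by (simp add: cinner_wave_wave)
  thus "cinner y (wave_adj b (wave b u)) = cinner y (proj0 Q u)" by (simp add: proj0_symmetric proj0_idem)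
qed

lemma filterlim_branch_time_shift: "filterlim (\<lambda>t. s + t) (branch_time b) (branch_time b)"
proof (cases b)
  case Plus
  have "filterlim (\<lambda>t. t + s) at_bot at_bot"
    unfolding filterlim_at_bot eventually_at_bot_linorder by (metis le_diff_eq)
  thus ?thesis using Plus by (simp add: add.commute)
next
  case Minus
  thus ?thesis by (simp add: filterlim_tendsto_add_at_top[OF tendsto_const filterlim_ident])
qed

text \<open>The intertwining relation: replacing \<open>t\<close> by \<open>s + t\<close> in the
  defining limit splits off \<open>propag Q s\<close>.\<close>

lemma wave_propag: "wave b (propag0 Q s u) = propag Q s (wave b u)"
proof (rule tendsto_unique[OF branch_time_neq_bot])
  have "((\<lambda>t. propag Q (s + t) (propag0 Q (- (s + t)) (proj0 Q (propag0 Q s u)))) \<longlongrightarrow> wave b (propag0 Q s u)) (branch_time b)"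
    by (rule filterlim_compose[OF moller_limit filterlim_branch_time_shift])
  also have "(\<lambda>t. propag Q (s + t) (propag0 Q (- (s + t)) (proj0 Q (propag0 Q s u))))
      = (\<lambda>t. propag Q s (propag Q t (propag0 Q (- t) (proj0 Q u))))"
    unfolding propag0_proj0 G0.U_add[symmetric] by (simp add: G.U_add)
  finally show "((\<lambda>t. propag Q s (propag Q t (propag0 Q (- t) (proj0 Q u)))) \<longlongrightarrow> wave b (propag0 Q s u)) (branch_time b)" .
  show "((\<lambda>t. propag Q s (propag Q t (propag0 Q (- t) (proj0 Q u)))) \<longlongrightarrow> propag Q s (wave b u)) (branch_time b)"
    by (rule bounded_linear.tendsto[OF G.U_linear(1) moller_limit])
qed

text \<open>The intertwining relation differentiated at time 0; a differentiable orbit already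
  places \<open>wave b u\<close> in the domain.\<close>

lemma wave_generator:
  assumes "u \<in> dom0 Q"
  shows "wave b u \<in> dom0 Q" "ham Q (wave b u) = wave b (ham0 Q u)"
proof -
  have "((\<lambda>t. propag0 Q t u) has_vector_derivative \<i> *\<^sub>C ham0 Q u) (at 0)"
    using G0.U_generator assms by blast
  from bounded_linear.has_vector_derivative[OF wave_linear(1) this, of b]
  have "((\<lambda>t. propag Q t (wave b u)) has_vector_derivative \<i> *\<^sub>C wave b (ham0 Q u)) (at 0)"
    by (simp add: wave_propag wave_linear)
  hence *: "wave b u \<in> dom0 Q" "\<i> *\<^sub>C wave b (ham0 Q u) = \<i> *\<^sub>C ham Q (wave b u)" using G.U_generator by blast+
  show "wave b u \<in> dom0 Q" by fact
  have "(-\<i>) *\<^sub>C (\<i> *\<^sub>C wave b (ham0 Q u)) = (-\<i>) *\<^sub>C (\<i> *\<^sub>C ham Q (wave b u))" using * by simp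
  thus "ham Q (wave b u) = wave b (ham0 Q u)" unfolding scaleC_scaleC using scaleC_of_real[of 1] by simp
qed

text \<open>Applying the isometry \<open>propag Q t\<close> turns the difference into the one in the
  defining limit of the wave operator.\<close>

lemma wave_asymptotics: "((\<lambda>t. propag Q (- t) (wave b u) - propag0 Q (- t) (proj0 Q u)) \<longlongrightarrow> 0) (branch_time b)"
proof (rule tendsto_norm_zero_cancel)
  have "norm (propag Q (- t) (wave b u) - propag0 Q (- t) (proj0 Q u)) = norm (wave b u - propag Q t (propag0 Q (- t) (proj0 Q u)))" for t
    using G.norm_U[of t "propag Q (- t) (wave b u) - propag0 Q (- t) (proj0 Q u)"] by (simp add: G.U_linear)
  moreover have "((\<lambda>t. norm (wave b u - propag Q t (propag0 Q (- t) (proj0 Q u)))) \<longlongrightarrow> norm (wave b u - wave b u)) (branch_time b)"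
    by (intro tendsto_norm tendsto_diff tendsto_const moller_limit)
  ultimately show "((\<lambda>t. norm (propag Q (- t) (wave b u) - propag0 Q (- t) (proj0 Q u))) \<longlongrightarrow> 0) (branch_time b)" by simp
qed

text \<open>Completeness enters here: both wave operators have the absolutely continuous subspace as
  range, so the state launched by \<open>w\<close> in the past is also the one that
  \<open>scattering_op Q w\<close> describes in the future.\<close>

lemma scattering_op_wave:
  shows "wave Minus (scattering_op Q w) = wave Plus w" "proj0 Q (scattering_op Q w) = scattering_op Q w"
proof -
  have "wave Plus w \<in> ac_subspace (propag Q)"
    using moller_range[of Plus] wave_proj0[of Plus w] by (metis image_eqI rangeI)
  then obtain r where r: "wave Plus w = wave Minus r" "r \<in> range (proj0 Q)" using moller_range[of Minus] by auto
  have "scattering_op Q w = r" unfolding scattering_op_def r(1) wave_adj_wave using r(2) by (simp add: range_proj0_iff)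
  thus "wave Minus (scattering_op Q w) = wave Plus w" "proj0 Q (scattering_op Q w) = scattering_op Q w"
    using r unfolding range_proj0_iff by auto
qed

lemma nice_res: "nice j w \<Longrightarrow> w \<in> res Q j"
  unfolding nice_def by blast

lemma nice_evolution:
  assumes "j \<in> J" "nice j w"
  shows "propag0 Q t w \<in> res Q j" "AE E in lborel. R j (propag0 Q t w) E = iexp (t * E) * R j w E"
  using free_evolution[OF propag0 assms(1)] assms(2) unfolding nice_def by blast+

lemma nice_dom:
  assumes "j \<in> J" "nice j w"
  shows "w \<in> dom_res Q j" "w \<in> dom0 Q"
  using dom_res_iff[OF assms(1), of w] dom_res_dom0(1)[OF assms(1), of w] assms(2) unfolding nice_def by blast+

text \<open>Free evolution is a phase in the energy representation and stays inside
  \<open>res Q j\<close>, so pairing with any \<open>b\<close> gives a Fourier integral in the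
  energy.\<close>

lemma Fourier_coefficient:
  assumes j: "j \<in> J" and w: "nice j w"
  shows "cinner b (propag0 Q (- t) w) = (LBINT E. iexp (- t * E) * (cnj (R j (proj_res Q j b) E) * R j w E))"
proof -
  interpret L2_rep "res Q j" "sigma0 Q" "R j" by (rule rep_res[OF j])
  note ev = nice_evolution[OF j w, of "- t"]
  note [measurable] = meas[OF ev(1)] meas[OF proj_res_in[OF j, of b]] meas[OF nice_res[OF w]]
  have "cinner b (propag0 Q (- t) w) = cinner (proj_res Q j b) (propag0 Q (- t) w)"
    using proj_res_symmetric[OF j, of b "propag0 Q (- t) w"] proj_res_res[OF j j ev(1)] by simp
  also have "\<dots> = (LBINT E. cnj (R j (proj_res Q j b) E) * R j (propag0 Q (- t) w) E)"
    by (rule cinner_eq[OF proj_res_in[OF j] ev(1)])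
  also have "\<dots> = (LBINT E. iexp (- t * E) * (cnj (R j (proj_res Q j b) E) * R j w E))"
  proof (rule integral_cong_AE)
    show "AE E in lborel. cnj (R j (proj_res Q j b) E) * R j (propag0 Q (- t) w) E =
        iexp (- t * E) * (cnj (R j (proj_res Q j b) E) * R j w E)"
      using ev(2) by eventually_elim (simp only: mult_ac)
  qed measurable
  finally show ?thesis .
qed

text \<open>Riemann-Lebesgue in the energy variable; \<open>at_infinity\<close> covers both time
  directions.\<close>

lemma weak_decay:
  assumes j: "j \<in> J" and w: "nice j w"
  shows "((\<lambda>t. cinner b (propag0 Q (- t) w)) \<longlongrightarrow> 0) at_infinity"
proof -
  interpret L2_rep "res Q j" "sigma0 Q" "R j" by (rule rep_res[OF j])
  have "filterlim (\<lambda>t::real. - t) at_infinity at_infinity"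
    using filterlim_ident[of "at_infinity :: real filter"]
    by (simp only: filterlim_at_infinity_conv_norm_at_top norm_minus_cancel)
  from filterlim_compose[OF Riemann_Lebesgue[OF integrable_cnj_mult[OF proj_res_in[OF j, of b] nice_res[OF w]]] this]
  show ?thesis unfolding Fourier_coefficient[OF j w] .
qed

lemma coupling_clinear: "bounded_clinear (coupling Q)"
  using coupling_finite_rank unfolding finite_rank_def by blast

lemmas coupling_linear = bounded_clinearD[OF coupling_clinear]

text \<open>Intertwining transfers weak decay from the free orbit to the interacting one, and the
  finite rank of the coupling makes it decay in norm.\<close>

lemma coupling_decay:
  assumes j: "j \<in> J" and w: "nice j w"
  shows "((\<lambda>t. coupling Q (propag Q (- t) (wave b w))) \<longlongrightarrow> 0) at_infinity"
proof -
  obtain F where F: "finite F" "\<And>u. coupling Q u = (\<Sum>e\<in>F. cinner e (coupling Q u) *\<^sub>C e)"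
    using finite_rank_expansion[OF coupling_finite_rank] by blast
  have c: "cinner e (coupling Q (propag Q (- t) (wave b w))) = cinner (wave_adj b (coupling Q e)) (propag0 Q (- t) w)" for e t
  proof -
    have "cinner e (coupling Q (propag Q (- t) (wave b w))) = cinner (coupling Q e) (wave b (propag0 Q (- t) w))"
      by (simp add: coupling_symmetric wave_propag)
    also have "\<dots> = cinner (wave_adj b (coupling Q e)) (propag0 Q (- t) w)"
      using cinner_wave[of b "propag0 Q (- t) w" "coupling Q e"] by (metis cinner_commute)
    finally show ?thesis .
  qed
  have "((\<lambda>t. \<Sum>e\<in>F. cinner e (coupling Q (propag Q (- t) (wave b w))) *\<^sub>C e) \<longlongrightarrow> (\<Sum>e\<in>F. 0)) at_infinity"
  proof (intro tendsto_sum)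
    fix e
    have "((\<lambda>t. norm (cinner (wave_adj b (coupling Q e)) (propag0 Q (- t) w)) * norm e) \<longlongrightarrow> norm (0::complex) * norm e) at_infinity"
      by (intro tendsto_mult tendsto_norm tendsto_const weak_decay[OF j w])
    hence "((\<lambda>t. norm (cinner (wave_adj b (coupling Q e)) (propag0 Q (- t) w) *\<^sub>C e)) \<longlongrightarrow> 0) at_infinity"
      by (simp add: norm_scaleC)
    thus "((\<lambda>t. cinner e (coupling Q (propag Q (- t) (wave b w))) *\<^sub>C e) \<longlongrightarrow> 0) at_infinity"
      unfolding c by (rule tendsto_norm_zero_cancel)
  qed
  thus ?thesis using F(2) by simp
qed

section \<open>Currents as increments along scattering trajectories\<close>

lemma scattering_trajectory:
  assumes "w \<in> dom0 Q" and u: "\<And>t. u t = propag Q (- t) (wave Plus w)"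
  shows "u t \<in> dom0 Q" "(u has_vector_derivative - (\<i> *\<^sub>C ham Q (u t))) (at t)" "continuous_on UNIV u"
    "ham Q (u t) = propag Q (- t) (wave Plus (ham0 Q w))"
proof -
  note w = wave_generator[OF assms(1), of Plus]
  show "u t \<in> dom0 Q" unfolding u by (rule G.U_domain(1)[OF w(1)])
  show "ham Q (u t) = propag Q (- t) (wave Plus (ham0 Q w))" unfolding u by (simp add: G.U_domain(2)[OF w(1)] w(2))
  have "((\<lambda>t::real. - t) has_vector_derivative - 1) (at t)" for t by (auto intro!: derivative_eq_intros)
  from vector_diff_chain_at[OF this G.U_derivative[OF w(1)]]
  show *: "(u has_vector_derivative - (\<i> *\<^sub>C ham Q (u t))) (at t)" for t
    unfolding u[abs_def] by (simp add: o_def)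
  have "isCont u t" for t by (rule has_vector_derivative_continuous[OF *])
  thus "continuous_on UNIV u" by (simp add: continuous_on_eq_continuous_at)
qed

text \<open>The orbit is the image under \<open>wave Plus\<close> of a free one, so its pairings
  with \<open>e\<close> and with \<open>- C e\<close> are Fourier integrals, of \<open>g\<close> and
  \<open>h\<close> below. As products of two L2 functions these are a priori only integrable; the
  bound on \<open>R j w\<close> makes them square integrable, as Plancherel requires.\<close>

lemma current_increment:
  assumes j: "j \<in> J" and w: "nice j w" and bd: "AE E in lborel. cmod (R j w E) \<le> 1"
    and C: "is_commutator (dom0 Q) (coupling Q) A C"
    and F: "finite F" "\<And>u. C u = (\<Sum>e\<in>F. cinner e (C u) *\<^sub>C e)"
    and sym: "\<And>x y. x \<in> dom0 Q \<Longrightarrow> y \<in> dom0 Q \<Longrightarrow> cinner x (A y) = cinner (A x) y"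
    and comm: "\<And>x. x \<in> dom0 Q \<Longrightarrow> cinner (ham0 Q x) (A x) = cinner (A x) (ham0 Q x)"
    and u: "\<And>t. u t = propag Q (- t) (wave Plus w)"
    and cont: "continuous_on UNIV (\<lambda>t. A (u t))" and bA: "\<And>t. norm (A (u t)) \<le> B"
    and lim: "((\<lambda>t. cinner (u t) (A (u t))) \<longlongrightarrow> Lp) at_top" "((\<lambda>t. cinner (u t) (A (u t))) \<longlongrightarrow> Lm) at_bot"
  shows "Lp - Lm = 2 * pi * \<i> * (\<Sum>e\<in>F. LBINT E. cnj (R j (proj_res Q j (wave_adj Plus (- C e))) E) * R j w E *
      (cnj (R j w E) * R j (proj_res Q j (wave_adj Plus e)) E))"
proof -
  interpret L2_rep "res Q j" "sigma0 Q" "R j" by (rule rep_res[OF j])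
  note traj = scattering_trajectory[OF nice_dom(2)[OF j w] u]
  have Cb: "bounded_linear C" using C unfolding is_commutator_def by (blast dest: bounded_clinearD(1))
  define a where "a e = proj_res Q j (wave_adj Plus e)" for e
  define b where "b e = proj_res Q j (wave_adj Plus (- C e))" for e
  have ab: "a e \<in> res Q j" "b e \<in> res Q j" for e unfolding a_def b_def by (intro proj_res_in j)+
  \<comment> \<open>The factor removes the i produced by the Schroedinger equation, so that the
    derivative is exactly \<open>\<Psi>'\<close>.\<close>
  define \<Psi> where "\<Psi> t = - \<i> * cinner (u t) (A (u t))" for t
  define \<Psi>' where "\<Psi>' t = cinner (u t) (C (u t))" for t
  define g where "g e E = cnj (R j w E) * R j (a e) E" for e E
  define h where "h e E = cnj (R j (b e) E) * R j w E" for e E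
  note [measurable] = meas[OF ab(1)] meas[OF ab(2)] meas[OF nice_res[OF w]]
  have sqint: "integrable lborel (\<lambda>E. (cmod (f E * R j v E))\<^sup>2)" if "v \<in> res Q j" "f \<in> borel_measurable borel" "AE E in lborel. cmod (f E) \<le> 1" for f v
  proof (rule Bochner_Integration.integrable_bound[OF sq[OF that(1)]])
    note [measurable] = meas[OF that(1)] that(2)
    show "(\<lambda>E. (cmod (f E * R j v E))\<^sup>2) \<in> borel_measurable lborel" by measurable
    show "AE E in lborel. norm ((cmod (f E * R j v E))\<^sup>2) \<le> norm ((cmod (R j v E))\<^sup>2)"
      using that(3) by eventually_elim (auto intro!: power_mono mult_left_le_one_le simp: norm_mult)
  qed
  have wm: "R j w \<in> borel_measurable borel" and cwm: "(\<lambda>E. cnj (R j w E)) \<in> borel_measurable borel" by measurable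
  have eC: "cinner e (u t) = (LBINT E. iexp (- t * E) * (cnj (R j (a e) E) * R j w E))" for e t
  proof -
    have "cinner e (u t) = cinner (wave_adj Plus e) (propag0 Q (- t) w)"
      unfolding u using cinner_wave[of Plus "propag0 Q (- t) w" e] by (metis cinner_commute wave_propag)
    thus ?thesis unfolding Fourier_coefficient[OF j w] a_def .
  qed
  have g_coeff: "cinner (u t) e = (LBINT E. iexp (t * E) * g e E)" for e t
  proof -
    have "cinner (u t) e = cnj (cinner e (u t))" by (rule cinner_commute)
    also have "\<dots> = (LBINT E. cnj (iexp (- t * E) * (cnj (R j (a e) E) * R j w E)))"
      unfolding eC by (rule Bochner_Integration.integral_cnj[symmetric])
    also have "\<dots> = (LBINT E. iexp (t * E) * g e E)"
      unfolding g_def by (intro Bochner_Integration.integral_cong refl) (simp add: exp_cnj)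
    finally show ?thesis .
  qed
  have h_coeff: "cinner e (C (u t)) = (LBINT E. iexp (- t * E) * h e E)" for e t
  proof -
    have "cinner e (C (u t)) = cinner (- C e) (u t)"
      using commutator_antisymmetric[OF C, of e "u t"] by (simp add: cinner.minus_left)
    also have "\<dots> = cinner (wave_adj Plus (- C e)) (propag0 Q (- t) w)"
      unfolding u using cinner_wave[of Plus "propag0 Q (- t) w" "- C e"] by (metis cinner_commute wave_propag)
    finally show ?thesis unfolding Fourier_coefficient[OF j w] h_def b_def .
  qed
  have "- \<i> * Lp - - \<i> * Lm = 2 * pi * (\<Sum>e\<in>F. LBINT E. h e E * g e E)"
  proof (rule Plancherel_increment[where \<Phi> = \<Psi> and \<Phi>' = \<Psi>' and B = "norm (wave Plus w) * B"])
    show "integrable lborel (g e)" "integrable lborel (h e)" for e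
      unfolding g_def[abs_def] h_def[abs_def] by (intro integrable_cnj_mult ab nice_res[OF w])+
    show "integrable lborel (\<lambda>E. (cmod (g e E))\<^sup>2)" for e
      unfolding g_def using bd by (intro sqint ab cwm) simp
    show "integrable lborel (\<lambda>E. (cmod (h e E))\<^sup>2)" for e
      using sqint[OF ab(2)[of e] wm bd] unfolding h_def norm_mult by (simp add: mult.commute)
    show "(\<Psi> has_vector_derivative \<Psi>' t) (at t)" for t
    proof -
      have "((\<lambda>t. cinner (u t) (A (u t))) has_vector_derivative
          cinner (- (\<i> *\<^sub>C ham Q (u t))) (A (u t)) + cinner (A (u t)) (- (\<i> *\<^sub>C ham Q (u t)))) (at t)"
        by (rule has_vector_derivative_quadratic_form[OF traj(2) sym cont]) (rule traj(1))+
      hence "(\<Psi> has_vector_derivative - \<i> * (cinner (- (\<i> *\<^sub>C ham Q (u t))) (A (u t)) + cinner (A (u t)) (- (\<i> *\<^sub>C ham Q (u t))))) (at t)"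
        unfolding \<Psi>_def by (rule bounded_linear.has_vector_derivative[OF bounded_linear_mult_right])
      also have "- \<i> * (cinner (- (\<i> *\<^sub>C ham Q (u t))) (A (u t)) + cinner (A (u t)) (- (\<i> *\<^sub>C ham Q (u t))))
         = cinner (ham Q (u t)) (A (u t)) - cinner (A (u t)) (ham Q (u t))"
        by (simp add: cinner.minus_left cinner.minus_right cinner_scaleC_left cinner_scaleC_right algebra_simps)
      also have "\<dots> = cinner (coupling Q (u t)) (A (u t)) - cinner (A (u t)) (coupling Q (u t))"
        unfolding ham_def cinner.add_left cinner.add_right comm[OF traj(1)] by simp
      also have "\<dots> = \<Psi>' t" using C traj(1) unfolding is_commutator_def \<Psi>'_def by simp
      finally show ?thesis .
    qed
    show "continuous_on UNIV \<Psi>'" unfolding \<Psi>'_def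
      by (intro cinner.continuous_on traj(3) bounded_linear.continuous_on[OF Cb])
    show "\<Psi>' t = (\<Sum>e\<in>F. (LBINT x. iexp (t * x) * g e x) * (LBINT x. iexp (- t * x) * h e x))" for t
    proof -
      have "\<Psi>' t = (\<Sum>e\<in>F. cinner (u t) e * cinner e (C (u t)))"
        unfolding \<Psi>'_def by (subst F(2)) (simp add: cinner.sum_right cinner_scaleC_right mult.commute)
      thus ?thesis unfolding g_coeff h_coeff .
    qed
    show "cmod (\<Psi> t) \<le> norm (wave Plus w) * B" for t
    proof -
      have "cmod (\<Psi> t) \<le> norm (u t) * norm (A (u t))"
        unfolding \<Psi>_def using Cauchy_Schwarz_cinner by (simp add: norm_mult)
      also have "\<dots> \<le> norm (wave Plus w) * B" using bA[of t] by (intro mult_mono) (auto simp: u)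
      finally show ?thesis .
    qed
    show "(\<Psi> \<longlongrightarrow> - \<i> * Lp) at_top" "(\<Psi> \<longlongrightarrow> - \<i> * Lm) at_bot"
      unfolding \<Psi>_def by (intro tendsto_mult tendsto_const lim)+
  qed
  hence "\<i> * (- \<i> * Lp - - \<i> * Lm) = \<i> * (2 * pi * (\<Sum>e\<in>F. LBINT E. h e E * g e E))" by (rule arg_cong)
  thus ?thesis unfolding h_def g_def a_def b_def by (simp add: algebra_simps)
qed

section \<open>The trace formula\<close>

abbreviation
  "fd_fun \<beta> \<mu> j \<equiv> spectral_fun (res Q j) (sigma0 Q) (four Q j) (fermi_dirac (\<beta> j) (\<mu> j))"

lemma fermi_dirac_measurable [measurable]: "fermi_dirac \<beta> \<mu> \<in> borel_measurable borel"
  unfolding fermi_dirac_def[abs_def] by measurable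

lemma fermi_dirac_bounds: "0 < fermi_dirac \<beta> \<mu> x" "fermi_dirac \<beta> \<mu> x \<le> 1" "\<bar>fermi_dirac \<beta> \<mu> x\<bar> \<le> 1"
proof -
  have "0 < 1 + exp (\<beta> * (x - \<mu>))" by (simp add: add_pos_pos)
  thus "0 < fermi_dirac \<beta> \<mu> x" "fermi_dirac \<beta> \<mu> x \<le> 1" "\<bar>fermi_dirac \<beta> \<mu> x\<bar> \<le> 1"
    unfolding fermi_dirac_def by (simp_all add: divide_simps)
qed

lemma fd_fun_facts:
  assumes j: "j \<in> J" and u: "u \<in> res Q j"
  shows "fd_fun \<beta> \<mu> j u \<in> res Q j"
    "AE E in lborel. R j (fd_fun \<beta> \<mu> j u) E = complex_of_real (fermi_dirac (\<beta> j) (\<mu> j) E) * R j u E"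
  using spectral_fun_eq[OF j u fermi_dirac_measurable fermi_dirac_bounds(3)] by blast+

lemma fd_fun_add:
  assumes j: "j \<in> J" and u: "u \<in> res Q j" and v: "v \<in> res Q j"
  shows "fd_fun \<beta> \<mu> j (u + v) = fd_fun \<beta> \<mu> j u + fd_fun \<beta> \<mu> j v"
proof -
  interpret L2_rep "res Q j" "sigma0 Q" "R j" by (rule rep_res[OF j])
  note f = fd_fun_facts[OF j, of _ \<beta> \<mu>]
  have uv: "u + v \<in> res Q j" "fd_fun \<beta> \<mu> j u + fd_fun \<beta> \<mu> j v \<in> res Q j"
    using K u v f(1)[OF u] f(1)[OF v] unfolding csubspace_iff by blast+
  show ?thesis
  proof (rule eqI[OF f(1)[OF uv(1)] uv(2)])
    show "AE E in lborel. R j (fd_fun \<beta> \<mu> j (u + v)) E = R j (fd_fun \<beta> \<mu> j u + fd_fun \<beta> \<mu> j v) E"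
      using f(2)[OF uv(1)] f(2)[OF u] f(2)[OF v] add[OF u v] add[OF f(1)[OF u] f(1)[OF v]]
      by eventually_elim (simp add: distrib_left)
  qed
qed

lemma fd_fun_scale:
  assumes j: "j \<in> J" and u: "u \<in> res Q j"
  shows "fd_fun \<beta> \<mu> j (c *\<^sub>C u) = c *\<^sub>C fd_fun \<beta> \<mu> j u"
proof -
  interpret L2_rep "res Q j" "sigma0 Q" "R j" by (rule rep_res[OF j])
  note f = fd_fun_facts[OF j, of _ \<beta> \<mu>]
  have cu: "c *\<^sub>C u \<in> res Q j" "c *\<^sub>C fd_fun \<beta> \<mu> j u \<in> res Q j"
    using K u f(1)[OF u] unfolding csubspace_iff by blast+
  show ?thesis
  proof (rule eqI[OF f(1)[OF cu(1)] cu(2)])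
    show "AE E in lborel. R j (fd_fun \<beta> \<mu> j (c *\<^sub>C u)) E = R j (c *\<^sub>C fd_fun \<beta> \<mu> j u) E"
      using f(2)[OF cu(1)] f(2)[OF u] scale[OF u, of c] scale[OF f(1)[OF u], of c]
      by eventually_elim simp
  qed
qed

lemma initial_density_linear:
  "initial_density Q \<beta> \<mu> (u + v) = initial_density Q \<beta> \<mu> u + initial_density Q \<beta> \<mu> v"
  "initial_density Q \<beta> \<mu> (c *\<^sub>C u) = c *\<^sub>C initial_density Q \<beta> \<mu> u"
  unfolding initial_density_def
  by (simp_all add: proj_res_linear fd_fun_add fd_fun_scale proj_res_in sum.distrib complex_vector.scale_sum_right)

lemma wave_adj_linear: "wave_adj b (u + v) = wave_adj b u + wave_adj b v" "wave_adj b (c *\<^sub>C u) = c *\<^sub>C wave_adj b u"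
  by (rule cinner_ext, simp add: cinner_wave[symmetric] cinner.add_right cinner_scaleC_right)+

lemma steady_density_linear:
  "steady_density Q \<beta> \<mu> (u + v) = steady_density Q \<beta> \<mu> u + steady_density Q \<beta> \<mu> v"
  "steady_density Q \<beta> \<mu> (c *\<^sub>C u) = c *\<^sub>C steady_density Q \<beta> \<mu> u"
  unfolding steady_density_def by (simp_all add: wave_adj_linear initial_density_linear wave_linear)

lemma steady_density_sum: "finite F \<Longrightarrow> steady_density Q \<beta> \<mu> (\<Sum>e\<in>F. c e *\<^sub>C f e) = (\<Sum>e\<in>F. c e *\<^sub>C steady_density Q \<beta> \<mu> (f e))"
proof (induction F rule: finite_induct)
  case empty
  show ?case using steady_density_linear(2)[of \<beta> \<mu> 0 0] by simp
qed (simp add: steady_density_linear)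

lemma cinner_initial_density:
  "cinner b (initial_density Q \<beta> \<mu> a) = (\<Sum>j=1..nres Q. LBINT E. cnj (R j (proj_res Q j b) E) *
      (complex_of_real (fermi_dirac (\<beta> j) (\<mu> j) E) * R j (proj_res Q j a) E))"
  unfolding initial_density_def cinner.sum_right
proof (intro sum.cong refl)
  fix j assume j: "j \<in> J"
  interpret L2_rep "res Q j" "sigma0 Q" "R j" by (rule rep_res[OF j])
  note f = fd_fun_facts[OF j proj_res_in[OF j, of a], of \<beta> \<mu>]
  note [measurable] = meas[OF f(1)] meas[OF proj_res_in[OF j, of b]] meas[OF proj_res_in[OF j, of a]]
  have "cinner b (fd_fun \<beta> \<mu> j (proj_res Q j a)) = cinner (proj_res Q j b) (fd_fun \<beta> \<mu> j (proj_res Q j a))"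
    using proj_res_symmetric[OF j, of b "fd_fun \<beta> \<mu> j (proj_res Q j a)"] proj_res_res[OF j j f(1)] by simp
  also have "\<dots> = (LBINT E. cnj (R j (proj_res Q j b) E) * R j (fd_fun \<beta> \<mu> j (proj_res Q j a)) E)"
    by (rule cinner_eq[OF proj_res_in[OF j] f(1)])
  also have "\<dots> = (LBINT E. cnj (R j (proj_res Q j b) E) * (complex_of_real (fermi_dirac (\<beta> j) (\<mu> j) E) * R j (proj_res Q j a) E))"
    by (rule integral_cong_AE) (measurable, use f(2) in eventually_elim, simp)
  finally show "cinner b (fd_fun \<beta> \<mu> j (proj_res Q j a)) = (LBINT E. cnj (R j (proj_res Q j b) E) *
      (complex_of_real (fermi_dirac (\<beta> j) (\<mu> j) E) * R j (proj_res Q j a) E))" .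
qed

text \<open>Antisymmetry writes the operator as a sum of rank-one operators |steady_density e><- C
  e|; moving the wave operator to the left of each inner product leaves only the initial
  density.\<close>

lemma trace_steady_density:
  assumes C: "is_commutator (dom0 Q) (coupling Q) A C"
    and F: "finite F" "\<And>u. C u = (\<Sum>e\<in>F. cinner e (C u) *\<^sub>C e)"
  shows "op_trace (\<lambda>u. steady_density Q \<beta> \<mu> (C u)) =
    (\<Sum>e\<in>F. cinner (wave_adj Plus (- C e)) (initial_density Q \<beta> \<mu> (wave_adj Plus e)))"
proof -
  have "steady_density Q \<beta> \<mu> (C u) = (\<Sum>e\<in>F. cinner (- C e) u *\<^sub>C steady_density Q \<beta> \<mu> e)" for u
  proof -
    have "steady_density Q \<beta> \<mu> (C u) = (\<Sum>e\<in>F. cinner e (C u) *\<^sub>C steady_density Q \<beta> \<mu> e)"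
      by (subst F(2)) (rule steady_density_sum[OF F(1)])
    thus ?thesis using commutator_antisymmetric[OF C] by (simp add: cinner.minus_left)
  qed
  hence tr: "op_trace (\<lambda>u. steady_density Q \<beta> \<mu> (C u)) = (\<Sum>e\<in>F. cinner (- C e) (steady_density Q \<beta> \<mu> e))"
    by (rule op_trace_sum_rank_one[OF F(1)])
  have  "cinner (- C e) (steady_density Q \<beta> \<mu> e) = cinner (wave_adj Plus (- C e)) (initial_density Q \<beta> \<mu> (wave_adj Plus e))" for e
    unfolding steady_density_def using cinner_wave[of Plus "initial_density Q \<beta> \<mu> (wave_adj Plus e)" "- C e"]
    by (metis cinner_commute)
  thus ?thesis unfolding tr by (rule sum.cong[OF refl])
qed

text \<open>Formally the square root of f_j(H_j) applied to the constant function 1 on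
  \<open>sigma0 Q\<close>, which need not itself be square integrable.\<close>

definition
  "thermal_vector \<beta> \<mu> j w \<longleftrightarrow> nice j w \<and>
     (AE E in lborel. R j w E = indicator (sigma0 Q) E * complex_of_real (sqrt (fermi_dirac (\<beta> j) (\<mu> j) E)))"

text \<open>\<open>R j (w j)\<close> times its conjugate is the Fermi-Dirac function on
  \<open>sigma0 Q\<close>, so the increment for reservoir j is its term in the spectral form of the
  trace; exchanging the finite sums over reservoirs and over \<open>F\<close> assembles the
  whole.\<close>

theorem trace_increment:
  assumes C: "is_commutator (dom0 Q) (coupling Q) A C" "finite_rank C"
    and w: "\<And>j. j \<in> J \<Longrightarrow> thermal_vector \<beta> \<mu> j (w j)"
    and sym: "\<And>x y. x \<in> dom0 Q \<Longrightarrow> y \<in> dom0 Q \<Longrightarrow> cinner x (A y) = cinner (A x) y"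
    and comm: "\<And>x. x \<in> dom0 Q \<Longrightarrow> cinner (ham0 Q x) (A x) = cinner (A x) (ham0 Q x)"
    and u: "\<And>j t. u j t = propag Q (- t) (wave Plus (w j))"
    and cont: "\<And>j. j \<in> J \<Longrightarrow> continuous_on UNIV (\<lambda>t. A (u j t))" and bA: "\<And>j t. j \<in> J \<Longrightarrow> norm (A (u j t)) \<le> B j"
    and lim: "\<And>j. j \<in> J \<Longrightarrow> ((\<lambda>t. cinner (u j t) (A (u j t))) \<longlongrightarrow> Lp j) at_top"
      "\<And>j. j \<in> J \<Longrightarrow> ((\<lambda>t. cinner (u j t) (A (u j t))) \<longlongrightarrow> Lm j) at_bot"
  shows "(\<Sum>j=1..nres Q. Lp j - Lm j) = 2 * pi * \<i> * op_trace (\<lambda>u. steady_density Q \<beta> \<mu> (C u))"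
proof -
  obtain F where F: "finite F" "\<And>u. C u = (\<Sum>e\<in>F. cinner e (C u) *\<^sub>C e)"
    using finite_rank_expansion[OF C(2)] by blast
  define I where "I j e = (LBINT E. cnj (R j (proj_res Q j (wave_adj Plus (- C e))) E) *
      (complex_of_real (fermi_dirac (\<beta> j) (\<mu> j) E) * R j (proj_res Q j (wave_adj Plus e)) E))" for j e
  have "Lp j - Lm j = 2 * pi * \<i> * (\<Sum>e\<in>F. I j e)" if j: "j \<in> J" for j
  proof -
    interpret L2_rep "res Q j" "sigma0 Q" "R j" by (rule rep_res[OF j])
    have n: "nice j (w j)" and ae: "AE E in lborel. R j (w j) E = indicator (sigma0 Q) E * complex_of_real (sqrt (fermi_dirac (\<beta> j) (\<mu> j) E))"
      using w[OF j] unfolding thermal_vector_def by blast+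
    have bd: "AE E in lborel. cmod (R j (w j) E) \<le> 1"
      using ae by eventually_elim (auto simp: norm_mult indicator_def fermi_dirac_bounds(2) less_imp_le[OF fermi_dirac_bounds(1)])
    have incr: "Lp j - Lm j = 2 * pi * \<i> * (\<Sum>e\<in>F. LBINT E. cnj (R j (proj_res Q j (wave_adj Plus (- C e))) E) * R j (w j) E *
      (cnj (R j (w j) E) * R j (proj_res Q j (wave_adj Plus e)) E))"
      by (rule current_increment[OF j n bd C(1) F sym comm u cont[OF j] bA[OF j] lim[OF j]])
    have "(LBINT E. cnj (R j (proj_res Q j (wave_adj Plus (- C e))) E) * R j (w j) E *
      (cnj (R j (w j) E) * R j (proj_res Q j (wave_adj Plus e)) E)) = I j e" for e
      unfolding I_def
    proof (rule integral_cong_AE)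
      note [measurable] = meas[OF proj_res_in[OF j]] meas[OF nice_res[OF n]]
      show "(\<lambda>E. cnj (R j (proj_res Q j (wave_adj Plus (- C e))) E) * R j (w j) E *
        (cnj (R j (w j) E) * R j (proj_res Q j (wave_adj Plus e)) E)) \<in> borel_measurable lborel"
        "(\<lambda>E. cnj (R j (proj_res Q j (wave_adj Plus (- C e))) E) *
      (complex_of_real (fermi_dirac (\<beta> j) (\<mu> j) E) * R j (proj_res Q j (wave_adj Plus e)) E)) \<in> borel_measurable lborel"
        by measurable
      show "AE E in lborel. cnj (R j (proj_res Q j (wave_adj Plus (- C e))) E) * R j (w j) E *
        (cnj (R j (w j) E) * R j (proj_res Q j (wave_adj Plus e)) E) =
        cnj (R j (proj_res Q j (wave_adj Plus (- C e))) E) *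
        (complex_of_real (fermi_dirac (\<beta> j) (\<mu> j) E) * R j (proj_res Q j (wave_adj Plus e)) E)"
        using ae
      proof eventually_elim
        case (elim E)
        show ?case
        proof (cases "E \<in> sigma0 Q")
          case True
          have "R j (w j) E * cnj (R j (w j) E) = complex_of_real (fermi_dirac (\<beta> j) (\<mu> j) E)"
            unfolding elim using True fermi_dirac_bounds(1)[of "\<beta> j" "\<mu> j" E] by (simp add: of_real_mult[symmetric] del: of_real_mult)
          hence "x * R j (w j) E * (cnj (R j (w j) E) * y) = x * (complex_of_real (fermi_dirac (\<beta> j) (\<mu> j) E) * y)" for x y
            by (metis mult.assoc)
          thus ?thesis .
        next
          case False
          thus ?thesis using supp[OF proj_res_in[OF j]] by simp
        qed
      qed
    qed
    thus ?thesis unfolding incr by simp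
  qed
  hence "(\<Sum>j=1..nres Q. Lp j - Lm j) = 2 * pi * \<i> * (\<Sum>j=1..nres Q. \<Sum>e\<in>F. I j e)"
    by (simp add: sum_distrib_left)
  also have "(\<Sum>j=1..nres Q. \<Sum>e\<in>F. I j e) = op_trace (\<lambda>u. steady_density Q \<beta> \<mu> (C u))"
    unfolding trace_steady_density[OF C(1) F] cinner_initial_density I_def[symmetric] by (rule sum.swap)
  finally show ?thesis .
qed

end

section \<open>Thermal orbits and the Landauer-Buettiker formula\<close>

section \<open>Thermal vectors\<close>

lemma integrable_power_exp:
  assumes "b > 0"
  shows "integrable lborel (\<lambda>E. indicator {0..} E * (E ^ n * exp (- (b * E))) :: real)"
proof -
  have "integrable lborel (\<lambda>x. indicator {0..} x * (x ^ n * exp (- x)) :: real)"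
  proof (rule integrableI_nonneg)
    have "(\<integral>\<^sup>+x. ennreal (indicator {0..} x * (x ^ n * exp (- x))) \<partial>lborel) = (\<integral>\<^sup>+x. ennreal (x ^ n * exp (- x)) * indicator {0..} x \<partial>lborel)"
      by (intro nn_integral_cong) (auto simp: indicator_def)
    also have "\<dots> = real_of_nat (fact n)" by (rule nn_intergal_power_times_exp_Ici)
    also have "\<dots> < \<infinity>" by simp
    finally show "(\<integral>\<^sup>+x. ennreal (indicator {0..} x * (x ^ n * exp (- x))) \<partial>lborel) < \<infinity>" .
  qed (auto simp: indicator_def)
  from integrable_mult_right[OF integrable_scaled[OF this, of b], of "1 / b ^ n"] assms
  have "integrable lborel (\<lambda>E. 1 / b ^ n * (indicator {0..} (b * E) * ((b * E) ^ n * exp (- (b * E)))))" by simp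
  also have "(\<lambda>E. 1 / b ^ n * (indicator {0..} (b * E) * ((b * E) ^ n * exp (- (b * E))))) = (\<lambda>E. indicator {0..} E * (E ^ n * exp (- (b * E))))"
    using assms by (auto simp: indicator_def fun_eq_iff power_mult_distrib zero_le_mult_iff)
  finally show ?thesis .
qed

context scattering_system
begin

text \<open>Energies in \<open>sigma0 Q\<close> are nonnegative and \<open>b\<close> is positive, so
  domination by a multiple of \<open>exp (- (b * E))\<close> gives all moments.\<close>

lemma integrable_power_fermi_dirac:
  assumes b: "b > 0"
  shows "integrable lborel (\<lambda>E. indicator (sigma0 Q) E * (E ^ n * fermi_dirac b m E))"
proof (rule Bochner_Integration.integrable_bound)
  show "integrable lborel (\<lambda>E. exp (b * m) * (indicator {0..} E * (E ^ n * exp (- (b * E)))))"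
    by (intro integrable_mult_right integrable_power_exp b)
  have [measurable]: "sigma0 Q \<in> sets borel" by (rule sigma0)
  show "(\<lambda>E. indicator (sigma0 Q) E * (E ^ n * fermi_dirac b m E)) \<in> borel_measurable lborel" by measurable
  show "AE E in lborel. norm (indicator (sigma0 Q) E * (E ^ n * fermi_dirac b m E)) \<le> norm (exp (b * m) * (indicator {0..} E * (E ^ n * exp (- (b * E)))))"
  proof (intro AE_I2)
    fix E :: real
    show "norm (indicator (sigma0 Q) E * (E ^ n * fermi_dirac b m E)) \<le> norm (exp (b * m) * (indicator {0..} E * (E ^ n * exp (- (b * E)))))"
    proof (cases "E \<in> sigma0 Q")
      case True
      hence E: "E \<ge> 0" using sigma0(2) by auto
      have "fermi_dirac b m E \<le> 1 / exp (b * (E - m))"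
        unfolding fermi_dirac_def by (intro divide_left_mono) (auto intro!: mult_pos_pos add_pos_pos)
      also have "\<dots> = exp (b * m) * exp (- (b * E))"
        by (simp add: exp_minus[symmetric] exp_add[symmetric] inverse_eq_divide[symmetric] algebra_simps)
      finally have "E ^ n * fermi_dirac b m E \<le> E ^ n * (exp (b * m) * exp (- (b * E)))"
        using E by (intro mult_left_mono) auto
      thus ?thesis using True E fermi_dirac_bounds(1)[of b m E] by (simp add: abs_mult algebra_simps)
    qed simp
  qed
qed

lemma thermal_vector_exists:
  assumes j: "j \<in> J" and b: "\<beta> j > 0"
  shows "\<exists>w. thermal_vector \<beta> \<mu> j w"
proof -
  interpret L2_rep "res Q j" "sigma0 Q" "R j" by (rule rep_res[OF j])
  let ?f = "fermi_dirac (\<beta> j) (\<mu> j)"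
  define g where "g E = indicator (sigma0 Q) E * complex_of_real (sqrt (?f E))" for E
  have [measurable]: "sigma0 Q \<in> sets borel" by (rule sigma0)
  have gm: "g \<in> borel_measurable borel" unfolding g_def[abs_def] by measurable
  have g2: "(cmod (g E))\<^sup>2 = indicator (sigma0 Q) E * ?f E" for E
    using fermi_dirac_bounds(1)[of "\<beta> j" "\<mu> j" E] by (auto simp: g_def norm_mult indicator_def)
  have "integrable lborel (\<lambda>E. (cmod (g E))\<^sup>2)"
    unfolding g2 using integrable_power_fermi_dirac[OF b, of 0 "\<mu> j"] by simp
  then obtain w where w: "w \<in> res Q j" "AE E in lborel. R j w E = g E"
    using surj[OF gm] by (auto simp: g_def)
  note [measurable] = meas[OF w(1)] gm
  have "integrable lborel (\<lambda>E. E ^ n * (cmod (R j w E))\<^sup>2)" for n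
  proof -
    have "integrable lborel (\<lambda>E. E ^ n * (cmod (R j w E))\<^sup>2) \<longleftrightarrow> integrable lborel (\<lambda>E. indicator (sigma0 Q) E * (E ^ n * ?f E))"
    proof (rule integrable_cong_AE)
      show "AE E in lborel. E ^ n * (cmod (R j w E))\<^sup>2 = indicator (sigma0 Q) E * (E ^ n * ?f E)"
        using w(2) by eventually_elim (simp add: g2)
    qed measurable
    thus ?thesis using integrable_power_fermi_dirac[OF b] by simp
  qed
  with w show ?thesis unfolding thermal_vector_def nice_def g_def by blast
qed

section \<open>Limits along scattering trajectories\<close>

text \<open>Asymptotically both arguments of the inner product follow free orbits, and free
  evolution commutes with the projection and preserves inner products, so the limit is read off at
  time 0. It is applied with \<open>r = w\<close> in the past and with the scattered vector in the
  future; \<open>r'\<close> belongs to \<open>w'\<close>, which carries the energy weight of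
  \<open>A\<close>.\<close>

lemma trajectory_limit:
  assumes k: "k \<in> J"
    and r: "wave b r = wave Plus w" "proj0 Q r = r" and r': "wave b r' = wave Plus w'" "proj0 Q r' = r'"
    and u: "\<And>t. u t = propag Q (- t) (wave Plus w)"
    and bA: "\<And>t. norm (A (u t)) \<le> B"
    and asym: "((\<lambda>t. A (u t) - proj_res Q k (propag Q (- t) (wave Plus w'))) \<longlongrightarrow> 0) (branch_time b)"
  shows "((\<lambda>t. cinner (u t) (A (u t))) \<longlongrightarrow> cinner r (proj_res Q k r')) (branch_time b)"
proof -
  let ?x = "\<lambda>t. propag0 Q (- t) r" and ?y = "\<lambda>t. proj_res Q k (propag0 Q (- t) r')"
  have x: "((\<lambda>t. u t - ?x t) \<longlongrightarrow> 0) (branch_time b)"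
    using wave_asymptotics[of b r] by (simp add: r u)
  have "((\<lambda>t. proj_res Q k (propag Q (- t) (wave Plus w') - propag0 Q (- t) r')) \<longlongrightarrow> proj_res Q k 0) (branch_time b)"
    using wave_asymptotics[of b r'] by (intro bounded_linear.tendsto[OF proj_res_linear(1)[OF k]]) (simp add: r')
  from tendsto_add[OF asym this]
  have y: "((\<lambda>t. A (u t) - ?y t) \<longlongrightarrow> 0) (branch_time b)" by (simp add: proj_res_linear[OF k])
  have const: "cinner (?x t) (?y t) = cinner r (proj_res Q k r')" for t
    by (simp add: propag0_proj_res[OF k] G0.cinner_U)
  have "((\<lambda>t. cinner (u t) (A (u t)) - cinner r (proj_res Q k r')) \<longlongrightarrow> 0) (branch_time b)"
  proof (rule Lim_null_comparison)
    have "norm (cinner (u t) (A (u t)) - cinner r (proj_res Q k r')) \<le> norm (u t - ?x t) * B + norm r * norm (A (u t) - ?y t)" for t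
    proof -
      have "cinner (u t) (A (u t)) - cinner r (proj_res Q k r') = cinner (u t - ?x t) (A (u t)) + cinner (?x t) (A (u t) - ?y t)"
        unfolding const[of t, symmetric] by (simp add: cinner.diff_left cinner.diff_right)
      also have "norm \<dots> \<le> norm (cinner (u t - ?x t) (A (u t))) + norm (cinner (?x t) (A (u t) - ?y t))"
        by (rule norm_triangle_ineq)
      also have "\<dots> \<le> norm (u t - ?x t) * norm (A (u t)) + norm (?x t) * norm (A (u t) - ?y t)"
        by (intro add_mono Cauchy_Schwarz_cinner)
      also have "\<dots> \<le> norm (u t - ?x t) * B + norm r * norm (A (u t) - ?y t)"
        by (intro add_mono mult_left_mono bA) auto
      finally show ?thesis .
    qed
    thus "\<forall>\<^sub>F t in branch_time b. norm (cinner (u t) (A (u t)) - cinner r (proj_res Q k r')) \<le> norm (u t - ?x t) * B + norm r * norm (A (u t) - ?y t)"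
      by simp
    have "((\<lambda>t. norm (u t - ?x t) * B + norm r * norm (A (u t) - ?y t)) \<longlongrightarrow> 0 * B + norm r * 0) (branch_time b)"
      using tendsto_norm[OF x] tendsto_norm[OF y] by (intro tendsto_intros) auto
    thus "((\<lambda>t. norm (u t - ?x t) * B + norm r * norm (A (u t) - ?y t)) \<longlongrightarrow> 0) (branch_time b)" by simp
  qed
  thus ?thesis by (simp add: LIM_zero_iff)
qed

lemma AE_energy_cong:
  assumes "AE E in lborel. E \<in> sigma0 Q \<longrightarrow> P E" "\<And>E. E \<notin> sigma0 Q \<Longrightarrow> P E"
  shows "AE E in lborel. P E"
  using assms(1) by eventually_elim (use assms(2) in blast)

lemma rep_scattering:
  assumes j: "j \<in> J" and k: "k \<in> J" and w: "w \<in> res Q j"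
  shows "AE E in lborel. E \<in> sigma0 Q \<longrightarrow> R k (proj_res Q k (scattering_op Q w)) E = Smat Q k j E * R j w E"
proof -
  \<comment> \<open>Even the zero vector has a transform vanishing only almost everywhere, by
    scaling with 0.\<close>
  have zero: "AE E in lebesgue_on (sigma0 Q). \<forall>l\<in>J. l \<noteq> j \<longrightarrow> four Q l (proj_res Q l w) E = 0"
  proof (intro AE_finite_allI finite_atLeastAtMost)
    fix l assume l: "l \<in> J"
    show "AE E in lebesgue_on (sigma0 Q). l \<noteq> j \<longrightarrow> four Q l (proj_res Q l w) E = 0"
    proof (cases "l = j")
      case False
      have z: "0 \<in> res Q l" using csubspace_res[OF l] unfolding csubspace_iff by blast
      have "\<forall>c. \<forall>u\<in>res Q l. AE E in lebesgue_on (sigma0 Q). four Q l (c *\<^sub>C u) E = c * four Q l u E"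
        using four_spectral[OF l] unfolding spectral_rep_def L2_unitary_def by blast
      hence "AE E in lebesgue_on (sigma0 Q). four Q l (0 *\<^sub>C 0) E = 0 * four Q l 0 E" using z by blast
      thus ?thesis using False proj_res_res[OF j l w] by simp
    qed simp
  qed
  have "AE E in lebesgue_on (sigma0 Q). R k (proj_res Q k (scattering_op Q w)) E = Smat Q k j E * R j w E"
    using Smat_multiplication[OF res_subset_range_proj0[OF j w] k] AE_four_rep[OF k proj_res_in[OF k, of "scattering_op Q w"]] AE_four_rep[OF j w] zero
  proof eventually_elim
    case (elim E)
    have "(\<Sum>l=1..nres Q. Smat Q k l E * four Q l (proj_res Q l w) E) = (\<Sum>l=1..nres Q. if l = j then Smat Q k j E * four Q j w E else 0)"
      using elim(4) proj_res_res[OF j j w] by (intro sum.cong) auto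
    also have "\<dots> = Smat Q k j E * four Q j w E" using j by simp
    finally show ?case using elim by simp
  qed
  thus ?thesis by (simp add: AE_lebesgue_on_iff sigma0)
qed

text \<open>A Borel version of $|S_{kj}|^2 f_j$, for \<open>w j\<close> the thermal vector of reservoir \<open>j\<close>; \<open>Smat\<close> is not
  assumed to be measurable.\<close>

definition "transition w k j E = (cmod (R k (proj_res Q k (scattering_op Q (w j))) E))\<^sup>2"

lemma transition_facts:
  assumes j: "j \<in> J" and k: "k \<in> J" and w: "thermal_vector \<beta> \<mu> j (w j)"
  shows "AE E in lborel. E \<in> sigma0 Q \<longrightarrow> transition w k j E = (cmod (Smat Q k j E))\<^sup>2 * fermi_dirac (\<beta> j) (\<mu> j) E"
    "E \<notin> sigma0 Q \<Longrightarrow> transition w k j E = 0" "transition w k j \<in> borel_measurable borel"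
proof -
  have n: "nice j (w j)" and ae: "AE E in lborel. R j (w j) E = indicator (sigma0 Q) E * complex_of_real (sqrt (fermi_dirac (\<beta> j) (\<mu> j) E))"
    using w unfolding thermal_vector_def by blast+
  show "AE E in lborel. E \<in> sigma0 Q \<longrightarrow> transition w k j E = (cmod (Smat Q k j E))\<^sup>2 * fermi_dirac (\<beta> j) (\<mu> j) E"
    using rep_scattering[OF j k nice_res[OF n]] ae
    by eventually_elim (simp add: transition_def norm_mult power_mult_distrib less_imp_le[OF fermi_dirac_bounds(1)])
  show "E \<notin> sigma0 Q \<Longrightarrow> transition w k j E = 0"
    unfolding transition_def using L2_rep.supp[OF rep_res[OF k] proj_res_in[OF k]] by simp
  note [measurable] = rep_measurable[OF k proj_res_in[OF k]]
  show "transition w k j \<in> borel_measurable borel" unfolding transition_def[abs_def] by measurable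
qed

text \<open>Almost everywhere on \<open>sigma0 Q\<close> this is (|S_kj|^2 - \<delta>_jk) f_j,
  counted into reservoir k; the currents out of k therefore carry a minus sign.\<close>

definition "flux w k j E = transition w k j E - (if j = k then (cmod (R j (w j) E))\<^sup>2 else 0)"

text \<open>Both currents are obtained from the following lemma, with \<open>p = 1\<close> for particles and
  \<open>p E = E\<close> for energy.\<close>

lemma current_formula:
  assumes k: "k \<in> J" and C: "is_commutator (dom0 Q) (coupling Q) A C" "finite_rank C"
    and w: "\<And>j. j \<in> J \<Longrightarrow> thermal_vector \<beta> \<mu> j (w j)"
    and w': "\<And>j. j \<in> J \<Longrightarrow> w' j \<in> res Q j" "\<And>j. j \<in> J \<Longrightarrow> AE E in lborel. R j (w' j) E = complex_of_real (p E) * R j (w j) E"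
    and p [measurable]: "p \<in> borel_measurable borel"
    and sym: "\<And>x y. x \<in> dom0 Q \<Longrightarrow> y \<in> dom0 Q \<Longrightarrow> cinner x (A y) = cinner (A x) y"
    and comm: "\<And>x. x \<in> dom0 Q \<Longrightarrow> cinner (ham0 Q x) (A x) = cinner (A x) (ham0 Q x)"
    and u: "\<And>j t. u j t = propag Q (- t) (wave Plus (w j))"
    and cont: "\<And>j. j \<in> J \<Longrightarrow> continuous_on UNIV (\<lambda>t. A (u j t))" and bA: "\<And>j t. j \<in> J \<Longrightarrow> norm (A (u j t)) \<le> B j"
    and asym: "\<And>j. j \<in> J \<Longrightarrow> ((\<lambda>t. A (u j t) - proj_res Q k (propag Q (- t) (wave Plus (w' j)))) \<longlongrightarrow> 0) at_infinity"
  shows "(\<forall>j\<in>J. integrable lborel (\<lambda>E. p E * flux w k j E)) \<and>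
    - \<i> * op_trace (\<lambda>u. steady_density Q \<beta> \<mu> (C u)) =
     complex_of_real (- (1 / (2 * pi)) * (\<Sum>j=1..nres Q. LBINT E. p E * flux w k j E))"
proof -
  interpret k: L2_rep "res Q k" "sigma0 Q" "R k" by (rule rep_res[OF k])
  have wr: "w j \<in> res Q j" if "j \<in> J" for j using w[OF that] nice_res unfolding thermal_vector_def by blast
  define S where "S x = proj_res Q k (scattering_op Q x)" for x
  have Sin: "S x \<in> res Q k" for x unfolding S_def by (rule proj_res_in[OF k])
  define Lp where "Lp j = cinner (scattering_op Q (w j)) (proj_res Q k (scattering_op Q (w' j)))" for j
  define Lm where "Lm j = cinner (w j) (proj_res Q k (w' j))" for j
  have sub: "at_top \<le> (at_infinity :: real filter)" "at_bot \<le> (at_infinity :: real filter)"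
    by (auto simp: at_top_le_at_infinity at_bot_le_at_infinity)
  have sum: "(\<Sum>j=1..nres Q. Lp j - Lm j) = 2 * pi * \<i> * op_trace (\<lambda>u. steady_density Q \<beta> \<mu> (C u))"
  proof (rule trace_increment[OF C w sym comm u cont bA])
    fix j assume j: "j \<in> J"
    show "((\<lambda>t. cinner (u j t) (A (u j t))) \<longlongrightarrow> Lp j) at_top"
      unfolding Lp_def
      using trajectory_limit[where A = A and u = "u j" and w = "w j" and w' = "w' j",
          OF k scattering_op_wave scattering_op_wave u bA[OF j]] asym[OF j] tendsto_mono[OF sub(1)] by auto
    show "((\<lambda>t. cinner (u j t) (A (u j t))) \<longlongrightarrow> Lm j) at_bot"
      unfolding Lm_def
      using trajectory_limit[where A = A and u = "u j" and w = "w j" and w' = "w' j",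
          OF k refl proj0_res[OF j wr[OF j]] refl proj0_res[OF j w'(1)[OF j]] u bA[OF j]]
        asym[OF j] tendsto_mono[OF sub(2)] by auto
  qed
  \<comment> \<open>The weight \<open>p\<close> is carried by \<open>w'\<close>, so each term of the
    flux is an inner product of vectors and hence integrable separately.\<close>
  have p_int: "integrable lborel (\<lambda>E. p E * transition w k j E) \<and> Lp j = complex_of_real (LBINT E. p E * transition w k j E)" if j: "j \<in> J" for j
  proof -
    note [measurable] = k.meas[OF Sin] transition_facts(3)[where w = w, OF j k w[OF j]]
    have ae: "AE E in lborel. cnj (R k (S (w j)) E) * R k (S (w' j)) E = complex_of_real (p E * transition w k j E)"
    proof (rule AE_energy_cong)
      show "AE E in lborel. E \<in> sigma0 Q \<longrightarrow> cnj (R k (S (w j)) E) * R k (S (w' j)) E = complex_of_real (p E * transition w k j E)"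
        using rep_scattering[OF j k wr[OF j]] rep_scattering[OF j k w'(1)[OF j]] w'(2)[OF j]
      proof eventually_elim
        case (elim E)
        show ?case
        proof
          assume "E \<in> sigma0 Q"
          hence "R k (S (w' j)) E = complex_of_real (p E) * R k (S (w j)) E" using elim by (simp add: S_def)
          thus "cnj (R k (S (w j)) E) * R k (S (w' j)) E = complex_of_real (p E * transition w k j E)"
            unfolding transition_def S_def[symmetric] of_real_mult complex_norm_square by (simp only: mult_ac)
        qed
      qed
      show "cnj (R k (S (w j)) E) * R k (S (w' j)) E = complex_of_real (p E * transition w k j E)" if "E \<notin> sigma0 Q" for E
        using k.supp[OF Sin that] transition_facts(2)[where w = w, OF j k w[OF j] that] by simp
    qed
    have "integrable lborel (\<lambda>E. complex_of_real (p E * transition w k j E)) \<longleftrightarrow> integrable lborel (\<lambda>E. cnj (R k (S (w j)) E) * R k (S (w' j)) E)"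
      by (rule integrable_cong_AE) (measurable, use ae in eventually_elim, simp)
    hence i: "integrable lborel (\<lambda>E. complex_of_real (p E * transition w k j E))" using k.integrable_cnj_mult[OF Sin Sin] by simp
    have "Lp j = cinner (S (w j)) (S (w' j))"
      unfolding Lp_def S_def using proj_res_symmetric[OF k, of "scattering_op Q (w j)" "S (w' j)"] proj_res_res[OF k k Sin[of "w' j"]]
      by (simp add: S_def)
    also have "\<dots> = (LBINT E. cnj (R k (S (w j)) E) * R k (S (w' j)) E)" by (rule k.cinner_eq[OF Sin Sin])
    also have "\<dots> = (LBINT E. complex_of_real (p E * transition w k j E))"
      by (rule integral_cong_AE) (measurable, rule ae)
    also have "\<dots> = complex_of_real (LBINT E. p E * transition w k j E)" by (rule integral_complex_of_real)
    finally show ?thesis using i by (simp only: complex_of_real_integrable_eq)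
  qed
  have m_int: "integrable lborel (\<lambda>E. p E * (if j = k then (cmod (R j (w j) E))\<^sup>2 else 0)) \<and>
      Lm j = complex_of_real (LBINT E. p E * (if j = k then (cmod (R j (w j) E))\<^sup>2 else 0))" if j: "j \<in> J" for j
  proof (cases "j = k")
    case True
    note in_res = wr[OF k] w'(1)[OF k]
    note [measurable] = k.meas[OF in_res(1)] k.meas[OF in_res(2)]
    have ae: "AE E in lborel. cnj (R k (w k) E) * R k (w' k) E = complex_of_real (p E * (cmod (R k (w k) E))\<^sup>2)"
      using w'(2)[OF k]
    proof eventually_elim
      case (elim E)
      thus ?case unfolding of_real_mult complex_norm_square by (simp only: mult_ac)
    qed
    have "integrable lborel (\<lambda>E. complex_of_real (p E * (cmod (R k (w k) E))\<^sup>2)) \<longleftrightarrow> integrable lborel (\<lambda>E. cnj (R k (w k) E) * R k (w' k) E)"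
      by (rule integrable_cong_AE) (measurable, use ae in eventually_elim, simp)
    hence i: "integrable lborel (\<lambda>E. complex_of_real (p E * (cmod (R k (w k) E))\<^sup>2))" using k.integrable_cnj_mult[OF in_res] by simp
    have "Lm k = cinner (w k) (w' k)" unfolding Lm_def using proj_res_res[OF k k in_res(2)] by simp
    also have "\<dots> = (LBINT E. cnj (R k (w k) E) * R k (w' k) E)" by (rule k.cinner_eq[OF in_res])
    also have "\<dots> = (LBINT E. complex_of_real (p E * (cmod (R k (w k) E))\<^sup>2))"
      by (rule integral_cong_AE) (measurable, rule ae)
    also have "\<dots> = complex_of_real (LBINT E. p E * (cmod (R k (w k) E))\<^sup>2)" by (rule integral_complex_of_real)
    finally show ?thesis using i True by (simp only: complex_of_real_integrable_eq) simp
  next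
    case False
    thus ?thesis unfolding Lm_def using proj_res_res[OF j k w'(1)[OF j]] by simp
  qed
  have int: "integrable lborel (\<lambda>E. p E * flux w k j E)" if "j \<in> J" for j
    using Bochner_Integration.integrable_diff[OF conjunct1[OF p_int[OF that]] conjunct1[OF m_int[OF that]]]
    by (simp only: flux_def right_diff_distrib)
  have L: "Lp j - Lm j = complex_of_real (LBINT E. p E * flux w k j E)" if "j \<in> J" for j
    using Bochner_Integration.integral_diff[OF conjunct1[OF p_int[OF that]] conjunct1[OF m_int[OF that]]]
      conjunct2[OF p_int[OF that]] conjunct2[OF m_int[OF that]]
    by (simp only: flux_def right_diff_distrib of_real_diff)
  have "complex_of_real (- (1 / (2 * pi))) * (\<Sum>j=1..nres Q. Lp j - Lm j) = - \<i> * op_trace (\<lambda>u. steady_density Q \<beta> \<mu> (C u))"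
    unfolding sum by (simp add: field_simps)
  moreover have "(\<Sum>j=1..nres Q. Lp j - Lm j) = complex_of_real (\<Sum>j=1..nres Q. LBINT E. p E * flux w k j E)"
    unfolding of_real_sum by (intro sum.cong refl L) auto
  ultimately show ?thesis using int by (simp only: of_real_mult) blast
qed

section \<open>Particle and energy currents\<close>

lemma particle_commutator:
  assumes k: "k \<in> J"
  defines "C \<equiv> \<lambda>u. coupling Q (proj_res Q k u) - proj_res Q k (coupling Q u)"
  shows "is_commutator (dom0 Q) (coupling Q) (proj_res Q k) C" "finite_rank C"
proof -
  note P = proj_res_linear[OF k]
  have bl: "bounded_linear C" unfolding C_def
    by (intro bounded_linear_sub bounded_linear_compose[OF coupling_linear(1) P(1)] bounded_linear_compose[OF P(1) coupling_linear(1)])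
  have bc: "bounded_clinear C"
    unfolding bounded_clinear_def using bl by (simp add: C_def P coupling_linear complex_vector.scale_right_diff_distrib)
  show "is_commutator (dom0 Q) (coupling Q) (proj_res Q k) C"
    unfolding is_commutator_def using bc
    by (simp add: C_def cinner.diff_right coupling_symmetric proj_res_symmetric[OF k])
  obtain F where F: "finite F" "range (coupling Q) \<subseteq> cspan F" using coupling_finite_rank unfolding finite_rank_def by blast
  have sub: "csubspace {x. proj_res Q k x \<in> cspan (F \<union> proj_res Q k ` F)}"
    unfolding csubspace_iff using complex_vector.subspace_span[of "F \<union> proj_res Q k ` F"]
    unfolding csubspace_iff by (auto simp: P)
  have "cspan F \<subseteq> {x. proj_res Q k x \<in> cspan (F \<union> proj_res Q k ` F)}"
    by (intro complex_vector.span_minimal sub) (auto intro: complex_vector.span_base)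
  hence "C u \<in> cspan (F \<union> proj_res Q k ` F)" for u
    unfolding C_def using F(2) complex_vector.span_mono[of F "F \<union> proj_res Q k ` F"]
    by (intro complex_vector.span_diff) blast+
  thus "finite_rank C" unfolding finite_rank_def using bc F(1) by (intro conjI exI[of _ "F \<union> proj_res Q k ` F"]) auto
qed

lemma particle_current_formula:
  assumes k: "k \<in> J" and w: "\<And>j. j \<in> J \<Longrightarrow> thermal_vector \<beta> \<mu> j (w j)"
  shows "\<And>j. j \<in> J \<Longrightarrow> integrable lborel (flux w k j)"
    "particle_current Q \<beta> \<mu> k =
     complex_of_real (- (1 / (2 * pi)) * (\<Sum>j=1..nres Q. LBINT E. flux w k j E))"
proof -
  define u where "u j t = propag Q (- t) (wave Plus (w j))" for j t
  have n: "nice j (w j)" if "j \<in> J" for j using w[OF that] unfolding thermal_vector_def by blast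
  have sym: "cinner (ham0 Q x) (proj_res Q k x) = cinner (proj_res Q k x) (ham0 Q x)" if x: "x \<in> dom0 Q" for x
  proof -
    have "cinner (ham0 Q x) (proj_res Q k x) = cinner (proj_res Q k (ham0 Q x)) (proj_res Q k x)"
      using proj_res_symmetric[OF k, of "ham0 Q x" "proj_res Q k x"] proj_res_res[OF k k proj_res_in[OF k, of x]] by simp
    also have "\<dots> = cinner (proj_res Q k x) (proj_res Q k (ham0 Q x))"
      unfolding proj_res_ham0[OF x k] by (rule ham_res_facts(5)[OF k, symmetric]) (intro dom0_proj x k)+
    also have "\<dots> = cinner (proj_res Q k x) (ham0 Q x)"
      using proj_res_symmetric[OF k, of "proj_res Q k x" "ham0 Q x"] proj_res_res[OF k k proj_res_in[OF k, of x]] by simp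
    finally show ?thesis .
  qed
  have cont: "continuous_on UNIV (\<lambda>t. proj_res Q k (u j t))" if "j \<in> J" for j
    using scattering_trajectory(3)[OF nice_dom(2)[OF that n[OF that]], of "u j"]
    by (intro bounded_linear.continuous_on[OF proj_res_linear(1)[OF k]]) (simp add: u_def)
  have bd: "norm (proj_res Q k (u j t)) \<le> norm (wave Plus (w j))" for j t
    using norm_proj_res_le[OF k, of "u j t"] by (simp add: u_def)
  have cf: "(\<forall>j\<in>J. integrable lborel (\<lambda>E. 1 * flux w k j E)) \<and>
    - \<i> * op_trace (\<lambda>u. steady_density Q \<beta> \<mu> (coupling Q (proj_res Q k u) - proj_res Q k (coupling Q u))) =
     complex_of_real (- (1 / (2 * pi)) * (\<Sum>j=1..nres Q. LBINT E. 1 * flux w k j E))"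
    by (rule current_formula[where A = "proj_res Q k" and w' = w and u = u and B = "\<lambda>j. norm (wave Plus (w j))"])
      (use k particle_commutator[OF k] w nice_res[OF n] sym cont bd in \<open>auto simp: proj_res_symmetric[OF k] u_def\<close>)
  show "integrable lborel (flux w k j)" if "j \<in> J" for j
    using cf that by simp
  show "particle_current Q \<beta> \<mu> k =
     complex_of_real (- (1 / (2 * pi)) * (\<Sum>j=1..nres Q. LBINT E. flux w k j E))"
    unfolding particle_current_def using cf by simp
qed

end

context regular_scattering_system
begin

text \<open>The observable is unbounded, but on the orbit \<open>ham0 Q\<close> is
  \<open>ham Q\<close> minus the coupling, and \<open>ham Q (u j t)\<close> is again a scattering
  orbit, launched by \<open>ham0 Q (w j)\<close>. This gives continuity and bounds, and the decay of
  the coupling yields the asymptotics with \<open>w' j = ham0 Q (w j)\<close>.\<close>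

lemma energy_current_formula:
  assumes k: "k \<in> J" and w: "\<And>j. j \<in> J \<Longrightarrow> thermal_vector \<beta> \<mu> j (w j)"
  shows "\<And>j. j \<in> J \<Longrightarrow> integrable lborel (\<lambda>E. E * flux w k j E)"
    "energy_current Q \<beta> \<mu> k =
     complex_of_real (- (1 / (2 * pi)) * (\<Sum>j=1..nres Q. LBINT E. E * flux w k j E))"
proof -
  define A where "A u = proj_res Q k (ham0 Q (proj_res Q k u))" for u
  obtain C where C: "finite_rank C" "is_commutator (dom0 Q) (coupling Q) A C"
    using energy_commutator[OF k] unfolding A_def by blast
  have Ceq: "commutator (dom0 Q) (coupling Q) A = C" by (rule commutator_eq[OF C(2)])
  have A: "A x = proj_res Q k (ham0 Q x)" "A x = ham_res Q k (proj_res Q k x)" if x: "x \<in> dom0 Q" for x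
  proof -
    show A1: "A x = proj_res Q k (ham0 Q x)"
      unfolding A_def ham0_proj_res(2)[OF x k] using proj_res_res[OF k k proj_res_in[OF k, of "ham0 Q x"]] by simp
    show "A x = ham_res Q k (proj_res Q k x)" unfolding A1 by (rule proj_res_ham0[OF x k])
  qed
  have AK: "A x \<in> res Q k" for x unfolding A_def by (rule proj_res_in[OF k])
  define u where "u j t = propag Q (- t) (wave Plus (w j))" for j t
  have n: "nice j (w j)" if "j \<in> J" for j using w[OF that] unfolding thermal_vector_def by blast
  note dom = nice_dom[OF _ n]
  note traj = scattering_trajectory[OF dom(2), where u = "u _", OF _ _ u_def]
  have sym: "cinner x (A y) = cinner (A x) y" if "x \<in> dom0 Q" "y \<in> dom0 Q" for x y
  proof -
    have "cinner x (A y) = cinner (proj_res Q k x) (A y)"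
      using proj_res_symmetric[OF k, of x "A y"] proj_res_res[OF k k AK] by simp
    also have "\<dots> = cinner (A x) (proj_res Q k y)"
      unfolding A(2)[OF that(1)] A(2)[OF that(2)] by (rule ham_res_facts(5)[OF k]) (intro dom0_proj that k)+
    also have "\<dots> = cinner (A x) y"
      using proj_res_symmetric[OF k, of "A x" y] proj_res_res[OF k k AK] by simp
    finally show ?thesis .
  qed
  have comm: "cinner (ham0 Q x) (A x) = cinner (A x) (ham0 Q x)" if x: "x \<in> dom0 Q" for x
  proof -
    have "cinner (ham0 Q x) (A x) = cinner (A x) (A x)"
      using proj_res_symmetric[OF k, of "ham0 Q x" "A x"] proj_res_res[OF k k AK] by (simp add: A(1)[OF x, symmetric])
    also have "\<dots> = cinner (A x) (ham0 Q x)"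
      using proj_res_symmetric[OF k, of "A x" "ham0 Q x"] proj_res_res[OF k k AK] by (simp add: A(1)[OF x, symmetric])
    finally show ?thesis .
  qed
  have Au: "A (u j t) = proj_res Q k (propag Q (- t) (wave Plus (ham0 Q (w j)))) - proj_res Q k (coupling Q (u j t))" if "j \<in> J" for j t
  proof -
    have "ham0 Q (u j t) = ham Q (u j t) - coupling Q (u j t)" by (simp add: ham_def)
    thus ?thesis unfolding A(1)[OF traj(1)[OF that that]] using traj(4)[OF that that] by (simp add: proj_res_linear[OF k])
  qed
  have cont: "continuous_on UNIV (\<lambda>t. A (u j t))" if j: "j \<in> J" for j
  proof -
    have "continuous_on UNIV (\<lambda>t. propag Q (- t) (wave Plus (ham0 Q (w j))))"
      by (rule continuous_on_compose2[OF G.U_cont, of UNIV "\<lambda>t. - t"]) (auto intro: continuous_intros)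
    thus ?thesis unfolding Au[OF j]
      by (intro continuous_on_diff bounded_linear.continuous_on[OF proj_res_linear(1)[OF k]]
          bounded_linear.continuous_on[OF coupling_linear(1)] traj(3)[OF j j])
  qed
  obtain c where c: "\<And>x. norm (coupling Q x) \<le> norm x * c" using bounded_linear.bounded[OF coupling_linear(1)] by blast
  have bd: "norm (A (u j t)) \<le> norm (wave Plus (ham0 Q (w j))) + norm (wave Plus (w j)) * c" if j: "j \<in> J" for j t
  proof -
    have "norm (A (u j t)) \<le> norm (proj_res Q k (propag Q (- t) (wave Plus (ham0 Q (w j))))) + norm (proj_res Q k (coupling Q (u j t)))"
      unfolding Au[OF j] by (rule norm_triangle_ineq4)
    also have "\<dots> \<le> norm (propag Q (- t) (wave Plus (ham0 Q (w j)))) + norm (coupling Q (u j t))"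
      by (intro add_mono norm_proj_res_le k)
    also have "\<dots> \<le> norm (wave Plus (ham0 Q (w j))) + norm (wave Plus (w j)) * c"
      using c[of "u j t"] by (simp add: u_def)
    finally show ?thesis .
  qed
  have w'r: "ham0 Q (w j) \<in> res Q j" if "j \<in> J" for j
    using dom_res_dom0(2)[OF that dom(1)[OF that that]] ham_res_facts(4)[OF that dom(1)[OF that that]] by simp
  have w'ae: "AE E in lborel. R j (ham0 Q (w j)) E = complex_of_real E * R j (w j) E" if "j \<in> J" for j
    using rep_ham_res[OF that dom(1)[OF that that]] dom_res_dom0(2)[OF that dom(1)[OF that that]] by simp
  have asym: "((\<lambda>t. A (u j t) - proj_res Q k (propag Q (- t) (wave Plus (ham0 Q (w j))))) \<longlongrightarrow> 0) at_infinity" if j: "j \<in> J" for j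
  proof -
    have "((\<lambda>t. - proj_res Q k (coupling Q (u j t))) \<longlongrightarrow> - proj_res Q k 0) at_infinity"
      unfolding u_def by (intro tendsto_minus bounded_linear.tendsto[OF proj_res_linear(1)[OF k]] coupling_decay[OF j n[OF j]])
    thus ?thesis unfolding Au[OF j] by (simp add: proj_res_linear[OF k])
  qed
  have cf: "(\<forall>j\<in>J. integrable lborel (\<lambda>E. E * flux w k j E)) \<and>
    - \<i> * op_trace (\<lambda>u. steady_density Q \<beta> \<mu> (C u)) =
     complex_of_real (- (1 / (2 * pi)) * (\<Sum>j=1..nres Q. LBINT E. E * flux w k j E))"
    by (rule current_formula[where p = "\<lambda>E. E" and u = u, OF k C(2,1) w w'r w'ae _ sym comm u_def cont bd asym]) measurable
  show "integrable lborel (\<lambda>E. E * flux w k j E)" if "j \<in> J" for j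
    using cf that by blast
  show "energy_current Q \<beta> \<mu> k =
     complex_of_real (- (1 / (2 * pi)) * (\<Sum>j=1..nres Q. LBINT E. E * flux w k j E))"
    unfolding energy_current_def A_def[symmetric] Ceq using cf by blast
qed

end

section \<open>Convexity and the sign of the entropy production\<close>

section \<open>Entropy inequality for doubly stochastic matrices\<close>

definition fermi :: "real \<Rightarrow> real" where "fermi x = 1 / (1 + exp x)"

lemma fermi_dirac_fermi: "fermi_dirac b m E = fermi (b * (E - m))"
  by (simp add: fermi_dirac_def fermi_def)

lemma fermi_strict_antimono: "x < y \<Longrightarrow> fermi y < fermi x"
  unfolding fermi_def by (intro divide_strict_left_mono) (auto intro!: mult_pos_pos add_pos_pos)

text \<open>The graph of a strictly convex function lies strictly above its tangent at
  \<open>x\<close>, whose slope is \<open>- fermi x\<close>; by the mean value theorem this reduces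
  to strict monotonicity of \<open>fermi\<close>.\<close>

lemma ln_one_plus_exp_strict_convex:
  assumes "x \<noteq> y"
  shows "fermi x * (y - x) + ln (1 + exp (- y)) - ln (1 + exp (- x)) > 0"
proof -
  define g where "g z = ln (1 + exp (- z))" for z :: real
  have pos: "0 < 1 + exp (- z)" for z :: real by (simp add: add_pos_pos)
  have "(g has_real_derivative - fermi z) (at z)" for z
  proof -
    have "(g has_real_derivative - exp (- z) / (1 + exp (- z))) (at z)"
      unfolding g_def[abs_def] using pos[of z] by (auto intro!: derivative_eq_intros)
    also have "- exp (- z) / (1 + exp (- z)) = - fermi z"
      unfolding fermi_def using pos[of z] pos[of "- z"] by (simp add: exp_minus field_simps)
    finally show ?thesis .
  qed
  note d = this
  have "fermi x * (y - x) + g y - g x > 0"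
  proof (cases "x < y")
    case True
    obtain z where z: "x < z" "z < y" "g y - g x = (y - x) * - fermi z" using MVT2[OF True, of g "\<lambda>z. - fermi z"] d by blast
    have "(y - x) * (fermi x - fermi z) > 0" using True fermi_strict_antimono[OF z(1)] by (intro mult_pos_pos) auto
    thus ?thesis using z(3) by (simp add: algebra_simps)
  next
    case False
    hence xy: "y < x" using assms by simp
    obtain z where z: "y < z" "z < x" "g x - g y = (x - y) * - fermi z" using MVT2[OF xy, of g "\<lambda>z. - fermi z"] d by blast
    have "(x - y) * (fermi z - fermi x) > 0" using xy fermi_strict_antimono[OF z(2)] by (intro mult_pos_pos) auto
    thus ?thesis using z(3) by (simp add: algebra_simps)
  qed
  thus ?thesis by (simp add: g_def)
qed

text \<open>The sum equals that of \<open>M k j * D k j\<close>, where \<open>D\<close> is the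
  Bregman distance of the convex function \<open>g\<close>. Row sums evaluate the terms in
  \<open>g (x k)\<close>, column sums those in \<open>g (x j)\<close> and
  \<open>x j * fermi (x j)\<close>; the contributions of \<open>g\<close> cancel and the last one
  produces the diagonal subtraction.\<close>

lemma doubly_stochastic_fermi:
  fixes M :: "'i \<Rightarrow> 'i \<Rightarrow> real"
  assumes I: "finite I" and M: "\<And>k j. k \<in> I \<Longrightarrow> j \<in> I \<Longrightarrow> M k j \<ge> 0"
    and col: "\<And>j. j \<in> I \<Longrightarrow> (\<Sum>k\<in>I. M k j) = 1" and row: "\<And>k. k \<in> I \<Longrightarrow> (\<Sum>j\<in>I. M k j) = 1"
  shows "(\<Sum>k\<in>I. \<Sum>j\<in>I. x k * (M k j * fermi (x j) - (if j = k then fermi (x j) else 0))) \<ge> 0" (is "?s \<ge> 0")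
    "\<lbrakk>k \<in> I; j \<in> I; M k j > 0; x k \<noteq> x j\<rbrakk> \<Longrightarrow> (\<Sum>k\<in>I. \<Sum>j\<in>I. x k * (M k j * fermi (x j) - (if j = k then fermi (x j) else 0))) > 0"
proof -
  define g where "g z = ln (1 + exp (- z))" for z :: real
  define D where "D k j = fermi (x j) * (x k - x j) + g (x k) - g (x j)" for k j
  have D: "D k j \<ge> 0" "x k \<noteq> x j \<Longrightarrow> D k j > 0" for k j
    using ln_one_plus_exp_strict_convex[of "x j" "x k"] unfolding D_def g_def by (cases "x j = x k"; force)+
  have "(\<Sum>k\<in>I. \<Sum>j\<in>I. M k j * D k j) = (\<Sum>k\<in>I. \<Sum>j\<in>I. x k * (M k j * fermi (x j))) - (\<Sum>k\<in>I. \<Sum>j\<in>I. M k j * (x j * fermi (x j)))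
      + (\<Sum>k\<in>I. \<Sum>j\<in>I. M k j * g (x k)) - (\<Sum>k\<in>I. \<Sum>j\<in>I. M k j * g (x j))"
    unfolding D_def by (simp add: algebra_simps sum.distrib sum_subtractf)
  also have "(\<Sum>k\<in>I. \<Sum>j\<in>I. M k j * g (x k)) = (\<Sum>k\<in>I. g (x k))"
    unfolding sum_distrib_right[symmetric] using row by (intro sum.cong) auto
  also have "(\<Sum>k\<in>I. \<Sum>j\<in>I. M k j * g (x j)) = (\<Sum>j\<in>I. g (x j))"
    by (subst sum.swap, unfold sum_distrib_right[symmetric]) (use col in \<open>intro sum.cong; auto\<close>)
  also have "(\<Sum>k\<in>I. \<Sum>j\<in>I. M k j * (x j * fermi (x j))) = (\<Sum>j\<in>I. x j * fermi (x j))"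
    by (subst sum.swap, unfold sum_distrib_right[symmetric]) (use col in \<open>intro sum.cong; auto\<close>)
  also have "(\<Sum>j\<in>I. x j * fermi (x j)) = (\<Sum>k\<in>I. \<Sum>j\<in>I. x k * (if j = k then fermi (x j) else 0))"
  proof (intro sum.cong refl)
    fix k assume "k \<in> I"
    have "(\<Sum>j\<in>I. x k * (if j = k then fermi (x j) else 0)) = (\<Sum>j\<in>I. if j = k then x k * fermi (x k) else 0)"
      by (intro sum.cong) auto
    thus "x k * fermi (x k) = (\<Sum>j\<in>I. x k * (if j = k then fermi (x j) else 0))" using \<open>k \<in> I\<close> I by simp
  qed
  finally have eq: "?s = (\<Sum>k\<in>I. \<Sum>j\<in>I. M k j * D k j)"
    by (simp add: right_diff_distrib sum_subtractf)
  show "?s \<ge> 0" unfolding eq using M D(1) by (intro sum_nonneg mult_nonneg_nonneg)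
  assume kj: "k \<in> I" "j \<in> I" "M k j > 0" "x k \<noteq> x j"
  show "?s > 0" unfolding eq
  proof (rule sum_pos2[OF I kj(1)])
    show "(\<Sum>j\<in>I. M k j * D k j) > 0"
      using kj M D by (intro sum_pos2[OF I kj(2)] mult_pos_pos mult_nonneg_nonneg) auto
  qed (use M D(1) in \<open>intro sum_nonneg mult_nonneg_nonneg\<close>)
qed

section \<open>Positivity of the entropy production\<close>

context regular_scattering_system
begin

lemma entropy_production_formula:
  assumes w: "\<And>j. j \<in> J \<Longrightarrow> thermal_vector \<beta> \<mu> j (w j)"
  defines "G \<equiv> \<lambda>E. \<Sum>k=1..nres Q. \<Sum>j=1..nres Q. \<beta> k * (E - \<mu> k) * flux w k j E"
  shows "integrable lborel G" "entropy_production Q \<beta> \<mu> = complex_of_real (1 / (2 * pi) * (LBINT E. G E))"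
proof -
  have i1: "integrable lborel (flux w k j)" and iE: "integrable lborel (\<lambda>E. E * flux w k j E)" if "k \<in> J" "j \<in> J" for k j
    using particle_current_formula(1)[OF that(1) w that(2)] energy_current_formula(1)[OF that(1) w that(2)]
    by blast+
  have split: "\<beta> k * (E - \<mu> k) * flux w k j E = \<beta> k * (E * flux w k j E) - \<beta> k * \<mu> k * flux w k j E" for k j E
    by (simp add: algebra_simps)
  have ik: "integrable lborel (\<lambda>E. \<beta> k * (E - \<mu> k) * flux w k j E)" if "k \<in> J" "j \<in> J" for k j
    unfolding split by (intro Bochner_Integration.integrable_diff integrable_mult_right i1 iE that)
  show "integrable lborel G" unfolding G_def by (intro Bochner_Integration.integrable_sum ik)
  have "(LBINT E. G E) = (\<Sum>k=1..nres Q. \<Sum>j=1..nres Q. LBINT E. \<beta> k * (E - \<mu> k) * flux w k j E)"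
    unfolding G_def by (subst Bochner_Integration.integral_sum; (intro sum.cong refl Bochner_Integration.integral_sum Bochner_Integration.integrable_sum ik)?)
  also have "\<dots> = (\<Sum>k=1..nres Q. \<Sum>j=1..nres Q. \<beta> k * (LBINT E. E * flux w k j E) - \<beta> k * \<mu> k * (LBINT E. flux w k j E))"
  proof (intro sum.cong refl)
    fix k j assume kj: "k \<in> J" "j \<in> J"
    show "(LBINT E. \<beta> k * (E - \<mu> k) * flux w k j E) = \<beta> k * (LBINT E. E * flux w k j E) - \<beta> k * \<mu> k * (LBINT E. flux w k j E)"
      unfolding split Bochner_Integration.integral_diff[OF integrable_mult_right[OF iE[OF kj]] integrable_mult_right[OF i1[OF kj]]] by simp
  qed
  also have "\<dots> = (\<Sum>k=1..nres Q. \<beta> k * ((\<Sum>j=1..nres Q. LBINT E. E * flux w k j E) - \<mu> k * (\<Sum>j=1..nres Q. LBINT E. flux w k j E)))"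
    by (simp add: sum_subtractf sum_distrib_left right_diff_distrib mult.assoc)
  finally have G: "(LBINT E. G E) = \<dots>" .
  have cur: "energy_current Q \<beta> \<mu> k = complex_of_real (- (1 / (2 * pi)) * (\<Sum>j=1..nres Q. LBINT E. E * flux w k j E))"
    "particle_current Q \<beta> \<mu> k = complex_of_real (- (1 / (2 * pi)) * (\<Sum>j=1..nres Q. LBINT E. flux w k j E))" if "k \<in> J" for k
    using particle_current_formula(2)[OF that w] energy_current_formula(2)[OF that w] by blast+
  \<comment> \<open>The sign in the definition of the entropy production cancels the sign of the
    currents; \<open>c\<close> is \<open>1 / (2 * pi)\<close>.\<close>
  have gen: "- (\<Sum>k\<in>K. \<beta> k * (- c * X k - \<mu> k * (- c * Y k))) = c * (\<Sum>k\<in>K. \<beta> k * (X k - \<mu> k * Y k))" for K X Y and c :: real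
    unfolding sum_distrib_left sum_negf[symmetric] by (intro sum.cong refl) (simp add: algebra_simps)
  have "entropy_production Q \<beta> \<mu> = - (\<Sum>k=1..nres Q. complex_of_real (\<beta> k * (- (1 / (2 * pi)) * (\<Sum>j=1..nres Q. LBINT E. E * flux w k j E)
      - \<mu> k * (- (1 / (2 * pi)) * (\<Sum>j=1..nres Q. LBINT E. flux w k j E)))))"
    unfolding entropy_production_def by (intro arg_cong[where f = uminus] sum.cong refl) (simp only: cur of_real_mult of_real_diff)
  also have "\<dots> = complex_of_real (1 / (2 * pi) * (\<Sum>k=1..nres Q. \<beta> k * ((\<Sum>j=1..nres Q. LBINT E. E * flux w k j E) - \<mu> k * (\<Sum>j=1..nres Q. LBINT E. flux w k j E))))"
    unfolding of_real_sum[symmetric] of_real_minus[symmetric] of_real_eq_iff by (rule gen)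
  finally show "entropy_production Q \<beta> \<mu> = complex_of_real (1 / (2 * pi) * (LBINT E. G E))" unfolding G .
qed

lemma Smat_doubly_stochastic:
  "AE E in lborel. E \<in> sigma0 Q \<longrightarrow> (\<forall>j\<in>J. (\<Sum>k=1..nres Q. (cmod (Smat Q k j E))\<^sup>2) = 1 \<and> (\<Sum>k=1..nres Q. (cmod (Smat Q j k E))\<^sup>2) = 1)"
proof -
  have "AE E in lborel. E \<in> sigma0 Q \<longrightarrow> (\<forall>j\<in>J. \<forall>k\<in>J.
        (\<Sum>l=1..nres Q. cnj (Smat Q l j E) * Smat Q l k E) = (if j = k then 1 else 0) \<and>
        (\<Sum>l=1..nres Q. Smat Q j l E * cnj (Smat Q k l E)) = (if j = k then 1 else 0))"
    using Smat_unitary by (simp only: AE_lebesgue_on_iff sigma0)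
  thus ?thesis
  proof eventually_elim
    case (elim E)
    show ?case
    proof (intro impI ballI)
      fix j assume E: "E \<in> sigma0 Q" and j: "j \<in> J"
      have "complex_of_real (\<Sum>k=1..nres Q. (cmod (Smat Q k j E))\<^sup>2) = (\<Sum>l=1..nres Q. cnj (Smat Q l j E) * Smat Q l j E)"
        unfolding of_real_sum complex_norm_square by (simp only: mult.commute)
      also have "\<dots> = complex_of_real 1" using elim E j by simp
      finally have c: "(\<Sum>k=1..nres Q. (cmod (Smat Q k j E))\<^sup>2) = 1" unfolding of_real_eq_iff .
      have "complex_of_real (\<Sum>k=1..nres Q. (cmod (Smat Q j k E))\<^sup>2) = (\<Sum>l=1..nres Q. Smat Q j l E * cnj (Smat Q j l E))"
        unfolding of_real_sum complex_norm_square ..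
      also have "\<dots> = complex_of_real 1" using elim E j by simp
      finally have "(\<Sum>k=1..nres Q. (cmod (Smat Q j k E))\<^sup>2) = 1" unfolding of_real_eq_iff .
      with c show "(\<Sum>k=1..nres Q. (cmod (Smat Q k j E))\<^sup>2) = 1 \<and> (\<Sum>k=1..nres Q. (cmod (Smat Q j k E))\<^sup>2) = 1" by blast
    qed
  qed
qed

text \<open>With equal slopes the lines are parallel and differ everywhere, since the slope is
  nonzero; otherwise they meet at a single energy, a null set. Distinct reservoirs thus have
  distinct thermal variables on almost all of \<open>B\<close>.\<close>

lemma AE_distinct_affine:
  fixes b b' m m' :: real
  assumes "b > 0" "b' > 0" "(b, m) \<noteq> (b', m')"
  shows "AE E in lborel. b * (E - m) \<noteq> b' * (E - m')"
proof (cases "b = b'")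
  case True
  thus ?thesis using assms by (auto intro!: AE_I2)
next
  case False
  have "AE E in lborel. E \<noteq> (b * m - b' * m') / (b - b')" by (rule AE_lborel_singleton)
  thus ?thesis by eventually_elim (use False in \<open>auto simp: field_simps\<close>)
qed

text \<open>The entropy density is nonnegative almost everywhere by the matrix inequality at fixed
  energy, and strictly positive on almost all of \<open>B\<close>, so its integral cannot
  vanish.\<close>

theorem entropy_production_positive:
  assumes beta: "\<And>j. j \<in> J \<Longrightarrow> \<beta> j > 0"
    and jk: "j0 \<in> J" "k0 \<in> J"
    and B: "B \<subseteq> sigma0 Q" "B \<in> sets lebesgue" "emeasure lebesgue B > 0"
    and T: "\<And>E. E \<in> B \<Longrightarrow> Tmat Q j0 k0 E \<noteq> 0"
    and ne: "(\<beta> j0, \<mu> j0) \<noteq> (\<beta> k0, \<mu> k0)"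
  shows "\<exists>r>0. entropy_production Q \<beta> \<mu> = complex_of_real r"
proof -
  have "\<exists>w. \<forall>j\<in>J. thermal_vector \<beta> \<mu> j (w j)"
    using thermal_vector_exists beta by (intro bchoice) blast
  then obtain w where w: "\<And>j. j \<in> J \<Longrightarrow> thermal_vector \<beta> \<mu> j (w j)" by blast
  define G where "G E = (\<Sum>k=1..nres Q. \<Sum>j=1..nres Q. \<beta> k * (E - \<mu> k) * flux w k j E)" for E
  define x where "x E k = \<beta> k * (E - \<mu> k)" for E k
  have ep: "integrable lborel G" "entropy_production Q \<beta> \<mu> = complex_of_real (1 / (2 * pi) * (LBINT E. G E))"
    unfolding G_def[abs_def] by (rule entropy_production_formula, rule w, assumption)+
  have rho: "AE E in lborel. \<forall>k\<in>J. \<forall>j\<in>J. (E \<in> sigma0 Q \<longrightarrow> flux w k j E = (cmod (Smat Q k j E))\<^sup>2 * fermi (x E j) - (if j = k then fermi (x E j) else 0))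
      \<and> (E \<notin> sigma0 Q \<longrightarrow> flux w k j E = 0)"
  proof (intro AE_finite_allI finite_atLeastAtMost)
    fix k j assume k: "k \<in> J" and j: "j \<in> J"
    have "AE E in lborel. R j (w j) E = indicator (sigma0 Q) E * complex_of_real (sqrt (fermi_dirac (\<beta> j) (\<mu> j) E))"
      using w[OF j] unfolding thermal_vector_def by blast
    with transition_facts(1)[where w = w, OF j k w[OF j]]
    show "AE E in lborel. (E \<in> sigma0 Q \<longrightarrow> flux w k j E = (cmod (Smat Q k j E))\<^sup>2 * fermi (x E j) - (if j = k then fermi (x E j) else 0))
      \<and> (E \<notin> sigma0 Q \<longrightarrow> flux w k j E = 0)"
    proof eventually_elim
      case (elim E)
      have "(cmod (R j (w j) E))\<^sup>2 = indicator (sigma0 Q) E * fermi (x E j)"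
        unfolding elim(2) x_def fermi_dirac_fermi[symmetric]
        using fermi_dirac_bounds(1)[of "\<beta> j" "\<mu> j" E] by (auto simp: norm_mult indicator_def)
      thus ?case using elim(1) transition_facts(2)[where w = w, OF j k w[OF j], of E]
        by (auto simp: flux_def x_def fermi_dirac_fermi)
    qed
  qed
  have distinct: "AE E in lborel. x E j0 \<noteq> x E k0"
    unfolding x_def by (rule AE_distinct_affine) (use beta jk ne in auto)
  have pos: "AE E in lborel. G E \<ge> 0 \<and> (E \<in> B \<longrightarrow> G E > 0)"
    using rho distinct Smat_doubly_stochastic
  proof eventually_elim
    case (elim E)
    show ?case
    proof (cases "E \<in> sigma0 Q")
      case True
      have G: "G E = (\<Sum>k\<in>J. \<Sum>j\<in>J. x E k * ((cmod (Smat Q k j E))\<^sup>2 * fermi (x E j) - (if j = k then fermi (x E j) else 0)))"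
        unfolding G_def x_def[symmetric] using elim(1) True by (intro sum.cong refl) simp
      \<comment> \<open>Off the diagonal \<open>Smat\<close> is a nonzero multiple of
        \<open>Tmat\<close>, so a nonzero transition amplitude is a nonzero entry of the doubly
        stochastic matrix.\<close>
      have "j0 \<noteq> k0" using ne by auto
      hence "cmod (Smat Q j0 k0 E) > 0" if "E \<in> B" using T[OF that] by (simp add: Smat_def)
      hence "(cmod (Smat Q j0 k0 E))\<^sup>2 > 0" if "E \<in> B" using that by simp
      thus ?thesis unfolding G using elim(2,3) True jk
        by (intro conjI impI doubly_stochastic_fermi(1) doubly_stochastic_fermi(2)[where k = j0 and j = k0]) auto
    next
      case False
      hence "G E = 0" unfolding G_def using elim(1) by simp
      thus ?thesis using False B(1) by auto
    qed
  qed
  hence G0: "AE E in lborel. 0 \<le> G E" by eventually_elim simp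
  have "(LBINT E. G E) \<ge> 0" by (rule integral_nonneg_AE[OF G0])
  moreover have "(LBINT E. G E) \<noteq> 0"
  proof
    assume "(LBINT E. G E) = 0"
    hence "AE E in lborel. G E = 0" using integral_nonneg_eq_0_iff_AE[OF ep(1) G0] by simp
    hence "AE E in lborel. E \<notin> B" using pos by eventually_elim auto
    \<comment> \<open>\<open>B\<close> is Lebesgue but not necessarily Borel measurable, hence the
      passage to the completed measure.\<close>
    hence "AE E in lebesgue. E \<notin> B" by (rule AE_completion)
    hence "emeasure lebesgue B = 0" using B(2) by (subst (asm) AE_iff_measurable[of B]) auto
    thus False using B(3) by simp
  qed
  ultimately have "1 / (2 * pi) * (LBINT E. G E) > 0" by simp
  thus ?thesis using ep(2) by blast
qed

end

theorem corollary2: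
  fixes Q :: "'h::chilbert_space open_system"
    and \<beta> \<mu> :: "nat \<Rightarrow> real"
    and j0 k0 :: nat
    and B :: "real set"
  assumes "nres Q \<ge> 2"
    and "regular_scattering_system Q"
    and "\<And>j. j \<in> {1..nres Q} \<Longrightarrow> \<beta> j > 0"
    and "j0 \<in> {1..nres Q}" and "k0 \<in> {1..nres Q}"
    and "B \<subseteq> sigma0 Q" and "B \<in> sets lebesgue" and "emeasure lebesgue B > 0"
    and "\<And>E. E \<in> B \<Longrightarrow> Tmat Q j0 k0 E \<noteq> 0"
    and "(\<beta> j0, \<mu> j0) \<noteq> (\<beta> k0, \<mu> k0)"
  shows "entropy_production Q \<beta> \<mu> \<in> \<real> \<and> Re (entropy_production Q \<beta> \<mu>) > 0"
proof -
  obtain r where "r > 0" "entropy_production Q \<beta> \<mu> = complex_of_real r"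
    using regular_scattering_system.entropy_production_positive[OF assms(2-)] by blast
  thus ?thesis by simp
qed

end
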